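(* Let $N\ge2$ be an integer, let $1\le p\le N$ and let $q\ge1$ be such that $q<p^*=\frac{Np}{N-p}$ if $p<N$, and $q<\infty$ if $p=N$. Then for every $0<\gamma<1$ there exists a constant $C_{N,\gamma,p,q}>0$, depending only on $N,\gamma,p,q$, such that for every open set $\Omega\subseteq\mathbb{R}^N$ $$\lambda_{p,q}(\Omega)\le C_{N,\gamma,p,q}\left(\frac{1}{R_{p,\gamma}(\Omega)}\right)^{p-N+N\frac{p}{q}},$$ where it is intended that $\lambda_{p,q}(\Omega)=0$ whenever $R_{p,\gamma}(\Omega)=+\infty$. Furthermore, if $q\ge p$, there exists a constant $\sigma_{N,p,q}>0$, depending only on $N,p,q$, such that for every $0<\gamma<1$ and every open set $\Omega\subseteq\mathbb{R}^N$ $$\gamma\,\sigma_{N,p,q}\left(\frac{1}{R_{p,\gamma}(\Omega)}\right)^{p-N+N\frac{p}{q}}\le\lambda_{p,q}(\Omega).$$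
   Context: $B_r(x_0)=\{x\in\mathbb{R}^N: |x-x_0|<r\}$. $C^\infty_0(\Omega)$ is the space of infinitely differentiable functions with compact support in $\Omega$. The sharp Poincaré–Sobolev embedding constant of an open set $\Omega\subseteq\mathbb{R}^N$ is $$\lambda_{p,q}(\Omega)=\inf_{u\in C^\infty_0(\Omega)}\left\{\int_\Omega|\nabla u|^p\,dx : \|u\|^p_{L^q(\Omega)}=1\right\}.$$ For an open set $E\subseteq\mathbb{R}^N$ and compact $\Sigma\subseteq E$, $$\mathrm{cap}_p(\Sigma;E)=\inf_{\varphi\in C^\infty_0(E)}\left\{\int_E|\nabla\varphi|^p\,dx : \varphi\ge1\text{ on }\Sigma\right\}.$$ For $0<\gamma<1$, a compact set $\Sigma\subseteq\overline{B_r(x_0)}$ is $(p,\gamma)$-negligible if $\mathrm{cap}_p(\Sigma;B_{2r}(x_0))\le\gamma\,\mathrm{cap}_p(\overline{B_r(x_0)};B_{2r}(x_0))$. The capacitary inradius is $$R_{p,\gamma}(\Omega)=\sup\Big\{r>0 : \exists x_0\in\mathbb{R}^N\text{ such that }\overline{B_r(x_0)}\setminus\Omega\text{ is }(p,\gamma)\text{-negligible}\Big\}\in[0,+\infty].$$ Conventions: $1/(+\infty)=0$; for $\Omega=\emptyset$ one takes $\sup\emptyset=0$, $\inf\emptyset=+\infty$, $1/0=+\infty$. *)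

theory Defs
  imports "HOL-Analysis.Analysis"
begin

text \<open>
  \<open>Ck_function k u\<close>: \<open>u\<close> is of class \<open>C^k\<close> on the whole space. Every directional derivative of \<open>u\<close> is
  required to be of class \<open>C^(k-1)\<close>.
\<close>

fun Ck_function :: "nat \<Rightarrow> ('a::euclidean_space \<Rightarrow> real) \<Rightarrow> bool" where
  "Ck_function 0 u \<longleftrightarrow> continuous_on UNIV u"
| "Ck_function (Suc k) u \<longleftrightarrow>
     (\<forall>x. u differentiable (at x)) \<and> (\<forall>v. Ck_function k (\<lambda>x. frechet_derivative u (at x) v))"

text \<open>
  Functions with compact support in \<open>\<Omega>\<close> are identified with their extension by zero to the whole space.
\<close>

definition C0_infinity :: "'a::euclidean_space set \<Rightarrow> ('a \<Rightarrow> real) set" where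
  "C0_infinity \<Omega> =
     {u. (\<forall>k. Ck_function k u) \<and> compact (closure {x. u x \<noteq> 0}) \<and> closure {x. u x \<noteq> 0} \<subseteq> \<Omega>}"

definition grad :: "('a::euclidean_space \<Rightarrow> real) \<Rightarrow> 'a \<Rightarrow> 'a" where
  "grad u x = (THE D. GDERIV u x :> D)"

text \<open>
  Power of an extended nonnegative real, meant for exponents \<open>a > 0\<close> only: it sends \<open>0\<close> to \<open>0\<close>
  and \<open>\<infinity>\<close> to \<open>\<infinity>\<close>.
\<close>

definition ennpowr :: "ennreal \<Rightarrow> real \<Rightarrow> ennreal" where
  "ennpowr x a = (if x = \<infinity> then \<infinity> else ennreal (enn2real x powr a))"

definition dirichlet_energy :: "real \<Rightarrow> 'a::euclidean_space set \<Rightarrow> ('a \<Rightarrow> real) \<Rightarrow> ennreal" where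
  "dirichlet_energy p \<Omega> u = (\<integral>\<^sup>+x\<in>\<Omega>. ennreal (norm (grad u x) powr p) \<partial>lborel)"

definition Lq_norm :: "real \<Rightarrow> 'a::euclidean_space set \<Rightarrow> ('a \<Rightarrow> real) \<Rightarrow> ennreal" where
  "Lq_norm q \<Omega> u = ennpowr (\<integral>\<^sup>+x\<in>\<Omega>. ennreal (\<bar>u x\<bar> powr q) \<partial>lborel) (1 / q)"

text \<open>
  Infima and suprema are taken in \<^typ>\<open>ennreal\<close>, so that the infimum of the empty set is \<open>\<infinity>\<close>, its
  supremum is \<open>0\<close>, \<open>1 / \<infinity> = 0\<close> and \<open>1 / 0 = \<infinity>\<close>.
\<close>

definition poincare_sobolev_const :: "real \<Rightarrow> real \<Rightarrow> 'a::euclidean_space set \<Rightarrow> ennreal" where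
  "poincare_sobolev_const p q \<Omega> =
     (INF u \<in> {u \<in> C0_infinity \<Omega>. ennpowr (Lq_norm q \<Omega> u) p = 1}. dirichlet_energy p \<Omega> u)"

definition capacity :: "real \<Rightarrow> 'a::euclidean_space set \<Rightarrow> 'a set \<Rightarrow> ennreal" where
  "capacity p \<Sigma> E =
     (INF \<phi> \<in> {\<phi> \<in> C0_infinity E. \<forall>x\<in>\<Sigma>. \<phi> x \<ge> 1}. dirichlet_energy p E \<phi>)"

definition capacity_negligible ::
    "real \<Rightarrow> real \<Rightarrow> 'a::euclidean_space \<Rightarrow> real \<Rightarrow> 'a set \<Rightarrow> bool" where
  "capacity_negligible p \<gamma> x\<^sub>0 r \<Sigma> \<longleftrightarrow>
     compact \<Sigma> \<and> \<Sigma> \<subseteq> cball x\<^sub>0 r \<and>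
     capacity p \<Sigma> (ball x\<^sub>0 (2 * r)) \<le> ennreal \<gamma> * capacity p (cball x\<^sub>0 r) (ball x\<^sub>0 (2 * r))"

definition capacitary_inradius :: "real \<Rightarrow> real \<Rightarrow> 'a::euclidean_space set \<Rightarrow> ennreal" where
  "capacitary_inradius p \<gamma> \<Omega> =
     Sup (ennreal ` {r. r > 0 \<and> (\<exists>x\<^sub>0. capacity_negligible p \<gamma> x\<^sub>0 r (cball x\<^sub>0 r - \<Omega>))})"

end

theory Submission
  imports Defs
begin

text \<open>
  By scaling it suffices to consider balls of radius \<open>1\<close>.

  Lower bound: if \<open>u\<close> vanishes on \<open>\<Sigma> = cball z 1 - \<Omega>\<close> and \<open>m\<close> is its mean over \<open>cball z 2\<close>, then
  \<open>(1 - u / m) \<eta>\<close>, with \<open>\<eta>\<close> a cutoff, is admissible for the capacity of \<open>\<Sigma>\<close>, so that a lower bound on this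
  capacity controls \<open>m\<close> by the gradient of \<open>u\<close>. Together with a Poincare--Sobolev inequality on
  the ball this bounds the \<open>L^q\<close> norm of \<open>u\<close> on \<open>cball z 2\<close>; as \<open>q \<ge> p\<close>, integrating over all
  centres \<open>z\<close> (instead of choosing a covering) gives the global estimate.

  Upper bound: let \<open>\<phi>\<close> be nearly optimal for the capacity of \<open>cball 0 1 - \<Omega>\<close>, smoothly truncated to
  take values in \<open>[0, 1]\<close>. Then \<open>1 - \<phi>\<close>, cut off in the ball, is a test function for \<open>\<Omega>\<close> with bounded
  energy. It cannot be small in \<open>L^p\<close>: otherwise \<open>\<phi>\<close> could be raised to \<open>1\<close> on a slightly smaller
  ball, and then by a dilation on the whole ball, at almost no cost in energy, contradicting \<open>\<gamma> < 1\<close>.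
\<close>

subsection \<open>Smooth functions, gradients and test functions\<close>

text \<open>The constants must not depend on \<Omega>, so nothing rests on compactness or on
  capacitary minimisers: infima are only approached by smooth test functions and every estimate is
  quantitative. This also puts p = 1 on the same footing as p > 1. In the lower bound \<gamma>
  enters once, through the bound for |m|^p by a constant times energy / \<gamma>. The resulting
  \<gamma>^(-q/p) in the L^q estimate turns into exactly \<gamma> when the power p/q is taken at the
  end. The hypothesis q \<ge> p is what allows the powers (local energy)^(q/p) to be integrated: all
  but one power is bounded by the global energy. In the upper bound only the gap between \<gamma>
  and 1 is available. Truncation, raising to 1 and dilation must therefore each cost a factor
  arbitrarily close to 1, apart from a term controlled by the L^p size of 1 - \<phi>; the crude
  inequality (a + b)^p \<le> 2^p (a^p + b^p) would lose too much there. Since the test function has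
  values in [0, 1], a lower bound in L^p yields one in L^q whatever the order of p and q.\<close>

lemma Ck_function_SucI:
  assumes "\<And>x. (u has_derivative u' x) (at x)" and "\<And>v. Ck_function k (\<lambda>x. u' x v)"
  shows "Ck_function (Suc k) u"
proof -
  have "frechet_derivative u (at x) = u' x" for x
    using assms(1)[of x] frechet_derivative_at by metis
  then show ?thesis
    using assms by (auto simp: differentiable_def)
qed

lemma Ck_function_Suc_derivative:
  "Ck_function (Suc k) u \<Longrightarrow> (u has_derivative frechet_derivative u (at x)) (at x)"
  by (simp add: frechet_derivative_works)

lemma Ck_function_SucD: "Ck_function (Suc k) u \<Longrightarrow> Ck_function k u"
proof (induction k arbitrary: u)
  case 0
  then show ?case
    by (auto simp: continuous_on_eq_continuous_at intro: differentiable_imp_continuous_within)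
next
  case (Suc k)
  then show ?case by (metis Ck_function.simps(2))
qed

lemma Ck_function_const [simp]: "Ck_function k (\<lambda>x. c)"
proof (induction k arbitrary: c)
  case (Suc k)
  show ?case
    by (rule Ck_function_SucI[where u' = "\<lambda>x v. 0"]) (use Suc in auto)
qed auto

lemma Ck_function_inner: "Ck_function k (\<lambda>x. x \<bullet> a)"
proof (cases k)
  case (Suc j)
  show ?thesis unfolding Suc
    by (rule Ck_function_SucI[where u' = "\<lambda>x v. v \<bullet> a"]) (auto intro!: derivative_eq_intros)
qed (auto intro!: continuous_intros)

lemma Ck_function_add:
  "Ck_function k u \<Longrightarrow> Ck_function k v \<Longrightarrow> Ck_function k (\<lambda>x. u x + v x)"
proof (induction k arbitrary: u v)
  case (Suc k)
  show ?case
    by (rule Ck_function_SucI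
        [where u' = "\<lambda>x h. frechet_derivative u (at x) h + frechet_derivative v (at x) h"])
      (use Suc in \<open>auto intro!: has_derivative_add Suc.IH simp: frechet_derivative_works\<close>)
qed (auto intro: continuous_intros)

lemma Ck_function_mult:
  "Ck_function k u \<Longrightarrow> Ck_function k v \<Longrightarrow> Ck_function k (\<lambda>x. u x * v x)"
proof (induction k arbitrary: u v)
  case (Suc k)
  show ?case
    by (rule Ck_function_SucI
        [where u' = "\<lambda>x h. u x * frechet_derivative v (at x) h + frechet_derivative u (at x) h * v x"])
      (use Suc.prems Suc.prems[THEN Ck_function_SucD] in
       \<open>auto intro!: has_derivative_mult Ck_function_add Suc.IH simp: frechet_derivative_works\<close>)
qed (auto intro: continuous_intros)

lemma Ck_function_compose:
  fixes F :: "real \<Rightarrow> real"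
  shows "Ck_function k F \<Longrightarrow> Ck_function k u \<Longrightarrow> Ck_function k (\<lambda>x. F (u x))"
proof (induction k arbitrary: F u)
  case 0
  then show ?case using continuous_on_compose2[of UNIV F UNIV u] by auto
next
  case (Suc k)
  show ?case
  proof (rule Ck_function_SucI
      [where u' = "\<lambda>x h. frechet_derivative u (at x) h * frechet_derivative F (at (u x)) 1"])
    fix x
    have F: "(F has_derivative frechet_derivative F (at (u x))) (at (u x))"
      using Suc.prems(1) by (rule Ck_function_Suc_derivative)
    \<comment> \<open>A linear map on the reals is determined by its value at 1. In this form the
      derivative of the composition is a product, to which \<open>Ck_function_mult\<close> and the
      induction hypothesis for the derivative of \<open>F\<close> apply.\<close>
    have "frechet_derivative F (at (u x)) h = h * frechet_derivative F (at (u x)) 1" for h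
      using linear_cmul[OF has_derivative_linear[OF F], of h 1] by simp
    then have "(\<lambda>h. frechet_derivative F (at (u x)) (frechet_derivative u (at x) h)) =
        (\<lambda>h. frechet_derivative u (at x) h * frechet_derivative F (at (u x)) 1)"
      by blast
    with has_derivative_compose[OF Ck_function_Suc_derivative[OF Suc.prems(2)] F]
    show "((\<lambda>x. F (u x)) has_derivative
        (\<lambda>h. frechet_derivative u (at x) h * frechet_derivative F (at (u x)) 1)) (at x)"
      by simp
  next
    fix v
    show "Ck_function k (\<lambda>x. frechet_derivative u (at x) v * frechet_derivative F (at (u x)) 1)"
    proof (rule Ck_function_mult)
      show "Ck_function k (\<lambda>x. frechet_derivative u (at x) v)"
        using Suc.prems(2) by simp
      show "Ck_function k (\<lambda>x. frechet_derivative F (at (u x)) 1)"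
        by (rule Suc.IH[where F = "\<lambda>y. frechet_derivative F (at y) 1"])
          (use Suc.prems(1) Suc.prems(2)[THEN Ck_function_SucD] in simp_all)
    qed
  qed
qed

lemma Ck_function_affine:
  "Ck_function k u \<Longrightarrow> Ck_function k (\<lambda>x. u (a + r *\<^sub>R x))"
proof (induction k arbitrary: u)
  case 0
  then show ?case
    using continuous_on_compose2[of UNIV u UNIV "\<lambda>x. a + r *\<^sub>R x"]
    by (simp add: continuous_intros)
next
  case (Suc k)
  show ?case
  proof (rule Ck_function_SucI
      [where u' = "\<lambda>x h. frechet_derivative u (at (a + r *\<^sub>R x)) (r *\<^sub>R h)"])
    show "((\<lambda>x. u (a + r *\<^sub>R x)) has_derivative
        (\<lambda>h. frechet_derivative u (at (a + r *\<^sub>R x)) (r *\<^sub>R h))) (at x)" for x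
      by (rule has_derivative_compose[OF _ Ck_function_Suc_derivative[OF Suc.prems]])
        (auto intro!: derivative_eq_intros)
  qed (use Suc in auto)
qed

definition smooth :: "('a::euclidean_space \<Rightarrow> real) \<Rightarrow> bool" where
  "smooth u \<longleftrightarrow> (\<forall>k. Ck_function k u)"

lemma smooth_const: "smooth (\<lambda>x. c)"
  and smooth_inner: "smooth (\<lambda>x. x \<bullet> a)"
  and smooth_add: "smooth u \<Longrightarrow> smooth v \<Longrightarrow> smooth (\<lambda>x. u x + v x)"
  and smooth_mult: "smooth u \<Longrightarrow> smooth v \<Longrightarrow> smooth (\<lambda>x. u x * v x)"
  and smooth_compose: "smooth F \<Longrightarrow> smooth u \<Longrightarrow> smooth (\<lambda>x. F (u x))"
  and smooth_affine: "smooth u \<Longrightarrow> smooth (\<lambda>x. u (b + r *\<^sub>R x))"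
  by (auto simp: smooth_def Ck_function_inner Ck_function_add Ck_function_mult
      Ck_function_compose Ck_function_affine)

lemma smooth_diff: "smooth u \<Longrightarrow> smooth v \<Longrightarrow> smooth (\<lambda>x. u x - v x)"
  using smooth_add[OF _ smooth_mult[OF smooth_const[of "-1"]]] by force

lemma smooth_sum: "(\<And>i. i \<in> I \<Longrightarrow> smooth (f i)) \<Longrightarrow> smooth (\<lambda>x. \<Sum>i\<in>I. f i x)"
  by (induction I rule: infinite_finite_induct) (auto intro: smooth_const smooth_add)

lemma smooth_norm_sq: "smooth (\<lambda>x::'a::euclidean_space. (norm x)\<^sup>2)"
proof -
  have "(norm x)\<^sup>2 = (\<Sum>b\<in>Basis. (x \<bullet> b) * (x \<bullet> b))" for x :: 'a
    by (simp add: power2_norm_eq_inner euclidean_inner[of x x])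
  then show ?thesis
    by (auto intro!: smooth_sum smooth_mult smooth_inner)
qed

lemma smooth_has_derivative: "smooth u \<Longrightarrow> (u has_derivative frechet_derivative u (at x)) (at x)"
  unfolding smooth_def using Ck_function_Suc_derivative by blast

lemma smooth_continuous_on: "smooth u \<Longrightarrow> continuous_on S u"
  unfolding smooth_def using Ck_function.simps(1) continuous_on_subset by blast

lemma smooth_derivative:
  "smooth u \<Longrightarrow> smooth (\<lambda>x. frechet_derivative u (at x) v)"
  unfolding smooth_def using Ck_function.simps(2) by blast

lemma smooth_if_DERIV:
  fixes F :: "real \<Rightarrow> real"
  assumes D: "\<And>x. (F has_real_derivative f x) (at x)" and f: "smooth f"
  shows "smooth F"
  unfolding smooth_def
proof
  fix k
  have "Ck_function (Suc k) F"
    by (rule Ck_function_SucI[where u' = "\<lambda>x v. f x * v"])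
      (use assms in \<open>auto simp: has_field_derivative_def smooth_def intro!: Ck_function_mult\<close>)
  then show "Ck_function k F" by (rule Ck_function_SucD)
qed

section \<open>Gradients\<close>

lemma grad_eqI: "GDERIV u x :> D \<Longrightarrow> grad u x = D"
  unfolding grad_def
proof (rule the_equality)
  fix D' assume "GDERIV u x :> D" "GDERIV u x :> D'"
  then have "(\<lambda>h. h \<bullet> D) = (\<lambda>h. h \<bullet> D')"
    unfolding gderiv_def by (rule has_derivative_unique)
  then show "D' = D"
    by (metis inner_commute vector_eq_ldot)
qed

lemma has_derivative_imp_GDERIV:
  fixes u :: "'a::euclidean_space \<Rightarrow> real"
  assumes "(u has_derivative u') (at x)"
  shows "GDERIV u x :> (\<Sum>b\<in>Basis. u' b *\<^sub>R b)"
proof -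
  have "u' h = h \<bullet> (\<Sum>b\<in>Basis. u' b *\<^sub>R b)" for h
  proof -
    have "u' h = u' (\<Sum>b\<in>Basis. (h \<bullet> b) *\<^sub>R b)"
      by (simp add: euclidean_representation)
    also have "\<dots> = (\<Sum>b\<in>Basis. (h \<bullet> b) * u' b)"
      using has_derivative_linear[OF assms] by (simp add: linear_sum linear_cmul)
    finally show ?thesis by (simp add: inner_sum_right mult.commute)
  qed
  then have "u' = (\<lambda>h. h \<bullet> (\<Sum>b\<in>Basis. u' b *\<^sub>R b))" by blast
  with assms show ?thesis unfolding gderiv_def by simp
qed

lemma smooth_GDERIV: "smooth u \<Longrightarrow> GDERIV u x :> grad u x"
  using has_derivative_imp_GDERIV[OF smooth_has_derivative] grad_eqI by metis

lemma continuous_on_grad: "smooth u \<Longrightarrow> continuous_on S (grad u)"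
proof -
  assume u: "smooth u"
  then have "grad u = (\<lambda>x. \<Sum>b\<in>Basis. frechet_derivative u (at x) b *\<^sub>R b)"
    using has_derivative_imp_GDERIV[OF smooth_has_derivative] grad_eqI by blast
  then show ?thesis
    using u by (auto intro!: continuous_intros smooth_continuous_on smooth_derivative)
qed

lemma grad_const: "grad (\<lambda>x. c) x = 0"
  by (rule grad_eqI) (rule GDERIV_const)

lemma grad_add: "smooth u \<Longrightarrow> smooth v \<Longrightarrow> grad (\<lambda>x. u x + v x) x = grad u x + grad v x"
  and grad_diff: "smooth u \<Longrightarrow> smooth v \<Longrightarrow> grad (\<lambda>x. u x - v x) x = grad u x - grad v x"
  and grad_mult: "smooth u \<Longrightarrow> smooth v \<Longrightarrow>
    grad (\<lambda>x. u x * v x) x = u x *\<^sub>R grad v x + v x *\<^sub>R grad u x"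
  by (auto intro!: grad_eqI GDERIV_add GDERIV_diff GDERIV_mult smooth_GDERIV)

lemma grad_compose:
  "(F has_real_derivative d) (at (u x)) \<Longrightarrow> smooth u \<Longrightarrow> grad (\<lambda>x. F (u x)) x = d *\<^sub>R grad u x"
  by (rule grad_eqI[OF GDERIV_DERIV_compose[OF smooth_GDERIV]])

lemma grad_affine:
  assumes "smooth u"
  shows "grad (\<lambda>x. u (a + r *\<^sub>R x)) x = r *\<^sub>R grad u (a + r *\<^sub>R x)"
proof (rule grad_eqI)
  have "((\<lambda>x. a + r *\<^sub>R x) has_derivative (\<lambda>h. r *\<^sub>R h)) (at x)"
    by (auto intro!: derivative_eq_intros)
  from has_derivative_compose[OF this smooth_GDERIV[OF assms, unfolded gderiv_def]]
  show "GDERIV (\<lambda>x. u (a + r *\<^sub>R x)) x :> r *\<^sub>R grad u (a + r *\<^sub>R x)"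
    unfolding gderiv_def by (simp add: inner_commute)
qed

lemma grad_eq_0_if_const_on_open:
  assumes "open S" "x \<in> S" "\<And>y. y \<in> S \<Longrightarrow> u y = c"
  shows "grad u x = 0"
proof (rule grad_eqI)
  have "((\<lambda>y. c) has_derivative (\<lambda>h. 0)) (at x)" by simp
  then have "(u has_derivative (\<lambda>h. 0)) (at x)"
    by (rule has_derivative_transform_within_open[OF _ assms(1,2)]) (simp add: assms(3))
  then show "GDERIV u x :> 0" unfolding gderiv_def by simp
qed

lemma grad_eq_0_outside_support: "x \<notin> closure {x. u x \<noteq> 0} \<Longrightarrow> grad u x = 0"
  by (rule grad_eq_0_if_const_on_open[where S = "- closure {x. u x \<noteq> 0}" and c = 0])
    (use closure_subset[of "{x. u x \<noteq> 0}"] in auto)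

lemma line_DERIV:
  assumes "smooth u"
  shows "((\<lambda>t. u (x + t *\<^sub>R h)) has_real_derivative (h \<bullet> grad u (x + t *\<^sub>R h))) (at t within T)"
proof -
  have "((\<lambda>t. x + t *\<^sub>R h) has_derivative (\<lambda>s. s *\<^sub>R h)) (at t within T)"
    by (auto intro!: derivative_eq_intros)
  from has_derivative_compose[OF this smooth_GDERIV[OF assms, unfolded gderiv_def]]
  show ?thesis
    by (simp add: has_field_derivative_def mult.commute[of _ "h \<bullet> _"])
qed

section \<open>Compactly supported test functions\<close>

lemma C0_infinity_smooth: "u \<in> C0_infinity \<Omega> \<Longrightarrow> smooth u"
  by (auto simp: C0_infinity_def smooth_def)

lemma C0_infinityI:
  assumes "smooth u" "compact K" "K \<subseteq> \<Omega>" "\<And>x. x \<notin> K \<Longrightarrow> u x = 0"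
  shows "u \<in> C0_infinity \<Omega>"
proof -
  have "closure {x. u x \<noteq> 0} \<subseteq> K"
    by (rule closure_minimal) (use assms compact_imp_closed in auto)
  moreover from this have "compact (closure {x. u x \<noteq> 0})"
    using compact_Int_closed[OF assms(2) closed_closure, of "{x. u x \<noteq> 0}"] by (simp add: Int_absorb1)
  ultimately show ?thesis
    using assms(1,3) unfolding C0_infinity_def smooth_def by blast
qed

text \<open>The clause on the gradient is what makes energies over \<Omega> and over the whole space
  interchangeable.\<close>

lemma C0_infinityE:
  assumes "u \<in> C0_infinity \<Omega>"
  obtains K where "compact K" "K \<subseteq> \<Omega>" "\<And>x. x \<notin> K \<Longrightarrow> u x = 0" "\<And>x. x \<notin> K \<Longrightarrow> grad u x = 0"
proof (rule that)
  show "compact (closure {x. u x \<noteq> 0})" "closure {x. u x \<noteq> 0} \<subseteq> \<Omega>"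
    using assms by (simp_all add: C0_infinity_def)
  show "u x = 0" if "x \<notin> closure {x. u x \<noteq> 0}" for x
    using that closure_subset[of "{x. u x \<noteq> 0}"] by blast
qed (rule grad_eq_0_outside_support)

lemma C0_infinity_zero:
  assumes "u \<in> C0_infinity \<Omega>" "x \<notin> \<Omega>" shows "u x = 0" "grad u x = 0"
  using C0_infinityE[OF assms(1)] assms(2) by (metis subsetD)+

lemma C0_infinity_mult:
  assumes "smooth f" "u \<in> C0_infinity \<Omega>" shows "(\<lambda>x. f x * u x) \<in> C0_infinity \<Omega>"
proof -
  obtain K where K: "compact K" "K \<subseteq> \<Omega>" "\<And>x. x \<notin> K \<Longrightarrow> u x = 0"
    using C0_infinityE[OF assms(2)] by metis
  show ?thesis
    by (rule C0_infinityI[OF smooth_mult[OF assms(1) C0_infinity_smooth[OF assms(2)]] K(1,2)]) (simp add: K)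
qed

lemma C0_infinity_bounded:
  assumes "u \<in> C0_infinity \<Omega>"
  obtains M where "0 < M" "\<And>x. \<bar>u x\<bar> \<le> M" "\<And>x. norm (grad u x) \<le> M"
proof -
  obtain K where K: "compact K" "K \<subseteq> \<Omega>"
    "\<And>x. x \<notin> K \<Longrightarrow> u x = 0" "\<And>x. x \<notin> K \<Longrightarrow> grad u x = 0"
    using C0_infinityE[OF assms] by metis
  have s: "smooth u" using assms by (rule C0_infinity_smooth)
  have "bounded (u ` K)" "bounded (grad u ` K)"
    using K(1) s by (auto intro!: compact_imp_bounded compact_continuous_image
        smooth_continuous_on continuous_on_grad)
  then obtain M1 M2 where M: "0 < M1" "\<And>x. x \<in> K \<Longrightarrow> \<bar>u x\<bar> \<le> M1"
    "0 < M2" "\<And>x. x \<in> K \<Longrightarrow> norm (grad u x) \<le> M2"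
    unfolding bounded_pos by auto
  show thesis
  proof
    show "0 < max M1 M2" using M by simp
    show "\<bar>u x\<bar> \<le> max M1 M2" for x using M K by (cases "x \<in> K") fastforce+
    show "norm (grad u x) \<le> max M1 M2" for x using M K by (cases "x \<in> K") fastforce+
  qed
qed

subsection \<open>Cutoff functions\<close>

text \<open>
  The family is closed under differentiation up to linear combinations, so that a single induction on
  the order proves all members smooth.
\<close>

definition flat_exp :: "nat \<Rightarrow> real \<Rightarrow> real" where
  "flat_exp n x = (if x > 0 then (1 / x) ^ n * exp (- (1 / x)) else 0)"

text \<open>From the right, the substitution y = 1 / x turns this into the decay of y^n / exp y at
  infinity; from the left the function is 0.\<close>

lemma flat_exp_tendsto_0: "(flat_exp n \<longlongrightarrow> 0) (at 0)"
proof -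
  have "((\<lambda>x::real. inverse x ^ n / exp (inverse x)) \<longlongrightarrow> 0) (at_right 0)"
    by (rule filterlim_compose[OF tendsto_power_div_exp_0 filterlim_inverse_at_top_right])
  then have "(flat_exp n \<longlongrightarrow> 0) (at_right 0)"
    by (rule Lim_transform_eventually)
      (auto simp: flat_exp_def eventually_at_filter exp_minus field_simps)
  moreover have "(flat_exp n \<longlongrightarrow> 0) (at_left 0)"
    by (rule tendsto_eventually) (auto simp: flat_exp_def eventually_at_filter)
  ultimately show ?thesis by (rule filterlim_split_at[rotated])
qed

lemma flat_exp_DERIV:
  "(flat_exp n has_real_derivative (flat_exp (n + 2) x - n * flat_exp (n + 1) x)) (at x)"
proof (cases x "0::real" rule: linorder_cases)
  case less
  have "((\<lambda>x. 0) has_real_derivative 0) (at x)" by simp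
  then have "(flat_exp n has_real_derivative 0) (at x)"
    by (rule has_field_derivative_transform_within_open[where S = "{..<0}"])
      (use less in \<open>auto simp: flat_exp_def\<close>)
  with less show ?thesis by (simp add: flat_exp_def)
next
  case equal
  \<comment> \<open>The difference quotient at 0 is \<open>flat_exp (n + 1) h\<close>, whose limit
    is known.\<close>
  have "((\<lambda>h. (flat_exp n h - flat_exp n 0) / (h - 0)) \<longlongrightarrow> 0) (at 0)"
    by (rule Lim_transform_eventually[OF flat_exp_tendsto_0[of "n + 1"]])
      (auto simp: flat_exp_def eventually_at_filter field_simps)
  then have "(flat_exp n has_real_derivative 0) (at 0)"
    by (simp add: has_field_derivative_iff)
  with equal show ?thesis by (simp add: flat_exp_def)
next
  case greater
  have "((\<lambda>x. (1 / x) ^ n * exp (- (1 / x))) has_real_derivative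
      (1 / x) ^ n * (exp (- (1 / x)) * (1 / x\<^sup>2)) + n * (1 / x) ^ (n - 1) * (- (1 / x\<^sup>2)) * exp (- (1 / x))) (at x)"
    using greater by (auto intro!: derivative_eq_intros simp: power2_eq_square)
  also have "(1 / x) ^ n * (exp (- (1 / x)) * (1 / x\<^sup>2)) + n * (1 / x) ^ (n - 1) * (- (1 / x\<^sup>2)) * exp (- (1 / x))
      = flat_exp (n + 2) x - n * flat_exp (n + 1) x"
    using greater by (cases n) (auto simp: flat_exp_def field_simps power2_eq_square)
  finally show ?thesis
    by (rule has_field_derivative_transform_within_open[where S = "{0<..}"])
      (use greater in \<open>auto simp: flat_exp_def\<close>)
qed

lemma Ck_function_flat_exp: "Ck_function k (flat_exp n)"
proof (induction k arbitrary: n)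
  case 0
  have "isCont (flat_exp n) x" for x
    using flat_exp_DERIV by (rule DERIV_isCont)
  then show ?case by (simp add: continuous_on_eq_continuous_at)
next
  case (Suc k)
  show ?case
  proof (rule Ck_function_SucI
      [where u' = "\<lambda>x v. (flat_exp (n + 2) x + (- real n) * flat_exp (n + 1) x) * v"])
    show "(flat_exp n has_derivative (*) (flat_exp (n + 2) x + - real n * flat_exp (n + 1) x)) (at x)" for x
      using flat_exp_DERIV[of n x] by (simp add: has_field_derivative_def)
  qed (intro Ck_function_mult Ck_function_add Ck_function_const Suc)
qed

lemma smooth_normalized_primitive:
  fixes k :: "real \<Rightarrow> real"
  assumes k: "smooth k" and nonneg: "\<And>t. 0 \<le> k t"
    and zero: "\<And>t. t \<le> 0 \<Longrightarrow> k t = 0" "\<And>t. b \<le> t \<Longrightarrow> k t = 0"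
    and b: "0 < b" and I: "integral {0..b} k > 0"
  obtains F where "smooth F" "\<And>x. x \<le> 0 \<Longrightarrow> F x = 0" "\<And>x. b \<le> x \<Longrightarrow> F x = 1"
    "\<And>x. 0 \<le> F x" "\<And>x. F x \<le> 1"
    "\<And>x. (F has_real_derivative k x / integral {0..b} k) (at x)"
proof -
  define J where "J x = integral {0..x} k" for x
  define F where "F x = J x / integral {0..b} k" for x
  have cont: "continuous_on S k" for S using k by (rule smooth_continuous_on)
  have int: "k integrable_on {x..y}" for x y
    using cont by (rule integrable_continuous_interval)
  \<comment> \<open>For negative \<open>y\<close> the interval in \<open>J y\<close> is empty and
    \<open>J y\<close> is 0. As \<open>k\<close> vanishes on the negative axis, any base point
    \<open>a \<le> 0\<close> gives the same values; differentiating \<open>J\<close> at a point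
    \<open>x \<le> 0\<close> requires a base point to the left of \<open>x\<close>.\<close>
  have shift: "integral {a..y} k = J y" if "a \<le> 0" "a \<le> y" for a y
  proof (cases "0 \<le> y")
    case True
    have "integral {a..0} k = integral {a..0} (\<lambda>x. 0)"
      by (rule integral_cong) (use zero in auto)
    with True Henstock_Kurzweil_Integration.integral_combine[OF that(1) True int] show ?thesis
      by (simp add: J_def)
  next
    case False
    have "integral {a..y} k = integral {a..y} (\<lambda>x. 0)"
      by (rule integral_cong) (use zero False in auto)
    with False show ?thesis by (simp add: J_def)
  qed
  have DJ: "(J has_real_derivative k x) (at x)" for x
  proof -
    define a where "a = min x 0 - 1"
    have "((\<lambda>y. integral {a..y} k) has_real_derivative k x) (at x within {a..x + 1})"
      by (rule integral_has_real_derivative[OF cont]) (auto simp: a_def)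
    then have "((\<lambda>y. integral {a..y} k) has_real_derivative k x) (at x)"
      by (subst (asm) at_within_interior) (auto simp: a_def)
    then show ?thesis
      by (rule has_field_derivative_transform_within_open[where S = "{a<..}"])
        (auto intro!: shift simp: a_def)
  qed
  have DF: "(F has_real_derivative k x / integral {0..b} k) (at x)" for x
    unfolding F_def by (intro DERIV_cdivide DJ)
  have F0: "F x = 0" if "x \<le> 0" for x
    using shift[of x x] that by (simp add: F_def)
  have F1: "F x = 1" if "b \<le> x" for x
  proof -
    have "integral {b..x} k = integral {b..x} (\<lambda>x. 0)"
      by (rule integral_cong) (use zero in auto)
    then have "J x = J b"
      using Henstock_Kurzweil_Integration.integral_combine[OF _ that int, of 0] b by (simp add: J_def)
    then show ?thesis using I by (simp add: F_def J_def)
  qed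
  have mono: "F x \<le> F y" if "x \<le> y" for x y
    by (rule DERIV_nonneg_imp_nondecreasing[OF that]) (use DF nonneg I in \<open>meson divide_nonneg_pos\<close>)
  show thesis
  proof
    show "smooth F"
    proof (rule smooth_if_DERIV[OF DF])
      show "smooth (\<lambda>x. k x / integral {0..b} k)"
        using smooth_mult[OF k smooth_const[of "1 / integral {0..b} k"]] by simp
    qed
    show "0 \<le> F x" for x using mono[of "min x 0" x] F0[of "min x 0"] by simp
    show "F x \<le> 1" for x using mono[of x "max x b"] F1[of "max x b"] by simp
  qed (use F0 F1 DF in auto)
qed

lemma smooth_step_exists:
  obtains S :: "real \<Rightarrow> real" where "smooth S" "\<And>x. x \<le> 0 \<Longrightarrow> S x = 0" "\<And>x. 1 \<le> x \<Longrightarrow> S x = 1"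
    "\<And>x. 0 \<le> S x" "\<And>x. S x \<le> 1"
proof -
  \<comment> \<open>The bump exp(-1/t) exp(-1/(1-t)), positive exactly between 0 and 1; the step is
    its normalised primitive.\<close>
  define k :: "real \<Rightarrow> real" where "k t = flat_exp 0 t * flat_exp 0 (1 + (-1) *\<^sub>R t)" for t
  have sm: "smooth k"
    unfolding k_def using Ck_function_flat_exp by (intro smooth_mult smooth_affine) (auto simp: smooth_def)
  have nn: "0 \<le> k t" for t by (auto simp: k_def flat_exp_def)
  have z: "t \<le> 0 \<Longrightarrow> k t = 0" "1 \<le> t \<Longrightarrow> k t = 0" for t by (auto simp: k_def flat_exp_def)
  have "integral {0..1} k \<noteq> 0"
  proof
    assume "integral {0..1} k = 0"
    then have "k (1/2) = 0"
      using integral_eq_0_iff[of 0 1 k] smooth_continuous_on[OF sm] nn by auto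
    then show False by (simp add: k_def flat_exp_def)
  qed
  moreover have "integral {0..1} k \<ge> 0"
    by (rule integral_nonneg) (use nn smooth_continuous_on[OF sm] in \<open>auto intro: integrable_continuous_interval\<close>)
  ultimately have I: "0 < integral {0..1} k" by linarith
  show thesis
    by (rule smooth_normalized_primitive[OF sm nn z zero_less_one I]) (assumption | rule that)+
qed

text \<open>A smooth substitute for \<open>min 1 (max 0 x)\<close>, obtained by integrating a
  plateau of height at most 1 and integral at least \<open>1 - 3 * \<delta>\<close>, so that the
  slope is at most the reciprocal of that integral. The value 1 is reached already at
  \<open>1 - \<delta>\<close>; this margin later gives a test function compact support inside
  \<Omega>.\<close>

lemma smooth_truncation_exists:
  assumes "0 < \<epsilon>"
  obtains K :: "real \<Rightarrow> real" and \<delta> K' where "smooth K" "0 < \<delta>" "\<delta> < 1"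
    "\<And>x. x \<le> 0 \<Longrightarrow> K x = 0" "\<And>x. 1 - \<delta> \<le> x \<Longrightarrow> K x = 1" "\<And>x. 0 \<le> K x" "\<And>x. K x \<le> 1"
    "\<And>x. (K has_real_derivative K' x) (at x)" "\<And>x. \<bar>K' x\<bar> \<le> 1 + \<epsilon>"
proof -
  \<comment> \<open>The second bound ensures
    \<open>1 \<le> (1 + \<epsilon>) * (1 - 3 * \<delta>)\<close>, which limits the slope; the first
    keeps the plateau \<open>{\<delta>..1 - 2 * \<delta>}\<close> nondegenerate.\<close>
  define \<delta> where "\<delta> = min (1/6) (\<epsilon> / (3 * (1 + \<epsilon>)))"
  have \<delta>: "0 < \<delta>" "\<delta> \<le> 1/6" using assms unfolding \<delta>_def by (simp, linarith)
  have "\<delta> \<le> \<epsilon> / (3 * (1 + \<epsilon>))" by (simp add: \<delta>_def)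
  then have "3 * \<delta> * (1 + \<epsilon>) \<le> \<epsilon>" using assms by (simp add: field_simps)
  then have key: "1 \<le> (1 + \<epsilon>) * (1 - 3 * \<delta>)" by (simp add: algebra_simps)
  obtain S :: "real \<Rightarrow> real" where S: "smooth S" "\<And>x. x \<le> 0 \<Longrightarrow> S x = 0" "\<And>x. 1 \<le> x \<Longrightarrow> S x = 1"
    "\<And>x. 0 \<le> S x" "\<And>x. S x \<le> 1"
    using smooth_step_exists by metis
  \<comment> \<open>The first factor rises between 0 and \<delta>, the second falls between
    \<open>1 - 2 * \<delta>\<close> and \<open>1 - \<delta>\<close>. The arguments are written in
    the shape expected by \<open>smooth_affine\<close>.\<close>
  define k where "k x = S (0 + (1 / \<delta>) *\<^sub>R x) * S ((1 - \<delta>) / \<delta> + (- 1 / \<delta>) *\<^sub>R x)" for x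
  have k_eq: "k x = S (x / \<delta>) * S ((1 - \<delta> - x) / \<delta>)" for x
    unfolding k_def by (simp add: diff_divide_distrib)
  have sm: "smooth k"
    unfolding k_def using S(1) by (intro smooth_mult smooth_affine)
  have nn: "0 \<le> k t" for t by (simp add: k_eq S)
  have le1: "k t \<le> 1" for t by (simp add: k_eq S mult_le_one)
  have z: "t \<le> 0 \<Longrightarrow> k t = 0" "1 - \<delta> \<le> t \<Longrightarrow> k t = 0" for t
    using \<delta> by (auto simp: k_eq S divide_nonpos_pos)
  have one: "k t = 1" if "\<delta> \<le> t" "t \<le> 1 - 2 * \<delta>" for t
    using \<delta> that by (simp add: k_eq S)
  have int: "k integrable_on {x..y}" for x y
    by (rule integrable_continuous_interval) (rule smooth_continuous_on[OF sm])
  have "1 - 3 * \<delta> = integral {\<delta>..1 - 2 * \<delta>} (\<lambda>x. 1::real)" using \<delta> by simp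
  also have "\<dots> = integral {\<delta>..1 - 2 * \<delta>} k"
    by (rule integral_cong) (use one in auto)
  also have "\<dots> \<le> integral {0..1 - \<delta>} k"
    by (rule integral_subset_le) (use \<delta> nn int in auto)
  finally have I: "1 - 3 * \<delta> \<le> integral {0..1 - \<delta>} k" .
  then have Ipos: "0 < integral {0..1 - \<delta>} k" using \<delta> by linarith
  obtain F where F: "smooth F" "\<And>x. x \<le> 0 \<Longrightarrow> F x = 0" "\<And>x. 1 - \<delta> \<le> x \<Longrightarrow> F x = 1"
    "\<And>x. 0 \<le> F x" "\<And>x. F x \<le> 1"
    "\<And>x. (F has_real_derivative k x / integral {0..1 - \<delta>} k) (at x)"
    by (rule smooth_normalized_primitive[OF sm nn z _ Ipos]) (use \<delta> in auto)
  show thesis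
  proof (rule that[OF F(1) _ _ F(2-6)])
    fix x
    have "k x \<le> (1 + \<epsilon>) * (1 - 3 * \<delta>)" using key le1[of x] by linarith
    also have "\<dots> \<le> (1 + \<epsilon>) * integral {0..1 - \<delta>} k" using I assms by (intro mult_left_mono) auto
    finally show "\<bar>k x / integral {0..1 - \<delta>} k\<bar> \<le> 1 + \<epsilon>"
      using Ipos nn[of x] by (simp add: field_simps)
  qed (use \<delta> in auto)
qed

text \<open>The profile is applied to the squared norm, which unlike the norm is smooth at the
  centre. The cutoff vanishes beyond an intermediate radius \<open>b < c\<close>, so its support is
  a compact subset of the open ball.\<close>

lemma ball_cutoff_exists:
  fixes z :: "'a::euclidean_space"
  assumes "0 < a" "a < c"
  obtains \<eta> where "smooth \<eta>" "\<And>x. 0 \<le> \<eta> x" "\<And>x. \<eta> x \<le> 1"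
    "\<And>x. x \<in> cball z a \<Longrightarrow> \<eta> x = 1" "\<eta> \<in> C0_infinity (ball z c)"
proof -
  obtain S :: "real \<Rightarrow> real" where S: "smooth S" "\<And>x. x \<le> 0 \<Longrightarrow> S x = 0" "\<And>x. 1 \<le> x \<Longrightarrow> S x = 1"
    "\<And>x. 0 \<le> S x" "\<And>x. S x \<le> 1"
    using smooth_step_exists by metis
  define b where "b = (a + c) / 2"
  have b: "a < b" "b < c" using assms by (auto simp: b_def)
  have d: "a\<^sup>2 < b\<^sup>2" using assms b by (intro power_strict_mono) auto
  define h where "h x = S (1 / (b\<^sup>2 - a\<^sup>2) * (b\<^sup>2 - (norm x)\<^sup>2))" for x :: 'a
  define \<eta> where "\<eta> x = h (- z + 1 *\<^sub>R x)" for x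
  have "smooth h"
    unfolding h_def by (intro smooth_compose[OF S(1)] smooth_mult smooth_diff smooth_const smooth_norm_sq)
  then have sm: "smooth \<eta>"
    unfolding \<eta>_def by (rule smooth_affine)
  have h1: "h x = 1" if "norm x \<le> a" for x
  proof -
    have "(norm x)\<^sup>2 \<le> a\<^sup>2" using that by (intro power_mono) auto
    then show ?thesis using d by (simp add: h_def S)
  qed
  have h0: "h x = 0" if "b \<le> norm x" for x
  proof -
    have "b\<^sup>2 \<le> (norm x)\<^sup>2" using that assms b by (intro power_mono) auto
    then show ?thesis using d by (simp add: h_def S divide_nonpos_pos)
  qed
  have \<eta>0: "\<eta> x = 0" if "x \<notin> cball z b" for x
    using that h0[of "x - z"] by (simp add: \<eta>_def dist_norm norm_minus_commute)
  show thesis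
  proof (rule that[OF sm])
    show "0 \<le> \<eta> x" "\<eta> x \<le> 1" for x by (simp_all add: \<eta>_def h_def S)
    show "\<eta> x = 1" if "x \<in> cball z a" for x
      using that h1[of "x - z"] by (simp add: \<eta>_def dist_norm norm_minus_commute)
    show "\<eta> \<in> C0_infinity (ball z c)"
      by (rule C0_infinityI[OF sm, of "cball z b"]) (use b \<eta>0 in auto)
  qed
qed

subsection \<open>A subcritical Poincare--Sobolev inequality on balls\<close>

lemma ennpowr_ennreal [simp]: "0 \<le> x \<Longrightarrow> ennpowr (ennreal x) a = ennreal (x powr a)"
  by (simp add: ennpowr_def)

lemma ennpowr_top [simp]: "ennpowr top a = top"
  by (simp add: ennpowr_def)

lemma ennpowr_0 [simp]: "ennpowr 0 a = 0"
  by (simp add: ennpowr_def)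

lemma ennpowr_mono: "x \<le> y \<Longrightarrow> 0 \<le> a \<Longrightarrow> ennpowr x a \<le> ennpowr y a"
  by (cases x rule: ennreal_cases; cases y rule: ennreal_cases) (auto intro: powr_mono2 simp: top_unique)

lemma ennpowr_mult:
  assumes "0 < a" shows "ennpowr (x * y) a = ennpowr x a * ennpowr y a"
proof (cases "x = top \<or> y = top")
  case False
  then obtain r s where "x = ennreal r" "0 \<le> r" "y = ennreal s" "0 \<le> s"
    by (metis ennreal_cases)
  then show ?thesis by (simp add: ennreal_mult[symmetric] powr_mult)
next
  case True
  have *: "ennpowr z a = 0 \<longleftrightarrow> z = 0" for z
    by (cases z rule: ennreal_cases) (auto simp: ennreal_eq_0_iff)
  from True show ?thesis
    by (cases "x = 0 \<or> y = 0") (auto simp: ennreal_mult_eq_top_iff ennreal_top_mult ennreal_mult_top *)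
qed

lemma ennpowr_mult_ennreal:
  "0 \<le> c \<Longrightarrow> ennpowr (ennreal c * x) a = ennreal (c powr a) * ennpowr x a" if "0 < a"
  using that by (simp add: ennpowr_mult)

lemma ennpowr_ennpowr: "ennpowr (ennpowr x a) b = ennpowr x (a * b)"
  by (cases x rule: ennreal_cases) (auto simp: powr_powr)

text \<open>True for exponents of any sign because \<open>ennpowr\<close> fixes 0 and
  \<open>top\<close> whatever the exponent. It will split q / p into (q / p - 1) + 1, where the
  first summand is 0 when q = p.\<close>

lemma ennpowr_add: "ennpowr x (a + b) = ennpowr x a * ennpowr x b"
  by (cases x rule: ennreal_cases) (auto simp: powr_add ennreal_mult)

lemma ennpowr_1 [simp]: "ennpowr x 1 = x"
  by (cases x rule: ennreal_cases) auto

lemma borel_measurable_ennpowr [measurable]: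
  assumes "f \<in> borel_measurable M" shows "(\<lambda>x. ennpowr (f x) a) \<in> borel_measurable M"
  unfolding ennpowr_def using assms by measurable

text \<open>The tangent line of the convex power at \<open>m\<close>, rearranged so that the outer
  inequality contains no subtraction of \<open>x\<close> and can be transferred to
  \<open>ennreal\<close>.\<close>

lemma powr_above_tangent:
  assumes "1 \<le> q" "0 \<le> x" "0 < (m::real)"
  shows "q * m powr (q - 1) * x \<le> x powr q + (q - 1) * m powr q"
proof (cases "x = 0")
  case False
  have "((\<lambda>x. x powr q) has_field_derivative q * m powr (q - 1)) (at m within {0<..})"
    using assms by (auto intro!: derivative_eq_intros)
  then have "x powr q - m powr q \<ge> q * m powr (q - 1) * (x - m)"
    by (rule convex_on_imp_above_tangent[OF powr_convex, rotated -1])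
      (use assms False in \<open>auto simp: interior_open\<close>)
  moreover have "q * m powr (q - 1) * (x - m) = q * m powr (q - 1) * x - q * m powr q"
    using assms by (simp add: powr_diff right_diff_distrib)
  ultimately show ?thesis by (simp add: left_diff_distrib)
qed (use assms in simp)

text \<open>The tangent inequality is integrated with a free point \<open>m\<close>, and then
  \<open>m\<close> is taken to be the weighted mean \<open>T / W\<close>, which is the optimal
  choice. The weight is not normalised, whence the factor \<open>W powr (q - 1)\<close>.\<close>

lemma nn_integral_Jensen:
  assumes [measurable]: "w \<in> borel_measurable M" "f \<in> borel_measurable M"
    and W: "(\<integral>\<^sup>+x. w x \<partial>M) = ennreal W" "0 < W" and q: "1 \<le> q"
  shows "ennpowr (\<integral>\<^sup>+x. w x * f x \<partial>M) q \<le> ennreal (W powr (q - 1)) * (\<integral>\<^sup>+x. w x * ennpowr (f x) q \<partial>M)"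
proof -
  have above: "ennreal (q * m powr (q - 1)) * y \<le> ennpowr y q + ennreal ((q - 1) * m powr q)"
    if "0 < m" for m y
  proof (cases y rule: ennreal_cases)
    case (real r)
    have "ennreal (q * m powr (q - 1) * r) \<le> ennreal (r powr q + (q - 1) * m powr q)"
      using powr_above_tangent[OF q real(1) that] by (rule ennreal_leI)
    with real q show ?thesis by (simp add: ennreal_mult)
  qed auto
  have int: "ennreal (q * m powr (q - 1)) * (\<integral>\<^sup>+x. w x * f x \<partial>M) \<le>
      (\<integral>\<^sup>+x. w x * ennpowr (f x) q \<partial>M) + ennreal ((q - 1) * m powr q * W)" if "0 < m" for m
  proof -
    have "ennreal (q * m powr (q - 1)) * (\<integral>\<^sup>+x. w x * f x \<partial>M)
        = (\<integral>\<^sup>+x. w x * (ennreal (q * m powr (q - 1)) * f x) \<partial>M)"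
      by (subst nn_integral_cmult[symmetric]) (auto simp: mult_ac)
    also have "\<dots> \<le> (\<integral>\<^sup>+x. w x * ennpowr (f x) q + w x * ennreal ((q - 1) * m powr q) \<partial>M)"
      unfolding distrib_left[symmetric] using above[OF that] by (intro nn_integral_mono mult_left_mono) auto
    also have "\<dots> = (\<integral>\<^sup>+x. w x * ennpowr (f x) q \<partial>M) + ennreal W * ennreal ((q - 1) * m powr q)"
      by (simp add: nn_integral_add nn_integral_multc W)
    finally show ?thesis using W q by (simp add: ennreal_mult[symmetric] mult_ac)
  qed
  show ?thesis
  proof (cases "\<integral>\<^sup>+x. w x * f x \<partial>M" rule: ennreal_cases)
    \<comment> \<open>An infinite first moment forces an infinite q-th moment, as the tangent at 1
      shows.\<close>
    case top
    have "(\<integral>\<^sup>+x. w x * ennpowr (f x) q \<partial>M) = top"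
      using int[of 1] q unfolding top by (auto simp: ennreal_mult_top top_unique)
    then show ?thesis using W by (simp add: ennreal_mult_top)
  next
    case (real T)
    show ?thesis
    proof (cases "T = 0")
      case False
      define m where "m = T / W"
      have m: "0 < m" "T = m * W" using real False W by (auto simp: m_def)
      show ?thesis
      proof (cases "\<integral>\<^sup>+x. w x * ennpowr (f x) q \<partial>M" rule: ennreal_cases)
        case r: (real R)
        have mq: "m powr (q - 1) * m = m powr q" using m by (simp add: powr_diff)
        have "ennreal (q * m powr (q - 1) * T) \<le> ennreal (R + (q - 1) * m powr q * W)"
          using int[OF m(1)] real r q m W by (simp add: ennreal_mult[symmetric] ennreal_plus[symmetric] del: ennreal_plus)
        then have "q * m powr (q - 1) * T \<le> R + (q - 1) * m powr q * W"
          using r q m W by (subst (asm) ennreal_le_iff) auto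
        then have "m powr q * W \<le> R"
          using m by (simp add: mq[symmetric] algebra_simps)
        then have "W powr (q - 1) * (m powr q * W) \<le> W powr (q - 1) * R"
          by (rule mult_left_mono) auto
        moreover have "W powr (q - 1) * (m powr q * W) = T powr q"
          using W m by (simp add: powr_mult powr_diff)
        ultimately show ?thesis using real r by (simp add: ennreal_mult[symmetric])
      qed (use W in \<open>simp add: ennreal_mult_top\<close>)
    qed (use real in simp)
  qed
qed

section \<open>Change of variables, Fubini and integrals along segments\<close>

lemma nn_integral_affine:
  fixes g :: "'a::euclidean_space \<Rightarrow> ennreal"
  assumes [measurable]: "g \<in> borel_measurable borel" and "c \<noteq> 0"
  shows "(\<integral>\<^sup>+x. g (a + c *\<^sub>R x) \<partial>lborel) = ennreal (\<bar>c\<bar> powr (- real DIM('a))) * (\<integral>\<^sup>+x. g x \<partial>lborel)"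
proof -
  have "(\<integral>\<^sup>+x. g x \<partial>lborel) = \<bar>c\<bar> ^ DIM('a) * (\<integral>\<^sup>+x. g (a + c *\<^sub>R x) \<partial>lborel)"
    by (subst lborel_affine[OF assms(2), of a])
      (simp add: nn_integral_density nn_integral_distr nn_integral_cmult)
  also have "ennreal (\<bar>c\<bar> powr (- real DIM('a))) * \<dots> = (\<integral>\<^sup>+x. g (a + c *\<^sub>R x) \<partial>lborel)"
    using assms(2)
    by (simp add: mult.assoc[symmetric] ennreal_mult[symmetric] powr_minus powr_realpow ennreal_1)
  finally show ?thesis by simp
qed

lemma nn_integral_lborel_swap:
  fixes f :: "'a::euclidean_space \<Rightarrow> 'b::euclidean_space \<Rightarrow> ennreal"
  assumes "case_prod f \<in> borel_measurable (borel \<Otimes>\<^sub>M borel)"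
  shows "(\<integral>\<^sup>+y. (\<integral>\<^sup>+x. f x y \<partial>lborel) \<partial>lborel) = (\<integral>\<^sup>+x. (\<integral>\<^sup>+y. f x y \<partial>lborel) \<partial>lborel)"
  by (rule pair_sigma_finite.Fubini') (use assms in \<open>auto intro: pair_sigma_finite.intro sigma_finite_lborel\<close>)

text \<open>The fundamental theorem of calculus on the segment from \<open>x\<close> to
  \<open>y\<close>. The parameter 0 is excluded, which changes nothing almost everywhere, so that
  negative powers of \<open>t\<close> can be inserted later.\<close>

lemma abs_diff_le_nn_integral_grad:
  assumes u: "smooth u" and d: "dist x y \<le> d"
  shows "ennreal \<bar>u x - u y\<bar> \<le>
    ennreal d * (\<integral>\<^sup>+t. indicator {0<..1} t * ennreal (norm (grad u (x + t *\<^sub>R (y - x)))) \<partial>lborel)"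
proof -
  define h where "h = y - x"
  define g where "g t = h \<bullet> grad u (x + t *\<^sub>R h)" for t
  have cont: "continuous_on UNIV g"
    unfolding g_def by (intro continuous_intros continuous_on_compose2[OF continuous_on_grad[OF u, of UNIV]]) auto
  have cont': "continuous_on UNIV (\<lambda>t::real. norm (grad u (x + t *\<^sub>R h)))"
    by (intro continuous_intros continuous_on_compose2[OF continuous_on_grad[OF u, of UNIV]]) auto
  have [measurable]: "(\<lambda>t::real. norm (grad u (x + t *\<^sub>R h))) \<in> borel_measurable borel"
    using cont' by (rule borel_measurable_continuous_onI)
  have "has_bochner_integral lborel (\<lambda>t. g t * indicator {0..1} t) (u (x + 1 *\<^sub>R h) - u (x + 0 *\<^sub>R h))"
    by (rule has_bochner_integral_FTC_Icc_real)
      (use cont line_DERIV[OF u, of x h] in \<open>auto simp: g_def continuous_on_eq_continuous_at\<close>)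
  then have I: "integrable lborel (\<lambda>t. g t * indicator {0..1} t)"
    "(\<integral>t. g t * indicator {0..1} t \<partial>lborel) = u y - u x"
    by (auto simp: has_bochner_integral_iff h_def)
  have "ennreal \<bar>u x - u y\<bar> = ennreal (norm (\<integral>t. g t * indicator {0..1} t \<partial>lborel))"
    unfolding I(2) by (simp add: abs_minus_commute)
  also have "\<dots> \<le> (\<integral>\<^sup>+t. ennreal (norm (g t * indicator {0..1} t)) \<partial>lborel)"
    using I(1) by (rule integral_norm_bound_ennreal)
  also have "\<dots> \<le> (\<integral>\<^sup>+t. ennreal d * (indicator {0<..1} t * ennreal (norm (grad u (x + t *\<^sub>R h)))) \<partial>lborel)"
  proof (rule nn_integral_mono_AE)
    have "AE t in lborel. t \<noteq> (0::real)"
      using AE_lborel_singleton[of "0::real"] by auto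
    then show "AE t in lborel. ennreal (norm (g t * indicator {0..1} t))
        \<le> ennreal d * (indicator {0<..1} t * ennreal (norm (grad u (x + t *\<^sub>R h))))"
    proof eventually_elim
      case (elim t)
      have "\<bar>g t\<bar> \<le> norm h * norm (grad u (x + t *\<^sub>R h))"
        unfolding g_def by (rule Cauchy_Schwarz_ineq2)
      also have "\<dots> \<le> d * norm (grad u (x + t *\<^sub>R h))"
        using d by (intro mult_right_mono) (auto simp: h_def dist_norm norm_minus_commute)
      finally have "ennreal \<bar>g t\<bar> \<le> ennreal (d * norm (grad u (x + t *\<^sub>R h)))" by (rule ennreal_leI)
      moreover have "0 \<le> d" using d zero_le_dist order_trans by blast
      ultimately show ?case using elim by (auto simp: indicator_def ennreal_mult)
    qed
  qed
  also have "\<dots> = ennreal d * (\<integral>\<^sup>+t. indicator {0<..1} t * ennreal (norm (grad u (x + t *\<^sub>R h))) \<partial>lborel)"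
    by (rule nn_integral_cmult) measurable
  finally show ?thesis unfolding h_def .
qed


text \<open>
  Write \<open>u x - u y\<close> as an integral of the gradient along the segment and apply Jensen's inequality in
  the parameter \<open>t\<close>, with weight \<open>t powr (- \<alpha>)\<close> for \<open>\<alpha> = DIM('a) * (1 / p - 1 / q)\<close>, and then in \<open>y\<close>. With
  this weight the powers of \<open>t\<close> cancel exactly; \<open>\<alpha> < 1\<close> makes the weight integrable.
\<close>

lemma poincare_sobolev_ball:
  fixes p q \<rho> :: real
  assumes p: "1 \<le> p" and pq: "p \<le> q" and sub: "DIM('a) * (1 / p - 1 / q) < 1" and \<rho>: "0 < \<rho>"
  obtains C where "0 < C" "\<And>(u :: 'a::euclidean_space \<Rightarrow> real) z. smooth u \<Longrightarrow>
    (\<integral>\<^sup>+x\<in>cball z \<rho>. ennpowr (\<integral>\<^sup>+y\<in>cball z \<rho>. ennreal \<bar>u x - u y\<bar> \<partial>lborel) q \<partial>lborel)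
      \<le> ennreal C * ennpowr (\<integral>\<^sup>+x\<in>cball z \<rho>. ennreal (norm (grad u x) powr p) \<partial>lborel) (q / p)"
proof -
  define N where "N = real DIM('a)"
  define \<alpha> where "\<alpha> = N * (1 / p - 1 / q)"
  have \<alpha>: "0 \<le> \<alpha>" "\<alpha> < 1"
    using sub p pq by (auto simp: \<alpha>_def N_def field_simps)
  have \<alpha>q: "\<alpha> * q = N * (q / p - 1)"
    using p pq by (simp add: \<alpha>_def field_simps)
  define V where "V = unit_ball_vol N * \<rho> ^ DIM('a)"
  have V: "0 < V" using \<rho> by (simp add: V_def N_def)
  have VB: "emeasure lborel (cball z \<rho>) = ennreal V" for z :: 'a
    using emeasure_cball[of \<rho> z] \<rho> by (simp add: V_def N_def)
  define w where "w t = ennreal (t powr (- \<alpha>)) * indicator {0<..1} t" for t :: real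
  have [measurable]: "w \<in> borel_measurable borel" unfolding w_def by measurable
  define W where "W = 1 / (1 - \<alpha>)"
  have W: "0 < W" using \<alpha> by (simp add: W_def)
  have intw: "(\<integral>\<^sup>+t. w t \<partial>lborel) = ennreal W"
  proof -
    have "w t = ennreal (indicator {0..1} t * t powr (- \<alpha>))" for t
      by (auto simp: w_def indicator_def)
    then show ?thesis
      using nn_integral_has_integral_lebesgue[OF _ has_integral_powr_from_0[of "- \<alpha>" 1]] \<alpha>
      by (simp add: W_def)
  qed
  \<comment> \<open>\<open>C1\<close> collects the length of the segments and Jensen's inequality in
    \<open>t\<close>; \<open>C2\<close> comes from Jensen's inequality in \<open>y\<close>, used
    with exponent p and then raised to q / p.\<close>
  define C1 where "C1 = (2 * \<rho>) powr q * W powr (q - 1)"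
  define C2 where "C2 = V powr ((p - 1) * (q / p))"
  define C where "C = C1 * C2 * W * (V * 2 powr N)"
  have C12: "0 < C1" "0 < C2" using \<rho> W V by (auto simp: C1_def C2_def)
  show thesis
  proof (rule that[of C])
    show "0 < C" using C12 W V by (simp add: C_def)
  next
    fix u :: "'a \<Rightarrow> real" and z :: 'a
    assume u: "smooth u"
    define B where "B = cball z \<rho>"
    have [measurable]: "B \<in> sets borel" by (simp add: B_def)
    have Vind: "(\<integral>\<^sup>+y. indicator B y \<partial>lborel) = ennreal V" using VB by (simp add: B_def)
    \<comment> \<open>Extending the gradient by 0 outside the ball allows substitutions over the
      whole space. Nothing is lost, because segments between points of the convex set
      \<open>B\<close> stay in \<open>B\<close>.\<close>
    define h where "h x = ennreal (norm (grad u x)) * indicator B x" for x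
    have "(\<lambda>x. norm (grad u x)) \<in> borel_measurable borel"
      by (intro borel_measurable_continuous_onI continuous_intros continuous_on_grad u)
    then have [measurable]: "h \<in> borel_measurable borel" unfolding h_def by measurable
    have seg: "x + t *\<^sub>R (y - x) \<in> B" if "x \<in> B" "y \<in> B" "t \<in> {0<..1}" for x y t
      using convexD_alt[of B x y t] that by (auto simp: B_def algebra_simps)
    define F where "F = (\<integral>\<^sup>+x. ennpowr (h x) p \<partial>lborel)"
    have F_eq: "(\<integral>\<^sup>+x\<in>B. ennreal (norm (grad u x) powr p) \<partial>lborel) = F"
      unfolding F_def by (intro nn_integral_cong) (auto simp: h_def indicator_def)
    define a where "a t x = (\<integral>\<^sup>+y. indicator B y * h (x + t *\<^sub>R (y - x)) \<partial>lborel)" for t x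
    define b where "b t x = (\<integral>\<^sup>+y. indicator B y * ennpowr (h (x + t *\<^sub>R (y - x))) p \<partial>lborel)" for t x
    have [measurable]: "case_prod a \<in> borel_measurable (borel \<Otimes>\<^sub>M borel)"
      "case_prod b \<in> borel_measurable (borel \<Otimes>\<^sub>M borel)"
      unfolding a_def b_def by measurable
    have D1: "(\<integral>\<^sup>+y\<in>B. ennreal \<bar>u x - u y\<bar> \<partial>lborel) \<le>
        ennreal (2 * \<rho>) * (\<integral>\<^sup>+t. w t * (ennreal (t powr \<alpha>) * a t x) \<partial>lborel)" if x: "x \<in> B" for x
    proof -
      have "(\<integral>\<^sup>+y\<in>B. ennreal \<bar>u x - u y\<bar> \<partial>lborel) \<le> (\<integral>\<^sup>+y. ennreal (2 * \<rho>) *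
          (\<integral>\<^sup>+t. indicator {0<..1} t * (indicator B y * h (x + t *\<^sub>R (y - x))) \<partial>lborel) \<partial>lborel)"
      proof (rule nn_integral_mono)
        fix y
        show "ennreal \<bar>u x - u y\<bar> * indicator B y \<le> ennreal (2 * \<rho>) *
          (\<integral>\<^sup>+t. indicator {0<..1} t * (indicator B y * h (x + t *\<^sub>R (y - x))) \<partial>lborel)"
        proof (cases "y \<in> B")
          case True
          have "dist x y \<le> 2 * \<rho>"
            using x True dist_triangle[of x y z] by (auto simp: B_def dist_commute)
          from abs_diff_le_nn_integral_grad[OF u this]
          have "ennreal \<bar>u x - u y\<bar> \<le> ennreal (2 * \<rho>) *
            (\<integral>\<^sup>+t. indicator {0<..1} t * ennreal (norm (grad u (x + t *\<^sub>R (y - x)))) \<partial>lborel)" .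
          also have "(\<integral>\<^sup>+t. indicator {0<..1} t * ennreal (norm (grad u (x + t *\<^sub>R (y - x)))) \<partial>lborel)
              = (\<integral>\<^sup>+t. indicator {0<..1} t * (indicator B y * h (x + t *\<^sub>R (y - x))) \<partial>lborel)"
            by (rule nn_integral_cong) (use seg[OF x True] True in \<open>auto simp: h_def indicator_def\<close>)
          finally show ?thesis using True by simp
        qed simp
      qed
      also have "\<dots> = ennreal (2 * \<rho>) *
          (\<integral>\<^sup>+y. (\<integral>\<^sup>+t. indicator {0<..1} t * (indicator B y * h (x + t *\<^sub>R (y - x))) \<partial>lborel) \<partial>lborel)"
        by (rule nn_integral_cmult) measurable
      also have "(\<integral>\<^sup>+y. (\<integral>\<^sup>+t. indicator {0<..1} t * (indicator B y * h (x + t *\<^sub>R (y - x))) \<partial>lborel) \<partial>lborel)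
          = (\<integral>\<^sup>+t. (\<integral>\<^sup>+y. indicator {0<..1} t * (indicator B y * h (x + t *\<^sub>R (y - x))) \<partial>lborel) \<partial>lborel)"
        by (rule nn_integral_lborel_swap) measurable
      also have "\<dots> = (\<integral>\<^sup>+t. indicator {0<..1} t * a t x \<partial>lborel)"
        unfolding a_def by (intro nn_integral_cong nn_integral_cmult) measurable
      also have "\<dots> = (\<integral>\<^sup>+t. w t * (ennreal (t powr \<alpha>) * a t x) \<partial>lborel)"
        by (rule nn_integral_cong)
          (auto simp: w_def indicator_def mult.assoc[symmetric] ennreal_mult[symmetric] powr_add[symmetric])
      finally show ?thesis .
    qed
    have b_le: "b t x \<le> ennreal (t powr (- N)) * F" if "x \<in> B" "t \<in> {0<..1}" for t x
    proof -
      have "b t x \<le> (\<integral>\<^sup>+y. ennpowr (h ((1 - t) *\<^sub>R x + t *\<^sub>R y)) p \<partial>lborel)"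
        unfolding b_def by (intro nn_integral_mono) (auto simp: indicator_def algebra_simps)
      also have "\<dots> = ennreal (t powr (- N)) * F"
        unfolding F_def N_def using that by (subst nn_integral_affine) auto
      finally show ?thesis .
    qed
    \<comment> \<open>Jensen in \<open>y\<close> leaves (b t x)^(q/p). One factor
      \<open>b t x\<close> is kept for the integration in \<open>x\<close>; the remaining power q/p
      - 1 is bounded uniformly by \<open>b_le\<close>, and the negative power of \<open>t\<close>
      arising there is compensated by t^(\<alpha> q).\<close>
    have a_le: "ennpowr (ennreal (t powr \<alpha>) * a t x) q \<le> ennreal C2 * ennpowr F (q / p - 1) * b t x"
      if "x \<in> B" "t \<in> {0<..1}" for t x
    proof -
      have "ennpowr (ennreal (t powr \<alpha>) * a t x) q = ennreal (t powr (\<alpha> * q)) * ennpowr (ennpowr (a t x) p) (q / p)"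
        using p pq by (simp add: ennpowr_mult_ennreal powr_powr ennpowr_ennpowr)
      also have "ennpowr (a t x) p \<le> ennreal (V powr (p - 1)) * b t x"
        unfolding a_def b_def using V p by (intro nn_integral_Jensen Vind) auto
      then have "ennpowr (ennpowr (a t x) p) (q / p) \<le> ennpowr (ennreal (V powr (p - 1)) * b t x) (q / p)"
        using p pq by (intro ennpowr_mono) auto
      also have "\<dots> = ennreal C2 * (ennpowr (b t x) (q / p - 1) * b t x)"
        using p pq V ennpowr_add[of "b t x" "q / p - 1" 1]
        by (simp add: ennpowr_mult_ennreal powr_powr C2_def)
      also have "\<dots> \<le> ennreal C2 * (ennpowr (ennreal (t powr (- N)) * F) (q / p - 1) * b t x)"
        using b_le[OF that] p pq by (intro mult_left_mono mult_right_mono ennpowr_mono) auto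
      also have "ennreal (t powr (\<alpha> * q)) * \<dots> \<le> ennreal C2 * ennpowr F (q / p - 1) * b t x"
      proof (cases "q = p")
        \<comment> \<open>Here q / p - 1 = 0, and the product rule
          \<open>ennpowr_mult_ennreal\<close> is stated for positive exponents only.\<close>
        case True
        have "ennpowr (ennreal (t powr (- N)) * F) 0 \<le> ennpowr F 0"
          using that by (cases F rule: ennreal_cases) (auto simp: ennreal_mult[symmetric] ennreal_mult_top)
        then show ?thesis using True that p
          by (auto simp: \<alpha>_def mult.assoc intro!: mult_left_mono mult_right_mono)
      next
        case False
        then have "ennpowr (ennreal (t powr (- N)) * F) (q / p - 1)
            = ennreal (t powr (- N * (q / p - 1))) * ennpowr F (q / p - 1)"
          using p pq by (subst ennpowr_mult_ennreal) (auto simp: powr_powr)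
        moreover have "ennreal (t powr (\<alpha> * q)) * ennreal (t powr (- N * (q / p - 1))) = 1"
          using that by (simp add: ennreal_mult[symmetric] powr_add[symmetric] \<alpha>q)
        ultimately have "ennreal (t powr (\<alpha> * q)) * ennpowr (ennreal (t powr (- N)) * F) (q / p - 1)
            = ennpowr F (q / p - 1)"
          by (simp add: mult.assoc[symmetric])
        then have "ennreal (t powr (\<alpha> * q)) * (ennreal C2 * (ennpowr (ennreal (t powr (- N)) * F) (q / p - 1) * b t x))
            = ennreal C2 * ennpowr F (q / p - 1) * b t x"
          by (metis mult.assoc mult.left_commute)
        then show ?thesis by simp
      qed
      finally show ?thesis by (simp add: mult_left_mono)
    qed
    \<comment> \<open>The intermediate point is (1 - t) x + t y. One of the two coefficients is at
      least 1/2, and the substitution is made in the corresponding variable, so that it costs at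
      most 2^N uniformly in \<open>t\<close>.\<close>
    have int_b: "(\<integral>\<^sup>+x. indicator B x * b t x \<partial>lborel) \<le> ennreal (V * 2 powr N) * F" if t: "t \<in> {0<..1}" for t
    proof (cases "1 / 2 \<le> t")
      case True
      have tN: "t powr (- N) \<le> 2 powr N"
        using powr_mono2'[of "-N" "1 / 2" t] True by (simp add: N_def powr_minus powr_divide)
      have "(\<integral>\<^sup>+x. indicator B x * b t x \<partial>lborel) \<le> (\<integral>\<^sup>+x. indicator B x * (ennreal (2 powr N) * F) \<partial>lborel)"
      proof (intro nn_integral_mono)
        fix x
        have "b t x \<le> ennreal (2 powr N) * F" if "x \<in> B"
          using b_le[OF that t] mult_right_mono[OF ennreal_leI[OF tN], of F] by (rule order_trans) simp
        then show "indicator B x * b t x \<le> indicator B x * (ennreal (2 powr N) * F)"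
          by (simp add: indicator_def)
      qed
      also have "\<dots> = ennreal (V * 2 powr N) * F"
        using V by (simp add: nn_integral_multc Vind ennreal_mult mult.assoc)
      finally show ?thesis .
    next
      case False
      have tN: "(1 - t) powr (- N) \<le> 2 powr N"
        using powr_mono2'[of "-N" "1 / 2" "1 - t"] False by (simp add: N_def powr_minus powr_divide)
      have "(\<integral>\<^sup>+x. indicator B x * b t x \<partial>lborel) =
          (\<integral>\<^sup>+x. (\<integral>\<^sup>+y. indicator B x * (indicator B y * ennpowr (h (x + t *\<^sub>R (y - x))) p) \<partial>lborel) \<partial>lborel)"
        unfolding b_def by (intro nn_integral_cong nn_integral_cmult[symmetric]) measurable
      also have "\<dots> = (\<integral>\<^sup>+y. (\<integral>\<^sup>+x. indicator B x * (indicator B y * ennpowr (h (x + t *\<^sub>R (y - x))) p) \<partial>lborel) \<partial>lborel)"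
        by (rule nn_integral_lborel_swap[symmetric]) measurable
      also have "\<dots> \<le> (\<integral>\<^sup>+y. indicator B y * (ennreal (2 powr N) * F) \<partial>lborel)"
      proof (rule nn_integral_mono)
        fix y
        have "(\<integral>\<^sup>+x. indicator B x * (indicator B y * ennpowr (h (x + t *\<^sub>R (y - x))) p) \<partial>lborel)
            \<le> (\<integral>\<^sup>+x. indicator B y * ennpowr (h (t *\<^sub>R y + (1 - t) *\<^sub>R x)) p \<partial>lborel)"
          by (intro nn_integral_mono) (auto simp: indicator_def algebra_simps)
        also have "\<dots> = indicator B y * (\<integral>\<^sup>+x. ennpowr (h (t *\<^sub>R y + (1 - t) *\<^sub>R x)) p \<partial>lborel)"
          by (rule nn_integral_cmult) measurable
        also have "(\<integral>\<^sup>+x. ennpowr (h (t *\<^sub>R y + (1 - t) *\<^sub>R x)) p \<partial>lborel) = ennreal ((1 - t) powr (- N)) * F"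
          unfolding F_def N_def using False by (subst nn_integral_affine) auto
        also have "\<dots> \<le> ennreal (2 powr N) * F"
          using tN by (intro mult_right_mono ennreal_leI) auto
        finally show "(\<integral>\<^sup>+x. indicator B x * (indicator B y * ennpowr (h (x + t *\<^sub>R (y - x))) p) \<partial>lborel)
            \<le> indicator B y * (ennreal (2 powr N) * F)"
          by (simp add: mult_left_mono)
      qed
      also have "\<dots> = ennreal (V * 2 powr N) * F"
        using V by (simp add: nn_integral_multc Vind ennreal_mult mult.assoc)
      finally show ?thesis .
    qed
    define G where "G = ennreal C2 * ennpowr F (q / p - 1)"
    have D2: "ennpowr (\<integral>\<^sup>+y\<in>B. ennreal \<bar>u x - u y\<bar> \<partial>lborel) q \<le> ennreal C1 * G * (\<integral>\<^sup>+t. w t * b t x \<partial>lborel)"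
      if x: "x \<in> B" for x
    proof -
      have "ennpowr (\<integral>\<^sup>+y\<in>B. ennreal \<bar>u x - u y\<bar> \<partial>lborel) q \<le>
          ennpowr (ennreal (2 * \<rho>) * (\<integral>\<^sup>+t. w t * (ennreal (t powr \<alpha>) * a t x) \<partial>lborel)) q"
        using D1[OF x] p pq by (intro ennpowr_mono) auto
      also have "\<dots> = ennreal ((2 * \<rho>) powr q) * ennpowr (\<integral>\<^sup>+t. w t * (ennreal (t powr \<alpha>) * a t x) \<partial>lborel) q"
        using \<rho> p pq by (subst ennpowr_mult_ennreal) auto
      also have "\<dots> \<le> ennreal ((2 * \<rho>) powr q) *
          (ennreal (W powr (q - 1)) * (\<integral>\<^sup>+t. w t * ennpowr (ennreal (t powr \<alpha>) * a t x) q \<partial>lborel))"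
        using p pq W by (intro mult_left_mono nn_integral_Jensen) (auto simp: intw)
      also have "\<dots> = ennreal C1 * (\<integral>\<^sup>+t. w t * ennpowr (ennreal (t powr \<alpha>) * a t x) q \<partial>lborel)"
        by (simp add: C1_def ennreal_mult mult.assoc)
      also have "\<dots> \<le> ennreal C1 * (\<integral>\<^sup>+t. G * (w t * b t x) \<partial>lborel)"
      proof (intro mult_left_mono nn_integral_mono)
        fix t
        show "w t * ennpowr (ennreal (t powr \<alpha>) * a t x) q \<le> G * (w t * b t x)"
        proof (cases "t \<in> {0<..1}")
          case True
          have "w t * ennpowr (ennreal (t powr \<alpha>) * a t x) q \<le> w t * (G * b t x)"
            unfolding G_def using a_le[OF x True] by (intro mult_left_mono) auto
          then show ?thesis by (simp add: mult_ac)
        qed (simp add: w_def)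
      qed auto
      also have "\<dots> = ennreal C1 * G * (\<integral>\<^sup>+t. w t * b t x \<partial>lborel)"
        by (subst nn_integral_cmult) (auto simp: mult.assoc)
      finally show ?thesis .
    qed
    have "(\<integral>\<^sup>+x\<in>B. ennpowr (\<integral>\<^sup>+y\<in>B. ennreal \<bar>u x - u y\<bar> \<partial>lborel) q \<partial>lborel)
        \<le> (\<integral>\<^sup>+x. ennreal C1 * G * (\<integral>\<^sup>+t. w t * (indicator B x * b t x) \<partial>lborel) \<partial>lborel)"
      using D2 by (intro nn_integral_mono) (auto simp: indicator_def)
    also have "\<dots> = ennreal C1 * G * (\<integral>\<^sup>+x. (\<integral>\<^sup>+t. w t * (indicator B x * b t x) \<partial>lborel) \<partial>lborel)"
      by (rule nn_integral_cmult) measurable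
    also have "(\<integral>\<^sup>+x. (\<integral>\<^sup>+t. w t * (indicator B x * b t x) \<partial>lborel) \<partial>lborel)
        = (\<integral>\<^sup>+t. (\<integral>\<^sup>+x. w t * (indicator B x * b t x) \<partial>lborel) \<partial>lborel)"
      by (rule nn_integral_lborel_swap) measurable
    also have "\<dots> = (\<integral>\<^sup>+t. w t * (\<integral>\<^sup>+x. indicator B x * b t x \<partial>lborel) \<partial>lborel)"
      by (intro nn_integral_cong nn_integral_cmult) measurable
    also have "\<dots> \<le> (\<integral>\<^sup>+t. w t * (ennreal (V * 2 powr N) * F) \<partial>lborel)"
    proof (intro nn_integral_mono)
      show "w t * (\<integral>\<^sup>+x. indicator B x * b t x \<partial>lborel) \<le> w t * (ennreal (V * 2 powr N) * F)" for t
        using int_b[of t] by (cases "t \<in> {0<..1}") (auto simp: w_def intro!: mult_left_mono)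
    qed
    also have "\<dots> = ennreal (W * (V * 2 powr N)) * F"
      using V W by (simp add: nn_integral_multc intw ennreal_mult mult.assoc)
    also have "ennreal C1 * G * \<dots> = ennreal C * ennpowr F (q / p)"
      using ennpowr_add[of F "q / p - 1" 1] C12 V W unfolding G_def C_def
      by (simp add: ennreal_mult mult_ac)
    finally show "(\<integral>\<^sup>+x\<in>cball z \<rho>. ennpowr (\<integral>\<^sup>+y\<in>cball z \<rho>. ennreal \<bar>u x - u y\<bar> \<partial>lborel) q \<partial>lborel)
      \<le> ennreal C * ennpowr (\<integral>\<^sup>+x\<in>cball z \<rho>. ennreal (norm (grad u x) powr p) \<partial>lborel) (q / p)"
      using F_eq by (simp add: B_def mult_left_mono)
  qed
qed

subsection \<open>Scaling\<close>

lemma dirichlet_energy_eq_UNIV: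
  assumes "u \<in> C0_infinity \<Omega>"
  shows "dirichlet_energy p \<Omega> u = dirichlet_energy p UNIV u"
proof -
  obtain K where "K \<subseteq> \<Omega>" "\<And>x. x \<notin> K \<Longrightarrow> grad u x = 0"
    using C0_infinityE[OF assms] by metis
  then show ?thesis
    unfolding dirichlet_energy_def by (intro nn_integral_cong) (auto simp: indicator_def)
qed

lemma nn_integral_powr_eq_UNIV:
  assumes "u \<in> C0_infinity \<Omega>"
  shows "(\<integral>\<^sup>+x\<in>\<Omega>. ennreal (\<bar>u x\<bar> powr q) \<partial>lborel) = (\<integral>\<^sup>+x. ennreal (\<bar>u x\<bar> powr q) \<partial>lborel)"
proof -
  obtain K where "K \<subseteq> \<Omega>" "\<And>x. x \<notin> K \<Longrightarrow> u x = 0"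
    using C0_infinityE[OF assms] by metis
  then show ?thesis
    by (intro nn_integral_cong) (auto simp: indicator_def)
qed

lemma borel_measurable_grad: "smooth u \<Longrightarrow> grad u \<in> borel_measurable borel"
  by (intro borel_measurable_continuous_onI continuous_on_grad)

lemma borel_measurable_smooth: "smooth u \<Longrightarrow> u \<in> borel_measurable borel"
  by (intro borel_measurable_continuous_onI smooth_continuous_on)

lemma dirichlet_energy_cmult:
  assumes "smooth u"
  shows "dirichlet_energy p UNIV (\<lambda>x. c * u x) = ennreal (\<bar>c\<bar> powr p) * dirichlet_energy p UNIV u"
proof -
  have [measurable]: "grad u \<in> borel_measurable borel" using assms by (rule borel_measurable_grad)
  have "grad (\<lambda>x. c * u x) x = c *\<^sub>R grad u x" for x
    using grad_mult[OF smooth_const[of c] assms, of x] by (simp add: grad_const)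
  then show ?thesis
    by (simp add: dirichlet_energy_def powr_mult ennreal_mult nn_integral_cmult)
qed

lemma dirichlet_energy_affine:
  fixes u :: "'a::euclidean_space \<Rightarrow> real"
  assumes "smooth u" "0 < r"
  shows "dirichlet_energy p UNIV (\<lambda>x. u (a + r *\<^sub>R x)) =
    ennreal (r powr (p - DIM('a))) * dirichlet_energy p UNIV u"
proof -
  have [measurable]: "grad u \<in> borel_measurable borel" using assms(1) by (rule borel_measurable_grad)
  have "dirichlet_energy p UNIV (\<lambda>x. u (a + r *\<^sub>R x)) =
      ennreal (r powr p) * (\<integral>\<^sup>+x. ennreal (norm (grad u (a + r *\<^sub>R x)) powr p) \<partial>lborel)"
    using assms by (simp add: dirichlet_energy_def grad_affine powr_mult ennreal_mult nn_integral_cmult)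
  also have "(\<integral>\<^sup>+x. ennreal (norm (grad u (a + r *\<^sub>R x)) powr p) \<partial>lborel)
      = ennreal (r powr (- real DIM('a))) * dirichlet_energy p UNIV u"
    using assms nn_integral_affine[of "\<lambda>x. ennreal (norm (grad u x) powr p)" r a]
    by (simp add: dirichlet_energy_def)
  finally show ?thesis
    by (simp add: mult.assoc[symmetric] ennreal_mult[symmetric] powr_add[symmetric])
qed

text \<open>Sets are rescaled by preimages, to match test functions of the form u (a + r x). The
  inverse map is again affine of the same form, so a scaling inequality applied to both maps becomes
  an equality.\<close>

lemma vimage_affine_inverse:
  "0 < r \<Longrightarrow> (\<lambda>x. - ((1 / r) *\<^sub>R a) + (1 / r) *\<^sub>R x) -` (\<lambda>x::'a::real_vector. a + r *\<^sub>R x) -` S = S"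
  by (auto simp: algebra_simps)

lemma vimage_affine_eq_image:
  assumes "0 < r"
  shows "(\<lambda>x::'a::real_vector. a + r *\<^sub>R x) -` S = (\<lambda>x. - ((1 / r) *\<^sub>R a) + (1 / r) *\<^sub>R x) ` S"
proof (intro equalityI subsetI)
  fix x assume "x \<in> (\<lambda>x. a + r *\<^sub>R x) -` S"
  then show "x \<in> (\<lambda>x. - ((1 / r) *\<^sub>R a) + (1 / r) *\<^sub>R x) ` S"
    using assms by (intro image_eqI[of _ _ "a + r *\<^sub>R x"]) (auto simp: algebra_simps)
qed (use assms in \<open>auto simp: algebra_simps\<close>)

lemma compact_vimage_affine:
  fixes S :: "'a::euclidean_space set"
  assumes "compact S" "0 < r" shows "compact ((\<lambda>x. a + r *\<^sub>R x) -` S)"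
  unfolding vimage_affine_eq_image[OF assms(2)] using assms(1)
  by (intro compact_continuous_image continuous_intros)

lemma C0_infinity_affine:
  assumes "u \<in> C0_infinity \<Omega>" "0 < r"
  shows "(\<lambda>x. u (a + r *\<^sub>R x)) \<in> C0_infinity ((\<lambda>x. a + r *\<^sub>R x) -` \<Omega>)"
proof -
  obtain K where K: "compact K" "K \<subseteq> \<Omega>" "\<And>x. x \<notin> K \<Longrightarrow> u x = 0"
    using C0_infinityE[OF assms(1)] by metis
  show ?thesis
  proof (rule C0_infinityI)
    show "smooth (\<lambda>x. u (a + r *\<^sub>R x))"
      by (rule smooth_affine[OF C0_infinity_smooth[OF assms(1)]])
    show "compact ((\<lambda>x. a + r *\<^sub>R x) -` K)"
      by (rule compact_vimage_affine[OF K(1) assms(2)])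
  qed (use K in auto)
qed

section \<open>Scaling of capacities, of the Poincare-Sobolev constant and of the inradius\<close>

lemma ennreal_le_mult_INF:
  assumes "0 < c" "\<And>x. x \<in> A \<Longrightarrow> y \<le> ennreal c * f x"
  shows "y \<le> ennreal c * (INF x\<in>A. f x)"
proof -
  have inv: "ennreal c * (ennreal (1 / c) * z) = z" "ennreal (1 / c) * (ennreal c * z) = z" for z
    using assms(1) by (simp_all add: mult.assoc[symmetric] ennreal_mult[symmetric])
  have "ennreal (1 / c) * y \<le> f x" if "x \<in> A" for x
    using mult_left_mono[OF assms(2)[OF that], of "ennreal (1 / c)"] by (simp add: inv)
  then have "ennreal (1 / c) * y \<le> (INF x\<in>A. f x)"
    by (rule INF_greatest)
  then have "ennreal c * (ennreal (1 / c) * y) \<le> ennreal c * (INF x\<in>A. f x)"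
    by (rule mult_left_mono) simp
  then show ?thesis by (simp add: inv)
qed

lemma capacity_le:
  assumes "\<phi> \<in> C0_infinity E" "\<And>x. x \<in> \<Sigma> \<Longrightarrow> 1 \<le> \<phi> x"
  shows "capacity p \<Sigma> E \<le> dirichlet_energy p UNIV \<phi>"
  unfolding capacity_def using assms dirichlet_energy_eq_UNIV[OF assms(1)]
  by (auto intro!: INF_lower2[of \<phi>])

lemma capacity_affine_le:
  fixes \<Sigma> E :: "'a::euclidean_space set"
  assumes "0 < r"
  shows "capacity p ((\<lambda>x. a + r *\<^sub>R x) -` \<Sigma>) ((\<lambda>x. a + r *\<^sub>R x) -` E)
    \<le> ennreal (r powr (p - DIM('a))) * capacity p \<Sigma> E"
  unfolding capacity_def[of p \<Sigma> E]
proof (rule ennreal_le_mult_INF)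
  fix \<phi> assume "\<phi> \<in> {\<phi> \<in> C0_infinity E. \<forall>x\<in>\<Sigma>. 1 \<le> \<phi> x}"
  then have \<phi>: "\<phi> \<in> C0_infinity E" "\<And>x. x \<in> \<Sigma> \<Longrightarrow> 1 \<le> \<phi> x" by auto
  have "capacity p ((\<lambda>x. a + r *\<^sub>R x) -` \<Sigma>) ((\<lambda>x. a + r *\<^sub>R x) -` E)
      \<le> dirichlet_energy p UNIV (\<lambda>x. \<phi> (a + r *\<^sub>R x))"
    by (rule capacity_le) (use \<phi> assms C0_infinity_affine in auto)
  then show "capacity p ((\<lambda>x. a + r *\<^sub>R x) -` \<Sigma>) ((\<lambda>x. a + r *\<^sub>R x) -` E)
      \<le> ennreal (r powr (p - DIM('a))) * dirichlet_energy p E \<phi>"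
    using \<phi> assms by (simp add: dirichlet_energy_affine C0_infinity_smooth dirichlet_energy_eq_UNIV)
qed (use assms in simp)

lemma capacity_affine:
  fixes \<Sigma> E :: "'a::euclidean_space set"
  assumes r: "0 < r"
  shows "capacity p ((\<lambda>x. a + r *\<^sub>R x) -` \<Sigma>) ((\<lambda>x. a + r *\<^sub>R x) -` E)
    = ennreal (r powr (p - DIM('a))) * capacity p \<Sigma> E" (is "?L = _")
proof (rule antisym)
  have "capacity p \<Sigma> E \<le> ennreal ((1 / r) powr (p - DIM('a))) * ?L"
    using capacity_affine_le[of "1 / r" p "- ((1 / r) *\<^sub>R a)"
        "(\<lambda>x. a + r *\<^sub>R x) -` \<Sigma>" "(\<lambda>x. a + r *\<^sub>R x) -` E"] r
    by (simp only: vimage_affine_inverse[OF r]) simp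
  then have "ennreal (r powr (p - DIM('a))) * capacity p \<Sigma> E
      \<le> ennreal (r powr (p - DIM('a))) * (ennreal ((1 / r) powr (p - DIM('a))) * ?L)"
    by (rule mult_left_mono) simp
  also have "\<dots> = ?L"
    using r by (simp add: mult.assoc[symmetric] ennreal_mult[symmetric] powr_divide)
  finally show "ennreal (r powr (p - DIM('a))) * capacity p \<Sigma> E \<le> ?L" .
qed (rule capacity_affine_le[OF r])

lemma dist_affine: "0 < r \<Longrightarrow> dist (a + r *\<^sub>R y) (a + r *\<^sub>R x) = r * dist y (x::'a::real_normed_vector)"
  by (simp add: dist_norm scaleR_diff_right[symmetric])

lemma vimage_affine_cball:
  fixes a y :: "'a::real_normed_vector"
  assumes "0 < r"
  shows "(\<lambda>x. a + r *\<^sub>R x) -` cball (a + r *\<^sub>R y) (r * s) = cball y (s::real)"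
  using assms by (auto simp: dist_affine simp del: dist_add_cancel)

lemma vimage_affine_ball:
  fixes a y :: "'a::real_normed_vector"
  assumes "0 < r"
  shows "(\<lambda>x. a + r *\<^sub>R x) -` ball (a + r *\<^sub>R y) (r * s) = ball y (s::real)"
  using assms by (auto simp: dist_affine simp del: dist_add_cancel)

lemma capacity_negligible_affine:
  fixes \<Sigma> :: "'a::euclidean_space set"
  assumes r: "0 < r"
  shows "capacity_negligible p \<gamma> y s ((\<lambda>x. a + r *\<^sub>R x) -` \<Sigma>)
    \<longleftrightarrow> capacity_negligible p \<gamma> (a + r *\<^sub>R y) (r * s) \<Sigma>"
proof -
  define A where "A = (\<lambda>x::'a. a + r *\<^sub>R x)"
  define B where "B = (\<lambda>x::'a. - ((1 / r) *\<^sub>R a) + (1 / r) *\<^sub>R x)"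
  have BA: "B -` A -` S = S" for S unfolding A_def B_def by (rule vimage_affine_inverse[OF r])
  have ball: "A -` ball (a + r *\<^sub>R y) (2 * (r * s)) = ball y (2 * s)"
    using vimage_affine_ball[OF r, of a y "2 * s"] by (simp add: A_def mult_ac)
  have cball: "A -` cball (a + r *\<^sub>R y) (r * s) = cball y s"
    using vimage_affine_cball[OF r, of a y s] by (simp add: A_def)
  have "compact (A -` \<Sigma>) \<longleftrightarrow> compact \<Sigma>"
    using compact_vimage_affine[OF _ r, of \<Sigma> a] compact_vimage_affine[of "A -` \<Sigma>" "1 / r" "- ((1 / r) *\<^sub>R a)"] r BA[of \<Sigma>]
    by (auto simp: A_def B_def)
  moreover have "A -` \<Sigma> \<subseteq> cball y s \<longleftrightarrow> \<Sigma> \<subseteq> cball (a + r *\<^sub>R y) (r * s)"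
    using BA cball by (metis vimage_mono)
  moreover have "capacity p (A -` \<Sigma>) (ball y (2 * s)) \<le> ennreal \<gamma> * capacity p (cball y s) (ball y (2 * s))
      \<longleftrightarrow> capacity p \<Sigma> (ball (a + r *\<^sub>R y) (2 * (r * s)))
        \<le> ennreal \<gamma> * capacity p (cball (a + r *\<^sub>R y) (r * s)) (ball (a + r *\<^sub>R y) (2 * (r * s)))"
    unfolding ball[symmetric] cball[symmetric] unfolding A_def capacity_affine[OF r]
    using r by (simp add: mult.left_commute[of "ennreal \<gamma>"] ennreal_mult_le_mult_iff)
  ultimately show ?thesis unfolding capacity_negligible_def A_def by simp
qed

text \<open>By homogeneity, dividing \<open>u\<close> by its L^q norm \<open>i powr (1 / q)\<close>
  gives an admissible function, so test functions may be used without normalisation.\<close>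

lemma poincare_sobolev_const_le:
  assumes u: "u \<in> C0_infinity \<Omega>" and q: "1 \<le> q"
    and I: "(\<integral>\<^sup>+x. ennreal (\<bar>u x\<bar> powr q) \<partial>lborel) = ennreal i" "0 < i"
  shows "poincare_sobolev_const p q \<Omega> \<le> ennreal (i powr (- (p / q))) * dirichlet_energy p UNIV u"
proof -
  define c where "c = i powr (- (1 / q))"
  have c: "0 < c" using I by (simp add: c_def)
  define v where "v x = c * u x" for x
  have sm: "smooth u" using u by (rule C0_infinity_smooth)
  have [measurable]: "u \<in> borel_measurable borel" using sm by (rule borel_measurable_smooth)
  have v: "v \<in> C0_infinity \<Omega>"
    unfolding v_def by (rule C0_infinity_mult[OF smooth_const u])
  have "(\<integral>\<^sup>+x. ennreal (\<bar>v x\<bar> powr q) \<partial>lborel) = ennreal (c powr q) * ennreal i"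
    using c by (simp add: v_def abs_mult powr_mult ennreal_mult nn_integral_cmult I(1)[symmetric])
  also have "\<dots> = 1"
    using I q by (simp add: ennreal_mult[symmetric] c_def powr_powr powr_minus[of i 1])
  finally have "ennpowr (Lq_norm q \<Omega> v) p = 1"
    by (simp add: Lq_norm_def nn_integral_powr_eq_UNIV[OF v] ennpowr_def)
  then have "poincare_sobolev_const p q \<Omega> \<le> dirichlet_energy p \<Omega> v"
    unfolding poincare_sobolev_const_def using v by (intro INF_lower) auto
  also have "\<dots> = ennreal (c powr p) * dirichlet_energy p UNIV u"
    using c dirichlet_energy_cmult[OF sm, of p c] unfolding dirichlet_energy_eq_UNIV[OF v] v_def by simp
  also have "c powr p = i powr (- (p / q))"
    by (simp add: c_def powr_powr)
  finally show ?thesis .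
qed

lemma nn_integral_powr_eq_1:
  fixes p q :: real
  assumes "u \<in> C0_infinity \<Omega>" "ennpowr (Lq_norm q \<Omega> u) p = 1" "1 \<le> p" "1 \<le> q"
  shows "(\<integral>\<^sup>+x. ennreal (\<bar>u x\<bar> powr q) \<partial>lborel) = 1"
proof -
  have "ennpowr (\<integral>\<^sup>+x. ennreal (\<bar>u x\<bar> powr q) \<partial>lborel) (p / q) = 1"
    using assms(2) by (simp add: Lq_norm_def nn_integral_powr_eq_UNIV[OF assms(1)] ennpowr_ennpowr)
  then have "ennpowr (ennpowr (\<integral>\<^sup>+x. ennreal (\<bar>u x\<bar> powr q) \<partial>lborel) (p / q)) (q / p) = ennpowr 1 (q / p)"
    by simp
  then show ?thesis
    using assms(3,4) by (simp add: ennpowr_ennpowr) (simp add: ennpowr_def)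
qed

lemma poincare_sobolev_const_affine:
  fixes \<Omega> :: "'a::euclidean_space set" and p q :: real
  assumes r: "0 < r" and p: "1 \<le> p" and q: "1 \<le> q"
  shows "poincare_sobolev_const p q ((\<lambda>x. a + r *\<^sub>R x) -` \<Omega>)
    \<le> ennreal (r powr (p - DIM('a) + DIM('a) * (p / q))) * poincare_sobolev_const p q \<Omega>"
  unfolding poincare_sobolev_const_def[of p q \<Omega>]
proof (rule ennreal_le_mult_INF)
  fix u assume "u \<in> {u \<in> C0_infinity \<Omega>. ennpowr (Lq_norm q \<Omega> u) p = 1}"
  then have u: "u \<in> C0_infinity \<Omega>" and "ennpowr (Lq_norm q \<Omega> u) p = 1" by auto
  then have I: "(\<integral>\<^sup>+x. ennreal (\<bar>u x\<bar> powr q) \<partial>lborel) = 1"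
    using p q by (intro nn_integral_powr_eq_1)
  have sm: "smooth u" using u by (rule C0_infinity_smooth)
  have [measurable]: "u \<in> borel_measurable borel" using sm by (rule borel_measurable_smooth)
  have "(\<integral>\<^sup>+x. ennreal (\<bar>u (a + r *\<^sub>R x)\<bar> powr q) \<partial>lborel) = ennreal (r powr (- real DIM('a)))"
    using nn_integral_affine[of "\<lambda>x. ennreal (\<bar>u x\<bar> powr q)" r a] r by (simp add: I)
  then have "poincare_sobolev_const p q ((\<lambda>x. a + r *\<^sub>R x) -` \<Omega>) \<le>
      ennreal ((r powr (- real DIM('a))) powr (- (p / q))) * dirichlet_energy p UNIV (\<lambda>x. u (a + r *\<^sub>R x))"
    using r by (intro poincare_sobolev_const_le C0_infinity_affine u q) auto
  also have "\<dots> = ennreal (r powr (p - DIM('a) + DIM('a) * (p / q))) * dirichlet_energy p \<Omega> u"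
    using r by (simp add: dirichlet_energy_affine[OF sm] dirichlet_energy_eq_UNIV[OF u] powr_powr
        mult.assoc[symmetric] ennreal_mult[symmetric] powr_add[symmetric] add.commute)
  finally show "poincare_sobolev_const p q ((\<lambda>x. a + r *\<^sub>R x) -` \<Omega>) \<le>
      ennreal (r powr (p - DIM('a) + DIM('a) * (p / q))) * dirichlet_energy p \<Omega> u" .
qed (use r in simp)

text \<open>Rescaling an admissible ball to the unit ball bounds the constant by
  \<open>C * r powr (- \<kappa>)\<close> for each admissible \<open>r\<close>. Solving for
  \<open>r\<close> bounds all admissible radii and hence their supremum. The extreme cases follow:
  an infinite constant leaves no admissible radius, and an infinite inradius is only compatible with
  the constant 0.\<close>

lemma capacitary_inradius_upper:
  fixes \<Omega> :: "'a::euclidean_space set" and p q :: real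
  assumes p: "1 \<le> p" and q: "1 \<le> q" and C: "0 < C"
    and \<kappa>: "\<kappa> = p - DIM('a) + DIM('a) * (p / q)" "0 < \<kappa>" and \<Omega>: "open \<Omega>"
    and unit: "\<And>\<Omega>' :: 'a set. open \<Omega>' \<Longrightarrow> capacity_negligible p \<gamma> 0 1 (cball 0 1 - \<Omega>')
      \<Longrightarrow> poincare_sobolev_const p q \<Omega>' \<le> ennreal C"
  shows "poincare_sobolev_const p q \<Omega> \<le> ennreal C * ennpowr (1 / capacitary_inradius p \<gamma> \<Omega>) \<kappa>"
proof -
  define S where "S = {r. 0 < r \<and> (\<exists>x\<^sub>0. capacity_negligible p \<gamma> x\<^sub>0 r (cball x\<^sub>0 r - \<Omega>))}"
  define R where "R = capacitary_inradius p \<gamma> \<Omega>"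
  have R: "R = Sup (ennreal ` S)" unfolding R_def capacitary_inradius_def S_def ..
  have le: "poincare_sobolev_const p q \<Omega> \<le> ennreal (C * r powr (- \<kappa>))" if rS: "r \<in> S" for r
  proof -
    obtain a where r: "0 < r" and neg: "capacity_negligible p \<gamma> a r (cball a r - \<Omega>)"
      using rS by (auto simp: S_def)
    define \<Omega>' where "\<Omega>' = (\<lambda>x. a + r *\<^sub>R x) -` \<Omega>"
    have "(\<lambda>x. a + r *\<^sub>R x) -` (cball a r - \<Omega>) = cball 0 1 - \<Omega>'"
      using vimage_affine_cball[OF r, of a 0 1] by (auto simp: \<Omega>'_def)
    with neg capacity_negligible_affine[OF r, of p \<gamma> 0 1 a "cball a r - \<Omega>"]
    have "capacity_negligible p \<gamma> 0 1 (cball 0 1 - \<Omega>')" by simp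
    moreover have "open \<Omega>'"
      unfolding \<Omega>'_def by (intro continuous_open_vimage \<Omega>) (auto intro!: continuous_intros)
    ultimately have "poincare_sobolev_const p q \<Omega>' \<le> ennreal C" by (intro unit)
    then have "ennreal ((1 / r) powr \<kappa>) * poincare_sobolev_const p q \<Omega>' \<le> ennreal ((1 / r) powr \<kappa>) * ennreal C"
      by (rule mult_left_mono) simp
    moreover have "poincare_sobolev_const p q \<Omega> \<le> ennreal ((1 / r) powr \<kappa>) * poincare_sobolev_const p q \<Omega>'"
      using poincare_sobolev_const_affine[of "1 / r" p q "- ((1 / r) *\<^sub>R a)" \<Omega>'] r p q
      unfolding \<Omega>'_def \<kappa>(1)[symmetric] by (simp only: vimage_affine_inverse[OF r]) simp
    ultimately show ?thesis
      using r C by (simp add: ennreal_mult[symmetric] powr_minus_divide powr_divide mult.commute)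
  qed
  show ?thesis unfolding R_def[symmetric]
  proof (cases "poincare_sobolev_const p q \<Omega>" rule: ennreal_cases)
    case top
    then have "S = {}" using le by (auto simp: top_unique)
    then have "R = 0" by (simp add: R bot_ennreal)
    then show "poincare_sobolev_const p q \<Omega> \<le> ennreal C * ennpowr (1 / R) \<kappa>"
      using C by (simp add: ennreal_mult_top)
  next
    case (real l)
    show "poincare_sobolev_const p q \<Omega> \<le> ennreal C * ennpowr (1 / R) \<kappa>"
    proof (cases "l = 0")
      case False
      then have l: "0 < l" using real by simp
      \<comment> \<open>The radius at which \<open>C * T powr (- \<kappa>) = l\<close>.\<close>
      define T where "T = (C / l) powr (1 / \<kappa>)"
      have "r \<le> T" if rS: "r \<in> S" for r
      proof -
        have r: "0 < r" using rS by (simp add: S_def)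
        have "l \<le> C * r powr (- \<kappa>)" using le[OF rS] C real by simp
        then have "r powr \<kappa> \<le> C / l" using l r by (simp add: powr_minus field_simps)
        then have "(r powr \<kappa>) powr (1 / \<kappa>) \<le> T"
          unfolding T_def using \<kappa>(2) by (intro powr_mono2) auto
        then show ?thesis using r \<kappa>(2) by (simp add: powr_powr)
      qed
      then have RT: "R \<le> ennreal T" unfolding R by (auto intro!: SUP_least ennreal_leI)
      then obtain \<rho> where \<rho>: "R = ennreal \<rho>" "0 \<le> \<rho>" by (cases R rule: ennreal_cases) (auto simp: top_unique)
      show ?thesis
      proof (cases "\<rho> = 0")
        case True
        then show ?thesis using \<rho> C by (simp add: ennreal_mult_top)
      next
        case False
        then have pos: "0 < \<rho>" using \<rho> by simp
        have "\<rho> \<le> T" using RT \<rho> by (simp add: T_def)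
        then have "\<rho> powr \<kappa> \<le> T powr \<kappa>" using pos \<kappa>(2) by (intro powr_mono2) auto
        also have "\<dots> = C / l" using \<kappa>(2) l C by (simp add: T_def powr_powr)
        finally have "l \<le> C * (1 / \<rho>) powr \<kappa>" using l pos by (simp add: powr_divide field_simps)
        then show ?thesis
          using real \<rho> pos C
          by (simp add: divide_ennreal[of 1, simplified] ennreal_mult[symmetric] ennreal_leI)
      qed
    qed (use real in simp)
  qed
qed

text \<open>A radius above the inradius is inadmissible at every centre, so rescaling gives the
  lower bound \<open>c * r powr (- \<kappa>)\<close> for all such \<open>r\<close>, and
  \<open>r\<close> can decrease to the inradius. An infinite inradius makes the left-hand side
  0.\<close>

lemma capacitary_inradius_lower:
  fixes \<Omega> :: "'a::euclidean_space set" and p q :: real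
  assumes p: "1 \<le> p" and q: "1 \<le> q" and c: "0 < c"
    and \<kappa>: "\<kappa> = p - DIM('a) + DIM('a) * (p / q)" "0 < \<kappa>" and \<Omega>: "open \<Omega>"
    and unit: "\<And>\<Omega>' :: 'a set. open \<Omega>' \<Longrightarrow> (\<And>x\<^sub>0. \<not> capacity_negligible p \<gamma> x\<^sub>0 1 (cball x\<^sub>0 1 - \<Omega>'))
      \<Longrightarrow> ennreal c \<le> poincare_sobolev_const p q \<Omega>'"
  shows "ennreal c * ennpowr (1 / capacitary_inradius p \<gamma> \<Omega>) \<kappa> \<le> poincare_sobolev_const p q \<Omega>"
proof -
  define R where "R = capacitary_inradius p \<gamma> \<Omega>"
  have le: "ennreal (c * r powr (- \<kappa>)) \<le> poincare_sobolev_const p q \<Omega>" if r: "0 < r" and rR: "R < ennreal r" for r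
  proof -
    have not: "\<not> capacity_negligible p \<gamma> a r (cball a r - \<Omega>)" for a
    proof
      assume "capacity_negligible p \<gamma> a r (cball a r - \<Omega>)"
      then have "ennreal r \<le> R"
        unfolding R_def capacitary_inradius_def using r by (intro Sup_upper) auto
      with rR show False by simp
    qed
    define \<Omega>' where "\<Omega>' = (\<lambda>x. 0 + r *\<^sub>R x) -` \<Omega>"
    have "\<not> capacity_negligible p \<gamma> y 1 (cball y 1 - \<Omega>')" for y
    proof -
      have "(\<lambda>x. 0 + r *\<^sub>R x) -` (cball (r *\<^sub>R y) r - \<Omega>) = cball y 1 - \<Omega>'"
        using vimage_affine_cball[OF r, of 0 y 1] by (auto simp: \<Omega>'_def)
      then show ?thesis
        using not[of "r *\<^sub>R y"] capacity_negligible_affine[OF r, of p \<gamma> y 1 0 "cball (r *\<^sub>R y) r - \<Omega>"]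
        by simp
    qed
    moreover have "open \<Omega>'"
      unfolding \<Omega>'_def by (intro continuous_open_vimage \<Omega>) (auto intro!: continuous_intros)
    ultimately have "ennreal c \<le> poincare_sobolev_const p q \<Omega>'" by (intro unit)
    also have "\<dots> \<le> ennreal (r powr \<kappa>) * poincare_sobolev_const p q \<Omega>"
      unfolding \<Omega>'_def \<kappa>(1) by (rule poincare_sobolev_const_affine[OF r p q])
    finally have "ennreal (r powr (- \<kappa>)) * ennreal c
        \<le> ennreal (r powr (- \<kappa>)) * (ennreal (r powr \<kappa>) * poincare_sobolev_const p q \<Omega>)"
      by (rule mult_left_mono) simp
    also have "\<dots> = poincare_sobolev_const p q \<Omega>"
      using r by (simp add: mult.assoc[symmetric] ennreal_mult[symmetric] powr_minus)
    finally show ?thesis using c by (simp add: ennreal_mult[symmetric] mult.commute)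
  qed
  show ?thesis unfolding R_def[symmetric]
  proof (cases "R = top \<or> poincare_sobolev_const p q \<Omega> = top")
    case False
    then obtain \<rho> l where \<rho>: "R = ennreal \<rho>" "0 \<le> \<rho>" and l0: "poincare_sobolev_const p q \<Omega> = ennreal l" "0 \<le> l"
      by (metis ennreal_cases)
    have le': "c * r powr (- \<kappa>) \<le> l" if "\<rho> < r" for r
      using le[of r] that \<rho> l0 c by (simp add: ennreal_less_iff)
    then have "0 < c * (\<rho> + 1) powr (- \<kappa>)" "c * (\<rho> + 1) powr (- \<kappa>) \<le> l" using c \<rho> by auto
    then have l: "0 < l" by linarith
    define T where "T = (c / l) powr (1 / \<kappa>)"
    have T: "0 < T" using c l by (simp add: T_def)
    have "T \<le> \<rho>"
    proof (rule dense_ge)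
      fix r assume rr: "\<rho> < r"
      then have r: "0 < r" using \<rho> by simp
      have "c / l \<le> r powr \<kappa>" using le'[OF rr] l r by (simp add: powr_minus field_simps)
      then have "T \<le> (r powr \<kappa>) powr (1 / \<kappa>)"
        unfolding T_def using \<kappa>(2) c l by (intro powr_mono2) auto
      then show "T \<le> r" using r \<kappa>(2) by (simp add: powr_powr)
    qed
    \<comment> \<open>A finite constant thus forces a positive inradius; this settles the case of
      inradius 0, where the constant must be infinite.\<close>
    with T have pos: "0 < \<rho>" by simp
    have "c / l = T powr \<kappa>" using \<kappa>(2) l c by (simp add: T_def powr_powr)
    also have "\<dots> \<le> \<rho> powr \<kappa>" using \<open>T \<le> \<rho>\<close> T \<kappa>(2) by (intro powr_mono2) auto
    finally have "c * (1 / \<rho>) powr \<kappa> \<le> l" using l pos by (simp add: powr_divide field_simps)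
    then show "ennreal c * ennpowr (1 / R) \<kappa> \<le> poincare_sobolev_const p q \<Omega>"
      using l0 \<rho> pos c
      by (simp add: divide_ennreal[of 1, simplified] ennreal_mult[symmetric] ennreal_leI)
  qed auto
qed

subsection \<open>The lower bound\<close>

lemma powr_add_le:
  assumes "0 \<le> a" "0 \<le> b" "0 \<le> (p::real)"
  shows "(a + b) powr p \<le> 2 powr p * (a powr p + b powr p)"
proof -
  have "(a + b) powr p \<le> (2 * max a b) powr p"
    using assms by (intro powr_mono2) auto
  also have "\<dots> = 2 powr p * max a b powr p" using assms by (simp add: powr_mult)
  also have "max a b powr p \<le> a powr p + b powr p" by (simp add: max_def)
  finally show ?thesis by simp
qed

section \<open>Capacity of the unit ball: finite and positive\<close>

lemma emeasure_cball_pos: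
  assumes "0 < r"
  obtains V where "0 < V" "\<And>z::'a::euclidean_space. emeasure lborel (cball z r) = ennreal V"
proof (rule that)
  show "0 < unit_ball_vol DIM('a) * r ^ DIM('a)" using assms by simp
  show *: "emeasure lborel (cball z r) = ennreal (unit_ball_vol DIM('a) * r ^ DIM('a))" for z :: 'a
    using assms by (intro emeasure_cball) simp
qed

lemma dirichlet_energy_finite:
  assumes u: "u \<in> C0_infinity \<Omega>" and p: "1 \<le> p"
  shows "dirichlet_energy p UNIV u < \<infinity>"
proof -
  obtain M where M: "0 < M" "\<And>x. norm (grad u x) \<le> M" using C0_infinity_bounded[OF u] by metis
  obtain K where K: "compact K" "\<And>x. x \<notin> K \<Longrightarrow> grad u x = 0" using C0_infinityE[OF u] by metis
  have [measurable]: "K \<in> sets borel" using K(1) by (simp add: compact_imp_closed)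
  have "dirichlet_energy p UNIV u \<le> (\<integral>\<^sup>+x. ennreal (M powr p) * indicator K x \<partial>lborel)"
    unfolding dirichlet_energy_def
  proof (intro nn_integral_mono)
    show "ennreal (norm (grad u x) powr p) * indicator UNIV x \<le> ennreal (M powr p) * indicator K x" for x
      using M(2)[of x] K(2)[of x] p
      by (cases "x \<in> K") (auto intro!: ennreal_leI powr_mono2)
  qed
  also have "\<dots> = ennreal (M powr p) * emeasure lborel K"
    by (rule nn_integral_cmult_indicator) simp
  also have "\<dots> < \<infinity>"
    using emeasure_compact_finite[OF K(1)] by (simp add: ennreal_mult_less_top)
  finally show ?thesis .
qed

lemma capacity_unit_ball_finite:
  assumes "1 \<le> p" shows "capacity p (cball (0::'a::euclidean_space) 1) (ball 0 2) < \<infinity>"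
proof -
  obtain \<eta> :: "'a \<Rightarrow> real" where \<eta>: "\<And>x. x \<in> cball 0 1 \<Longrightarrow> \<eta> x = 1" "\<eta> \<in> C0_infinity (ball 0 2)"
    using ball_cutoff_exists[of 1 2 "0::'a"] by (metis one_less_numeral_iff semiring_norm(76) zero_less_one)
  have "capacity p (cball (0::'a) 1) (ball 0 2) \<le> dirichlet_energy p UNIV \<eta>"
    using \<eta> by (intro capacity_le) auto
  then show ?thesis using dirichlet_energy_finite[OF \<eta>(2) assms] by (rule le_less_trans)
qed

text \<open>A competitor is at least 1 on the unit ball and 0 on the unit ball around
  \<open>3 *\<^sub>R e\<close>, which lies outside \<open>ball 0 2\<close>. Both balls lie in
  \<open>cball 0 4\<close>, where the Poincare inequality with q = p turns this oscillation into a
  lower bound for the energy.\<close>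

lemma capacity_unit_ball_pos:
  assumes p: "1 \<le> p"
  obtains c where "0 < c" "ennreal c \<le> capacity p (cball (0::'a::euclidean_space) 1) (ball 0 2)"
proof -
  obtain C where C: "0 < C" "\<And>(u :: 'a \<Rightarrow> real) z. smooth u \<Longrightarrow>
    (\<integral>\<^sup>+x\<in>cball z 4. ennpowr (\<integral>\<^sup>+y\<in>cball z 4. ennreal \<bar>u x - u y\<bar> \<partial>lborel) p \<partial>lborel)
      \<le> ennreal C * ennpowr (\<integral>\<^sup>+x\<in>cball z 4. ennreal (norm (grad u x) powr p) \<partial>lborel) (p / p)"
    by (rule poincare_sobolev_ball[where 'a = 'a, of p p 4]) (use p in auto)
  obtain V where V: "0 < V" "\<And>z::'a. emeasure lborel (cball z 1) = ennreal V"
    using emeasure_cball_pos[of 1, where 'a = 'a] by (metis zero_less_one)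
  obtain e :: 'a where e: "e \<in> Basis" using nonempty_Basis by blast
  show thesis
  proof (rule that)
    show "0 < V powr p * V / C" using V C by simp
    have "ennreal (V powr p * V / C) \<le> dirichlet_energy p (ball 0 2) \<phi>"
      if \<phi>: "\<phi> \<in> C0_infinity (ball 0 2)" "\<And>x. x \<in> cball (0::'a) 1 \<Longrightarrow> 1 \<le> \<phi> x" for \<phi>
    proof -
      have sub: "cball (3 *\<^sub>R e) 1 \<subseteq> cball (0::'a) 4" and disj: "y \<in> cball (3 *\<^sub>R e) 1 \<Longrightarrow> \<phi> y = 0" for y
      proof -
        have "norm (3 *\<^sub>R e) = 3" using e by simp
        then have "norm y \<le> 4 \<and> 2 \<le> norm y" if "y \<in> cball (3 *\<^sub>R e) 1" for y
          using norm_triangle_ineq2[of "3 *\<^sub>R e" y] norm_triangle_ineq2[of y "3 *\<^sub>R e"] that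
          by (auto simp: dist_norm norm_minus_commute)
        then show "cball (3 *\<^sub>R e) 1 \<subseteq> cball (0::'a) 4" "y \<in> cball (3 *\<^sub>R e) 1 \<Longrightarrow> \<phi> y = 0"
          using C0_infinity_zero(1)[OF \<phi>(1), of y] by (force simp: subset_iff)+
      qed
      have "ennreal (V powr p * V) = (\<integral>\<^sup>+x. ennreal (V powr p) * indicator (cball (0::'a) 1) x \<partial>lborel)"
        using V by (simp add: nn_integral_cmult_indicator ennreal_mult)
      also have "\<dots> \<le> (\<integral>\<^sup>+x\<in>cball 0 4. ennpowr (\<integral>\<^sup>+y\<in>cball 0 4. ennreal \<bar>\<phi> x - \<phi> y\<bar> \<partial>lborel) p \<partial>lborel)"
      proof (intro nn_integral_mono)
        fix x :: 'a
        have "ennpowr (ennreal V) p \<le> ennpowr (\<integral>\<^sup>+y\<in>cball 0 4. ennreal \<bar>\<phi> x - \<phi> y\<bar> \<partial>lborel) p" if "x \<in> cball 0 1"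
        proof (rule ennpowr_mono)
          have "ennreal V = (\<integral>\<^sup>+y. indicator (cball (3 *\<^sub>R e) 1) y \<partial>lborel)" using V by simp
          also have "\<dots> \<le> (\<integral>\<^sup>+y\<in>cball 0 4. ennreal \<bar>\<phi> x - \<phi> y\<bar> \<partial>lborel)"
            using sub disj \<phi>(2)[OF that] by (intro nn_integral_mono) (auto simp: indicator_def)
          finally show "ennreal V \<le> (\<integral>\<^sup>+y\<in>cball 0 4. ennreal \<bar>\<phi> x - \<phi> y\<bar> \<partial>lborel)" .
        qed (use p in simp)
        then show "ennreal (V powr p) * indicator (cball 0 1) x
            \<le> ennpowr (\<integral>\<^sup>+y\<in>cball 0 4. ennreal \<bar>\<phi> x - \<phi> y\<bar> \<partial>lborel) p * indicator (cball 0 4) x"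
          using V by (auto simp: indicator_def)
      qed
      also have "\<dots> \<le> ennreal C * (\<integral>\<^sup>+x\<in>cball 0 4. ennreal (norm (grad \<phi> x) powr p) \<partial>lborel)"
        using C(2)[OF C0_infinity_smooth[OF \<phi>(1)], of 0] p by simp
      also have "(\<integral>\<^sup>+x\<in>cball 0 4. ennreal (norm (grad \<phi> x) powr p) \<partial>lborel) \<le> dirichlet_energy p UNIV \<phi>"
        unfolding dirichlet_energy_def by (intro nn_integral_mono) (auto simp: indicator_def)
      finally have "ennreal (1 / C) * ennreal (V powr p * V) \<le> ennreal (1 / C) * (ennreal C * dirichlet_energy p UNIV \<phi>)"
        by (simp add: mult_left_mono)
      also have "\<dots> = dirichlet_energy p (ball 0 2) \<phi>"
        using C by (simp add: mult.assoc[symmetric] ennreal_mult[symmetric] dirichlet_energy_eq_UNIV[OF \<phi>(1)])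
      finally show ?thesis using C V by (simp add: ennreal_mult[symmetric])
    qed
    then show "ennreal (V powr p * V / C) \<le> capacity p (cball (0::'a) 1) (ball 0 2)"
      unfolding capacity_def by (intro INF_greatest) blast
  qed
qed

section \<open>Deviation from the mean and capacity on a fixed ball\<close>

lemma mean_deviation_le:
  fixes u :: "'a::euclidean_space \<Rightarrow> real"
  assumes u: "smooth u" and B: "compact B" and V: "emeasure lborel B = ennreal V" "0 < V"
  defines "m \<equiv> (\<integral>y. u y * indicator B y \<partial>lborel) / V"
  shows "ennreal (V * \<bar>u x - m\<bar>) \<le> (\<integral>\<^sup>+y\<in>B. ennreal \<bar>u x - u y\<bar> \<partial>lborel)"
proof -
  have [measurable]: "B \<in> sets borel" using B by (simp add: compact_imp_closed)
  have i1: "integrable lborel (\<lambda>y. u y * indicator B y)"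
    using borel_integrable_compact[OF B smooth_continuous_on[OF u]] by (simp add: mult.commute)
  have i2: "integrable lborel (\<lambda>y. u x * indicator B y)"
    using V by (intro integrable_mult_right integrable_real_indicator) auto
  have mB: "measure lborel B = V" using V by (simp add: measure_def)
  have "(\<integral>y. (u x - u y) * indicator B y \<partial>lborel) = V * (u x - m)"
    using Bochner_Integration.integral_diff[OF i2 i1] V mB by (simp add: left_diff_distrib m_def right_diff_distrib)
  then have "ennreal (V * \<bar>u x - m\<bar>) = ennreal (norm (\<integral>y. (u x - u y) * indicator B y \<partial>lborel))"
    using V by (simp add: abs_mult)
  also have "\<dots> \<le> (\<integral>\<^sup>+y. ennreal (norm ((u x - u y) * indicator B y)) \<partial>lborel)"
    using Bochner_Integration.integrable_diff[OF i2 i1]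
    by (intro integral_norm_bound_ennreal) (simp add: left_diff_distrib)
  also have "\<dots> = (\<integral>\<^sup>+y\<in>B. ennreal \<bar>u x - u y\<bar> \<partial>lborel)"
    by (intro nn_integral_cong) (auto simp: indicator_def)
  finally show ?thesis .
qed

lemma mean_deviation_Lq:
  fixes p q \<rho> :: real
  assumes p: "1 \<le> p" and pq: "p \<le> q" and sub: "DIM('a) * (1 / p - 1 / q) < 1" and \<rho>: "0 < \<rho>"
  obtains C where "0 < C" "\<And>(u :: 'a::euclidean_space \<Rightarrow> real) z. smooth u \<Longrightarrow>
    (\<integral>\<^sup>+x\<in>cball z \<rho>. ennreal (\<bar>u x - (\<integral>y. u y * indicator (cball z \<rho>) y \<partial>lborel) / measure lborel (cball z \<rho>)\<bar> powr q) \<partial>lborel)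
      \<le> ennreal C * ennpowr (\<integral>\<^sup>+x\<in>cball z \<rho>. ennreal (norm (grad u x) powr p) \<partial>lborel) (q / p)"
proof -
  obtain C where C: "0 < C" "\<And>(u :: 'a \<Rightarrow> real) z. smooth u \<Longrightarrow>
    (\<integral>\<^sup>+x\<in>cball z \<rho>. ennpowr (\<integral>\<^sup>+y\<in>cball z \<rho>. ennreal \<bar>u x - u y\<bar> \<partial>lborel) q \<partial>lborel)
      \<le> ennreal C * ennpowr (\<integral>\<^sup>+x\<in>cball z \<rho>. ennreal (norm (grad u x) powr p) \<partial>lborel) (q / p)"
    by (rule poincare_sobolev_ball[where 'a = 'a, OF p pq sub \<rho>]) auto
  obtain V where V: "0 < V" "\<And>z::'a. emeasure lborel (cball z \<rho>) = ennreal V"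
    using emeasure_cball_pos[OF \<rho>, where 'a = 'a] by metis
  show thesis
  proof (rule that)
    show "0 < (1 / V) powr q * C" using C V by simp
    fix u :: "'a \<Rightarrow> real" and z
    assume u: "smooth u"
    define m where "m = (\<integral>y. u y * indicator (cball z \<rho>) y \<partial>lborel) / V"
    have mV: "measure lborel (cball z \<rho>) = V" using V by (simp add: measure_def)
    have [measurable]: "u \<in> borel_measurable borel" using u by (rule borel_measurable_smooth)
    have [measurable]: "cball z \<rho> \<in> sets borel" by simp
    have "(\<integral>\<^sup>+x\<in>cball z \<rho>. ennreal (\<bar>u x - m\<bar> powr q) \<partial>lborel) \<le>
        (\<integral>\<^sup>+x. ennreal ((1 / V) powr q) * (ennpowr (\<integral>\<^sup>+y\<in>cball z \<rho>. ennreal \<bar>u x - u y\<bar> \<partial>lborel) q * indicator (cball z \<rho>) x) \<partial>lborel)"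
    proof (intro nn_integral_mono)
      fix x
      have "ennpowr (ennreal (V * \<bar>u x - m\<bar>)) q \<le> ennpowr (\<integral>\<^sup>+y\<in>cball z \<rho>. ennreal \<bar>u x - u y\<bar> \<partial>lborel) q"
        unfolding m_def using p pq V u by (intro ennpowr_mono mean_deviation_le) auto
      then have "ennreal ((1 / V) powr q) * ennpowr (ennreal (V * \<bar>u x - m\<bar>)) q
          \<le> ennreal ((1 / V) powr q) * ennpowr (\<integral>\<^sup>+y\<in>cball z \<rho>. ennreal \<bar>u x - u y\<bar> \<partial>lborel) q"
        by (rule mult_left_mono) simp
      moreover have "ennreal ((1 / V) powr q) * ennpowr (ennreal (V * \<bar>u x - m\<bar>)) q = ennreal (\<bar>u x - m\<bar> powr q)"
        using V by (simp add: ennreal_mult[symmetric] powr_mult[symmetric])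
      ultimately show "ennreal (\<bar>u x - m\<bar> powr q) * indicator (cball z \<rho>) x \<le>
          ennreal ((1 / V) powr q) * (ennpowr (\<integral>\<^sup>+y\<in>cball z \<rho>. ennreal \<bar>u x - u y\<bar> \<partial>lborel) q * indicator (cball z \<rho>) x)"
        by (simp add: indicator_def)
    qed
    also have "\<dots> = ennreal ((1 / V) powr q) *
        (\<integral>\<^sup>+x\<in>cball z \<rho>. ennpowr (\<integral>\<^sup>+y\<in>cball z \<rho>. ennreal \<bar>u x - u y\<bar> \<partial>lborel) q \<partial>lborel)"
      by (rule nn_integral_cmult) measurable
    also have "\<dots> \<le> ennreal ((1 / V) powr q) * (ennreal C * ennpowr (\<integral>\<^sup>+x\<in>cball z \<rho>. ennreal (norm (grad u x) powr p) \<partial>lborel) (q / p))"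
      by (intro mult_left_mono C u) simp
    finally show "(\<integral>\<^sup>+x\<in>cball z \<rho>. ennreal (\<bar>u x - (\<integral>y. u y * indicator (cball z \<rho>) y \<partial>lborel) / measure lborel (cball z \<rho>)\<bar> powr q) \<partial>lborel)
      \<le> ennreal ((1 / V) powr q * C) * ennpowr (\<integral>\<^sup>+x\<in>cball z \<rho>. ennreal (norm (grad u x) powr p) \<partial>lborel) (q / p)"
      using C by (simp add: m_def mV ennreal_mult mult.assoc)
  qed
qed

text \<open>The power of \<gamma> is kept explicit because the final constant has to be linear in
  \<gamma>. The oscillation of \<open>u\<close> about its mean is controlled with exponent q and
  does not involve \<Sigma>. The mean is controlled by the capacity, and there the Poincare
  inequality with exponent p is needed, since the energy of the competitor is an integral of p-th
  powers.\<close>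

lemma capacity_poincare:
  fixes p q c :: real
  assumes p: "1 \<le> p" and pq: "p \<le> q" and sub: "DIM('a) * (1 / p - 1 / q) < 1" and c: "0 < c"
  obtains K where "0 < K" "\<And>(u :: 'a::euclidean_space \<Rightarrow> real) z \<Sigma> \<gamma>. smooth u \<Longrightarrow> 0 < \<gamma> \<Longrightarrow> \<gamma> < 1 \<Longrightarrow>
    \<Sigma> \<subseteq> cball z 1 \<Longrightarrow> (\<And>x. x \<in> \<Sigma> \<Longrightarrow> u x = 0) \<Longrightarrow> ennreal (\<gamma> * c) \<le> capacity p \<Sigma> (ball z 2) \<Longrightarrow>
    (\<integral>\<^sup>+x\<in>cball z 2. ennreal (\<bar>u x\<bar> powr q) \<partial>lborel)
      \<le> ennreal (K * \<gamma> powr (- (q / p))) * ennpowr (\<integral>\<^sup>+x\<in>cball z 2. ennreal (norm (grad u x) powr p) \<partial>lborel) (q / p)"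
proof -
  obtain Cp where Cp: "0 < Cp" "\<And>(u :: 'a \<Rightarrow> real) z. smooth u \<Longrightarrow>
    (\<integral>\<^sup>+x\<in>cball z 2. ennreal (\<bar>u x - (\<integral>y. u y * indicator (cball z 2) y \<partial>lborel) / measure lborel (cball z 2)\<bar> powr p) \<partial>lborel)
      \<le> ennreal Cp * ennpowr (\<integral>\<^sup>+x\<in>cball z 2. ennreal (norm (grad u x) powr p) \<partial>lborel) (p / p)"
    by (rule mean_deviation_Lq[where 'a = 'a, of p p 2]) (use p in auto)
  obtain Cq where Cq: "0 < Cq" "\<And>(u :: 'a \<Rightarrow> real) z. smooth u \<Longrightarrow>
    (\<integral>\<^sup>+x\<in>cball z 2. ennreal (\<bar>u x - (\<integral>y. u y * indicator (cball z 2) y \<partial>lborel) / measure lborel (cball z 2)\<bar> powr q) \<partial>lborel)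
      \<le> ennreal Cq * ennpowr (\<integral>\<^sup>+x\<in>cball z 2. ennreal (norm (grad u x) powr p) \<partial>lborel) (q / p)"
    by (rule mean_deviation_Lq[where 'a = 'a, OF p pq sub, of 2]) auto
  obtain V where V: "0 < V" "\<And>z::'a. emeasure lborel (cball z 2) = ennreal V"
    using emeasure_cball_pos[of 2, where 'a = 'a] by (metis zero_less_numeral)
  obtain \<eta>\<^sub>0 :: "'a \<Rightarrow> real" where \<eta>\<^sub>0: "smooth \<eta>\<^sub>0" "\<And>x. 0 \<le> \<eta>\<^sub>0 x" "\<And>x. \<eta>\<^sub>0 x \<le> 1"
    "\<And>x. x \<in> cball 0 1 \<Longrightarrow> \<eta>\<^sub>0 x = 1" "\<eta>\<^sub>0 \<in> C0_infinity (ball 0 2)"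
    using ball_cutoff_exists[of 1 2 "0::'a"] by (metis one_less_numeral_iff semiring_norm(76) zero_less_one)
  obtain M where M: "0 < M" "\<And>x. norm (grad \<eta>\<^sub>0 x) \<le> M" using C0_infinity_bounded[OF \<eta>\<^sub>0(5)] by metis
  \<comment> \<open>Bounds the energy of the competitor, up to |m|^p: \<open>M powr p * Cp\<close>
    stems from differentiating the cutoff, and 1 from differentiating \<open>u\<close>.\<close>
  define C' where "C' = 2 powr p * (M powr p * Cp + 1)"
  define K where "K = 2 powr q * (Cq + V * (C' / c) powr (q / p))"
  have C': "0 < C'" using Cp M by (simp add: C'_def add_pos_pos)
  have K: "0 < K" using Cq V C' c by (simp add: K_def add_pos_pos)
  show thesis
  proof (rule that[OF K])
    fix u :: "'a \<Rightarrow> real" and z :: 'a and \<Sigma> and \<gamma> :: real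
    assume u: "smooth u" and \<gamma>: "0 < \<gamma>" "\<gamma> < 1" and \<Sigma>: "\<Sigma> \<subseteq> cball z 1" "\<And>x. x \<in> \<Sigma> \<Longrightarrow> u x = 0"
      and cap: "ennreal (\<gamma> * c) \<le> capacity p \<Sigma> (ball z 2)"
    define B where "B = cball z 2"
    have [measurable]: "B \<in> sets borel" by (simp add: B_def)
    have VB: "emeasure lborel B = ennreal V" using V by (simp add: B_def)
    have [measurable]: "u \<in> borel_measurable borel" "grad u \<in> borel_measurable borel"
      using u by (rule borel_measurable_smooth, rule borel_measurable_grad)
    define G where "G = (\<integral>\<^sup>+x\<in>B. ennreal (norm (grad u x) powr p) \<partial>lborel)"
    define m where "m = (\<integral>y. u y * indicator B y \<partial>lborel) / measure lborel B"
    have Dp: "(\<integral>\<^sup>+x\<in>B. ennreal (\<bar>u x - m\<bar> powr p) \<partial>lborel) \<le> ennreal Cp * G"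
      using Cp(2)[OF u, of z] p by (simp add: B_def G_def m_def)
    have Dq: "(\<integral>\<^sup>+x\<in>B. ennreal (\<bar>u x - m\<bar> powr q) \<partial>lborel) \<le> ennreal Cq * ennpowr G (q / p)"
      using Cq(2)[OF u, of z] by (simp add: B_def G_def m_def)
    have "(\<integral>\<^sup>+x\<in>B. ennreal (\<bar>u x\<bar> powr q) \<partial>lborel) \<le> ennreal (K * \<gamma> powr (- (q / p))) * ennpowr G (q / p)"
    proof (cases G rule: ennreal_cases)
      case top
      then show ?thesis using K \<gamma> by (simp add: ennreal_mult_top)
    next
      case (real g)
      have mp: "\<bar>m\<bar> powr p \<le> C' * g / (\<gamma> * c)"
      proof (cases "m = 0")
        case True
        then show ?thesis using C' real \<gamma> c by simp
      next
        case False
        define \<eta> where "\<eta> x = \<eta>\<^sub>0 (- z + 1 *\<^sub>R x)" for x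
        have \<eta>s: "smooth \<eta>" unfolding \<eta>_def by (rule smooth_affine[OF \<eta>\<^sub>0(1)])
        have \<eta>: "\<And>x. 0 \<le> \<eta> x" "\<And>x. \<eta> x \<le> 1" "\<And>x. x \<in> cball z 1 \<Longrightarrow> \<eta> x = 1"
          unfolding \<eta>_def using \<eta>\<^sub>0(2-4)
          by (auto simp: dist_norm norm_minus_commute)
        have \<eta>C: "\<eta> \<in> C0_infinity (ball z 2)"
          using C0_infinity_affine[OF \<eta>\<^sub>0(5) zero_less_one, of "- z"] vimage_affine_ball[of 1 "- z" z 2]
          by (simp add: \<eta>_def[abs_def])
        have M\<eta>: "norm (grad \<eta> x) \<le> M" for x
          unfolding \<eta>_def by (subst grad_affine[OF \<eta>\<^sub>0(1)]) (simp add: M)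
        \<comment> \<open>The first factor is the deviation from the mean divided by m, so the term
          in which the cutoff is differentiated is controlled by Poincare's inequality
          \<open>Dp\<close>. On \<Sigma> the function \<open>u\<close> vanishes and the cutoff is 1,
          which makes \<phi> equal to 1 there.\<close>
        define \<phi> where "\<phi> x = (1 - 1 / m * u x) * \<eta> x" for x
        have sm1: "smooth (\<lambda>x. 1 - 1 / m * u x)" by (intro smooth_diff smooth_mult smooth_const u)
        have \<phi>C: "\<phi> \<in> C0_infinity (ball z 2)"
          unfolding \<phi>_def by (rule C0_infinity_mult[OF sm1 \<eta>C])
        have g\<phi>: "grad \<phi> x = (1 - 1 / m * u x) *\<^sub>R grad \<eta> x - (\<eta> x / m) *\<^sub>R grad u x" for x
        proof -
          have "grad (\<lambda>x. 1 / m * u x) x = (1 / m) *\<^sub>R grad u x"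
            by (subst grad_mult[OF smooth_const u]) (simp add: grad_const)
          then have "grad (\<lambda>x. 1 - 1 / m * u x) x = - ((1 / m) *\<^sub>R grad u x)"
            by (subst grad_diff[OF smooth_const smooth_mult[OF smooth_const u]]) (simp add: grad_const)
          then show ?thesis
            unfolding \<phi>_def by (subst grad_mult[OF sm1 \<eta>s]) simp
        qed
        have bound: "norm (grad \<phi> x) powr p \<le>
            (1 / \<bar>m\<bar>) powr p * (2 powr p * (M powr p * \<bar>u x - m\<bar> powr p + norm (grad u x) powr p))" for x
        proof -
          have "norm (grad \<phi> x) \<le> \<bar>1 - 1 / m * u x\<bar> * norm (grad \<eta> x) + \<bar>\<eta> x / m\<bar> * norm (grad u x)"
            unfolding g\<phi> using norm_triangle_ineq4 by (metis norm_scaleR)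
          also have "\<dots> \<le> (\<bar>u x - m\<bar> / \<bar>m\<bar>) * M + (1 / \<bar>m\<bar>) * norm (grad u x)"
          proof (intro add_mono mult_mono)
            show "\<bar>1 - 1 / m * u x\<bar> \<le> \<bar>u x - m\<bar> / \<bar>m\<bar>"
              using False by (simp add: abs_divide[symmetric] diff_divide_distrib abs_minus_commute)
            show "\<bar>\<eta> x / m\<bar> \<le> 1 / \<bar>m\<bar>" using \<eta>(1,2)[of x] by (simp add: divide_right_mono)
          qed (use M\<eta> M in auto)
          also have "\<dots> = (1 / \<bar>m\<bar>) * (M * \<bar>u x - m\<bar> + norm (grad u x))" by (simp add: algebra_simps)
          finally have "norm (grad \<phi> x) powr p \<le> ((1 / \<bar>m\<bar>) * (M * \<bar>u x - m\<bar> + norm (grad u x))) powr p"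
            using p by (intro powr_mono2) auto
          also have "\<dots> = (1 / \<bar>m\<bar>) powr p * (M * \<bar>u x - m\<bar> + norm (grad u x)) powr p"
            using M by (intro powr_mult)
          also have "(M * \<bar>u x - m\<bar> + norm (grad u x)) powr p \<le>
              2 powr p * (M powr p * \<bar>u x - m\<bar> powr p + norm (grad u x) powr p)"
            using powr_add_le[of "M * \<bar>u x - m\<bar>" "norm (grad u x)" p] M p by (simp add: powr_mult)
          finally show ?thesis by (simp add: mult_left_mono)
        qed
        have "ennreal (\<gamma> * c) \<le> dirichlet_energy p UNIV \<phi>"
          using cap by (rule order_trans) (rule capacity_le[OF \<phi>C], use \<Sigma> \<eta>(3) in \<open>auto simp: \<phi>_def subset_iff\<close>)
        also have "\<dots> = dirichlet_energy p (ball z 2) \<phi>" by (rule dirichlet_energy_eq_UNIV[OF \<phi>C, symmetric])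
        also have "\<dots> \<le> (\<integral>\<^sup>+x. ennreal ((1 / \<bar>m\<bar>) powr p * 2 powr p) *
            (ennreal (M powr p) * (ennreal (\<bar>u x - m\<bar> powr p) * indicator B x)
              + ennreal (norm (grad u x) powr p) * indicator B x) \<partial>lborel)"
          unfolding dirichlet_energy_def
        proof (intro nn_integral_mono)
          show "ennreal (norm (grad \<phi> x) powr p) * indicator (ball z 2) x \<le> ennreal ((1 / \<bar>m\<bar>) powr p * 2 powr p) *
            (ennreal (M powr p) * (ennreal (\<bar>u x - m\<bar> powr p) * indicator B x)
              + ennreal (norm (grad u x) powr p) * indicator B x)" for x
            using ennreal_leI[OF bound[of x]] M
            by (auto simp: indicator_def B_def ennreal_mult mult.assoc)
        qed
        also have "\<dots> = ennreal ((1 / \<bar>m\<bar>) powr p * 2 powr p) *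
            (ennreal (M powr p) * (\<integral>\<^sup>+x\<in>B. ennreal (\<bar>u x - m\<bar> powr p) \<partial>lborel) + G)"
          unfolding G_def by (simp add: nn_integral_cmult nn_integral_add)
        also have "\<dots> \<le> ennreal ((1 / \<bar>m\<bar>) powr p * 2 powr p) * (ennreal (M powr p) * (ennreal Cp * G) + G)"
          using Dp by (intro mult_left_mono add_right_mono) auto
        also have "\<dots> = ennreal ((1 / \<bar>m\<bar>) powr p * (C' * g))"
          using real Cp by (simp add: C'_def ennreal_mult[symmetric] ennreal_plus[symmetric] algebra_simps del: ennreal_plus)
        finally have "\<gamma> * c \<le> (1 / \<bar>m\<bar>) powr p * (C' * g)"
          using C' real by (subst (asm) ennreal_le_iff) auto
        then show ?thesis using False \<gamma> c by (simp add: powr_divide field_simps)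
      qed
      have mq: "\<bar>m\<bar> powr q \<le> (C' / c) powr (q / p) * \<gamma> powr (- (q / p)) * g powr (q / p)"
      proof -
        have "\<bar>m\<bar> powr q = (\<bar>m\<bar> powr p) powr (q / p)" using p by (simp add: powr_powr)
        also have "\<dots> \<le> (C' * g / (\<gamma> * c)) powr (q / p)" using mp p pq by (intro powr_mono2) auto
        also have "\<dots> = (C' / c) powr (q / p) * \<gamma> powr (- (q / p)) * g powr (q / p)"
          using C' c \<gamma> real by (simp add: powr_mult powr_divide powr_minus_divide field_simps)
        finally show ?thesis .
      qed
      \<comment> \<open>The oscillation term carries no power of \<gamma>; as \<gamma> < 1 it can be
        multiplied by this one and merged with the term from the mean.\<close>
      have \<gamma>1: "1 \<le> \<gamma> powr (- (q / p))"
        using powr_mono2'[of "- (q / p)" \<gamma> 1] \<gamma> p pq by simp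
      have "(\<integral>\<^sup>+x\<in>B. ennreal (\<bar>u x\<bar> powr q) \<partial>lborel) \<le>
          (\<integral>\<^sup>+x. ennreal (2 powr q) * (ennreal (\<bar>u x - m\<bar> powr q) * indicator B x + ennreal (\<bar>m\<bar> powr q) * indicator B x) \<partial>lborel)"
      proof (intro nn_integral_mono)
        fix x
        have "\<bar>u x\<bar> powr q \<le> (\<bar>u x - m\<bar> + \<bar>m\<bar>) powr q" using p pq by (intro powr_mono2) auto
        also have "\<dots> \<le> 2 powr q * (\<bar>u x - m\<bar> powr q + \<bar>m\<bar> powr q)" using p pq by (intro powr_add_le) auto
        finally have "ennreal (\<bar>u x\<bar> powr q) \<le> ennreal (2 powr q * (\<bar>u x - m\<bar> powr q + \<bar>m\<bar> powr q))" by (rule ennreal_leI)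
        then show "ennreal (\<bar>u x\<bar> powr q) * indicator B x \<le>
            ennreal (2 powr q) * (ennreal (\<bar>u x - m\<bar> powr q) * indicator B x + ennreal (\<bar>m\<bar> powr q) * indicator B x)"
          by (auto simp: indicator_def ennreal_mult)
      qed
      also have "\<dots> = ennreal (2 powr q) * ((\<integral>\<^sup>+x\<in>B. ennreal (\<bar>u x - m\<bar> powr q) \<partial>lborel) + ennreal (\<bar>m\<bar> powr q) * ennreal V)"
        by (simp add: nn_integral_cmult nn_integral_add nn_integral_cmult_indicator VB)
      also have "\<dots> \<le> ennreal (2 powr q) * (ennreal Cq * ennpowr G (q / p) + ennreal (\<bar>m\<bar> powr q) * ennreal V)"
        by (intro mult_left_mono add_right_mono Dq) auto
      also have "\<dots> = ennreal (2 powr q * (Cq * g powr (q / p) + \<bar>m\<bar> powr q * V))"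
        using real Cq V by (simp add: ennreal_mult)
      also have "\<dots> \<le> ennreal (K * \<gamma> powr (- (q / p)) * g powr (q / p))"
      proof (rule ennreal_leI)
        have "Cq * g powr (q / p) \<le> Cq * g powr (q / p) * \<gamma> powr (- (q / p))"
          using mult_left_mono[OF \<gamma>1, of "Cq * g powr (q / p)"] Cq(1) by simp
        moreover have "\<bar>m\<bar> powr q * V \<le> (C' / c) powr (q / p) * \<gamma> powr (- (q / p)) * g powr (q / p) * V"
          using mq V by (intro mult_right_mono) auto
        ultimately have "2 powr q * (Cq * g powr (q / p) + \<bar>m\<bar> powr q * V) \<le> 2 powr q *
            (Cq * g powr (q / p) * \<gamma> powr (- (q / p)) + (C' / c) powr (q / p) * \<gamma> powr (- (q / p)) * g powr (q / p) * V)"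
          by (intro mult_left_mono) auto
        then show "2 powr q * (Cq * g powr (q / p) + \<bar>m\<bar> powr q * V) \<le> K * \<gamma> powr (- (q / p)) * g powr (q / p)"
          by (simp add: K_def algebra_simps)
      qed
      also have "\<dots> = ennreal (K * \<gamma> powr (- (q / p))) * ennpowr G (q / p)"
        using real Cq V by (simp add: ennreal_mult K_def)
      finally show ?thesis .
    qed
    then show "(\<integral>\<^sup>+x\<in>cball z 2. ennreal (\<bar>u x\<bar> powr q) \<partial>lborel)
      \<le> ennreal (K * \<gamma> powr (- (q / p))) * ennpowr (\<integral>\<^sup>+x\<in>cball z 2. ennreal (norm (grad u x) powr p) \<partial>lborel) (q / p)"
      by (simp add: B_def G_def)
  qed
qed

lemma capacity_translate:
  "capacity p (cball (z::'a::euclidean_space) 1) (ball z 2) = capacity p (cball (0::'a) 1) (ball 0 2)"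
proof -
  have "(\<lambda>x. z + 1 *\<^sub>R x) -` cball z 1 = cball 0 1" "(\<lambda>x. z + 1 *\<^sub>R x) -` ball z 2 = ball 0 2"
    using vimage_affine_cball[of 1 z 0 1] vimage_affine_ball[of 1 z 0 2] by simp_all
  then have "capacity p (cball (0::'a) 1) (ball 0 2) = ennreal (1 powr (p - DIM('a))) * capacity p (cball z 1) (ball z 2)"
    using capacity_affine[of 1 p z "cball z 1" "ball z 2"] by (simp only: zero_less_one simp_thms)
  then show ?thesis by simp
qed

text \<open>By Fubini a point \<open>x\<close> is counted once for each centre within distance
  \<rho>, hence with weight \<open>V\<close>. Applied to both sides of the local inequality, the
  averaging produces the same factor \<open>V\<close>, which cancels.\<close>

lemma nn_integral_average_cball:
  fixes f :: "'a::euclidean_space \<Rightarrow> ennreal"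
  assumes [measurable]: "f \<in> borel_measurable borel"
    and V: "\<And>z::'a. emeasure lborel (cball z \<rho>) = ennreal V"
  shows "(\<integral>\<^sup>+z. (\<integral>\<^sup>+x\<in>cball z \<rho>. f x \<partial>lborel) \<partial>lborel) = ennreal V * (\<integral>\<^sup>+x. f x \<partial>lborel)"
proof -
  have "(\<integral>\<^sup>+z. (\<integral>\<^sup>+x\<in>cball z \<rho>. f x \<partial>lborel) \<partial>lborel) =
      (\<integral>\<^sup>+z. (\<integral>\<^sup>+x. (if dist x z \<le> \<rho> then f x else 0) \<partial>lborel) \<partial>lborel)"
    by (intro nn_integral_cong) (auto simp: indicator_def dist_commute)
  also have "\<dots> = (\<integral>\<^sup>+x. (\<integral>\<^sup>+z. (if dist x z \<le> \<rho> then f x else 0) \<partial>lborel) \<partial>lborel)"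
    by (rule nn_integral_lborel_swap) measurable
  also have "\<dots> = (\<integral>\<^sup>+x. (\<integral>\<^sup>+z. f x * indicator (cball x \<rho>) z \<partial>lborel) \<partial>lborel)"
    by (intro nn_integral_cong) (auto simp: indicator_def)
  also have "\<dots> = ennreal V * (\<integral>\<^sup>+x. f x \<partial>lborel)"
    by (simp add: nn_integral_cmult_indicator V nn_integral_multc mult.commute[of "ennreal V"])
  finally show ?thesis .
qed

lemma poincare_sobolev_const_lower_unit:
  fixes p q :: real
  assumes p: "1 \<le> p" and pq: "p \<le> q" and sub: "DIM('a) * (1 / p - 1 / q) < 1"
  obtains \<sigma> where "0 < \<sigma>" "\<And>\<gamma> (\<Omega> :: 'a::euclidean_space set). 0 < \<gamma> \<Longrightarrow> \<gamma> < 1 \<Longrightarrow> open \<Omega> \<Longrightarrow>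
    (\<And>x\<^sub>0. \<not> capacity_negligible p \<gamma> x\<^sub>0 1 (cball x\<^sub>0 1 - \<Omega>)) \<Longrightarrow>
    ennreal (\<gamma> * \<sigma>) \<le> poincare_sobolev_const p q \<Omega>"
proof -
  obtain c where c: "0 < c" "ennreal c \<le> capacity p (cball (0::'a) 1) (ball 0 2)"
    using capacity_unit_ball_pos[OF p] by metis
  obtain K where K: "0 < K" "\<And>(u :: 'a \<Rightarrow> real) z \<Sigma> \<gamma>. smooth u \<Longrightarrow> 0 < \<gamma> \<Longrightarrow> \<gamma> < 1 \<Longrightarrow>
    \<Sigma> \<subseteq> cball z 1 \<Longrightarrow> (\<And>x. x \<in> \<Sigma> \<Longrightarrow> u x = 0) \<Longrightarrow> ennreal (\<gamma> * c) \<le> capacity p \<Sigma> (ball z 2) \<Longrightarrow>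
    (\<integral>\<^sup>+x\<in>cball z 2. ennreal (\<bar>u x\<bar> powr q) \<partial>lborel)
      \<le> ennreal (K * \<gamma> powr (- (q / p))) * ennpowr (\<integral>\<^sup>+x\<in>cball z 2. ennreal (norm (grad u x) powr p) \<partial>lborel) (q / p)"
    by (rule capacity_poincare[where 'a = 'a, OF p pq sub c(1)]) auto
  obtain V where V: "0 < V" "\<And>z::'a. emeasure lborel (cball z 2) = ennreal V"
    using emeasure_cball_pos[of 2, where 'a = 'a] by (metis zero_less_numeral)
  show thesis
  proof (rule that)
    show "0 < (1 / K) powr (p / q)" using K by simp
    fix \<gamma> :: real and \<Omega> :: "'a set"
    assume \<gamma>: "0 < \<gamma>" "\<gamma> < 1" and \<Omega>: "open \<Omega>"
      and non: "\<And>x\<^sub>0. \<not> capacity_negligible p \<gamma> x\<^sub>0 1 (cball x\<^sub>0 1 - \<Omega>)"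
    have cap: "ennreal (\<gamma> * c) \<le> capacity p (cball z 1 - \<Omega>) (ball z 2)" for z
    proof -
      have "compact (cball z 1 - \<Omega>)" using \<Omega> by (intro compact_diff) auto
      then have "ennreal \<gamma> * capacity p (cball z 1) (ball z 2) \<le> capacity p (cball z 1 - \<Omega>) (ball z 2)"
        using non[of z] by (auto simp: capacity_negligible_def)
      moreover have "ennreal \<gamma> * ennreal c \<le> ennreal \<gamma> * capacity p (cball z 1) (ball z 2)"
        unfolding capacity_translate[of p z] using c by (intro mult_left_mono) auto
      ultimately show ?thesis using \<gamma> c by (auto simp: ennreal_mult)
    qed
    show "ennreal (\<gamma> * (1 / K) powr (p / q)) \<le> poincare_sobolev_const p q \<Omega>"
      unfolding poincare_sobolev_const_def
    proof (rule INF_greatest)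
      fix u assume "u \<in> {u \<in> C0_infinity \<Omega>. ennpowr (Lq_norm q \<Omega> u) p = 1}"
      then have u: "u \<in> C0_infinity \<Omega>" and "ennpowr (Lq_norm q \<Omega> u) p = 1" by auto
      then have I: "(\<integral>\<^sup>+x. ennreal (\<bar>u x\<bar> powr q) \<partial>lborel) = 1"
        using p pq by (intro nn_integral_powr_eq_1) auto
      have sm: "smooth u" using u by (rule C0_infinity_smooth)
      have u0: "u x = 0" if "x \<notin> \<Omega>" for x using C0_infinity_zero[OF u that] by simp
      have [measurable]: "u \<in> borel_measurable borel" "grad u \<in> borel_measurable borel"
      using sm by (rule borel_measurable_smooth, rule borel_measurable_grad)
      define E where "E = (\<integral>\<^sup>+x. ennreal (norm (grad u x) powr p) \<partial>lborel)"
      have Eeq: "dirichlet_energy p \<Omega> u = E"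
        unfolding dirichlet_energy_eq_UNIV[OF u] by (simp add: dirichlet_energy_def E_def)
      define G where "G z = (\<integral>\<^sup>+x\<in>cball z 2. ennreal (norm (grad u x) powr p) \<partial>lborel)" for z
      have G_meas[measurable]: "G \<in> borel_measurable borel"
      proof -
        \<comment> \<open>The moving ball is rewritten as a condition on the distance, so that the
          integrand is visibly measurable in both variables.\<close>
        have "G = (\<lambda>z. \<integral>\<^sup>+x. (if dist x z \<le> 2 then ennreal (norm (grad u x) powr p) else 0) \<partial>lborel)"
          unfolding G_def by (intro ext nn_integral_cong) (auto simp: indicator_def dist_commute)
        then show ?thesis by simp
      qed
      have GE: "G z \<le> E" for z
        unfolding G_def E_def by (intro nn_integral_mono) (auto simp: indicator_def)
      define k where "k = K * \<gamma> powr (- (q / p))"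
      have k: "0 < k" using K \<gamma> by (simp add: k_def)
      have "ennreal V = (\<integral>\<^sup>+z. (\<integral>\<^sup>+x\<in>cball z 2. ennreal (\<bar>u x\<bar> powr q) \<partial>lborel) \<partial>lborel)"
        by (subst nn_integral_average_cball[OF _ V(2)]) (auto simp: I)
      also have "\<dots> \<le> (\<integral>\<^sup>+z. ennreal k * (ennpowr E (q / p - 1) * G z) \<partial>lborel)"
      proof (intro nn_integral_mono)
        fix z
        have "(\<integral>\<^sup>+x\<in>cball z 2. ennreal (\<bar>u x\<bar> powr q) \<partial>lborel) \<le> ennreal k * ennpowr (G z) (q / p)"
          unfolding k_def G_def by (rule K(2)[OF sm \<gamma> _ _ cap[of z]]) (auto simp: u0)
        also have "ennpowr (G z) (q / p) = ennpowr (G z) (q / p - 1) * G z"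
          using ennpowr_add[of "G z" "q / p - 1" 1] by simp
        \<comment> \<open>This is where q \<ge> p enters: the exponent q / p - 1 is nonnegative, so
          the local energy in that power can be replaced by the global one, and a single factor
          \<open>G z\<close> remains to be integrated over the centres.\<close>
        also have "ennreal k * \<dots> \<le> ennreal k * (ennpowr E (q / p - 1) * G z)"
          using p pq by (intro mult_left_mono mult_right_mono ennpowr_mono GE) auto
        finally show "(\<integral>\<^sup>+x\<in>cball z 2. ennreal (\<bar>u x\<bar> powr q) \<partial>lborel) \<le> ennreal k * (ennpowr E (q / p - 1) * G z)" .
      qed
      also have "\<dots> = ennreal k * (ennpowr E (q / p - 1) * (\<integral>\<^sup>+z. G z \<partial>lborel))"
        by (simp add: nn_integral_cmult)
      also have "(\<integral>\<^sup>+z. G z \<partial>lborel) = ennreal V * E"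
        unfolding G_def E_def by (rule nn_integral_average_cball[OF _ V(2)]) measurable
      also have "ennreal k * (ennpowr E (q / p - 1) * (ennreal V * E)) = ennreal (V * k) * ennpowr E (q / p)"
        using ennpowr_add[of E "q / p - 1" 1] k V by (simp add: ennreal_mult mult_ac)
      finally have main: "ennreal V \<le> ennreal (V * k) * ennpowr E (q / p)" .
      have "ennreal (\<gamma> * (1 / K) powr (p / q)) \<le> E"
      proof (cases E rule: ennreal_cases)
        case (real e)
        have "V \<le> V * k * e powr (q / p)"
          using main real V k by (simp add: ennreal_mult[symmetric])
        then have "1 / k \<le> e powr (q / p)" using V k by (simp add: field_simps)
        then have "(1 / k) powr (p / q) \<le> (e powr (q / p)) powr (p / q)"
          using p pq k by (intro powr_mono2) auto
        also have "\<dots> = e" using p pq real by (simp add: powr_powr)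
        \<comment> \<open>The power \<gamma>^(-q/p) in \<open>k\<close> was kept for this moment:
          here it becomes exactly \<gamma>.\<close>
        also have "(1 / k) powr (p / q) = \<gamma> * (1 / K) powr (p / q)"
          using p pq K \<gamma> by (simp add: k_def powr_divide powr_mult powr_powr powr_minus_divide)
        finally show ?thesis using real by (simp add: ennreal_leI)
      qed simp
      then show "ennreal (\<gamma> * (1 / K) powr (p / q)) \<le> dirichlet_energy p \<Omega> u" by (simp add: Eeq)
    qed
  qed
qed

subsection \<open>Continuity of the capacity under dilations\<close>

lemma powr_convex_combination:
  assumes "1 \<le> p" "0 \<le> a" "0 \<le> (b::real)" "0 \<le> s" "s \<le> 1"
  shows "((1 - s) * a + s * b) powr p \<le> (1 - s) * a powr p + s * b powr p"
proof -
  define m where "m = (1 - s) * a + s * b"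
  have "0 \<le> m" using assms by (simp add: m_def)
  show ?thesis
  proof (cases "m = 0")
    case False
    with \<open>0 \<le> m\<close> have m: "0 < m" by simp
    have "(1 - s) * (p * m powr (p - 1) * a) \<le> (1 - s) * (a powr p + (p - 1) * m powr p)"
      "s * (p * m powr (p - 1) * b) \<le> s * (b powr p + (p - 1) * m powr p)"
      using assms m by (intro mult_left_mono powr_above_tangent; simp)+
    then have "p * m powr (p - 1) * m \<le> (1 - s) * a powr p + s * b powr p + (p - 1) * m powr p"
      by (simp add: m_def algebra_simps)
    moreover have "p * m powr (p - 1) * m = p * m powr p" using m by (simp add: powr_diff)
    ultimately have "m powr p \<le> (1 - s) * a powr p + s * b powr p" by (simp add: left_diff_distrib)
    then show ?thesis by (simp add: m_def)
  qed (use assms in \<open>simp flip: m_def\<close>)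
qed

text \<open>Write a + b as the convex combination of a / (1 - s) and b / s. Unlike in
  \<open>powr_add_le\<close>, the coefficient of the main term tends to 1 as \<open>s\<close> tends
  to 0; the price is a large coefficient for the perturbation \<open>b\<close>.\<close>

lemma powr_add_le_weighted:
  assumes "1 \<le> p" "0 \<le> a" "0 \<le> (b::real)" "0 < s" "s < 1"
  shows "(a + b) powr p \<le> (1 - s) powr (1 - p) * a powr p + s powr (1 - p) * b powr p"
proof -
  have "(a + b) powr p = ((1 - s) * (a / (1 - s)) + s * (b / s)) powr p" using assms by simp
  also have "\<dots> \<le> (1 - s) * (a / (1 - s)) powr p + s * (b / s) powr p"
    using assms by (intro powr_convex_combination) auto
  also have "\<dots> = (1 - s) powr (1 - p) * a powr p + s powr (1 - p) * b powr p"
    using assms by (simp add: powr_divide powr_diff)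
  finally show ?thesis .
qed

lemma C0_infinity_mono: "u \<in> C0_infinity A \<Longrightarrow> A \<subseteq> B \<Longrightarrow> u \<in> C0_infinity B"
  by (auto simp: C0_infinity_def)

lemma C0_infinity_add:
  assumes "u \<in> C0_infinity \<Omega>" "v \<in> C0_infinity \<Omega>"
  shows "(\<lambda>x. u x + v x) \<in> C0_infinity \<Omega>"
proof -
  obtain K where K: "compact K" "K \<subseteq> \<Omega>" "\<And>x. x \<notin> K \<Longrightarrow> u x = 0"
    using C0_infinityE[OF assms(1)] by metis
  obtain L where L: "compact L" "L \<subseteq> \<Omega>" "\<And>x. x \<notin> L \<Longrightarrow> v x = 0"
    using C0_infinityE[OF assms(2)] by metis
  show ?thesis
    by (rule C0_infinityI[OF smooth_add[OF assms[THEN C0_infinity_smooth]] compact_Un[OF K(1) L(1)]])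
      (use K L in auto)
qed

lemma grad_bound_imp_lipschitz:
  assumes "smooth u" "\<And>x. norm (grad u x) \<le> M"
  shows "\<bar>u x - u y\<bar> \<le> M * dist x y"
proof -
  have "(u has_derivative (\<lambda>h. h \<bullet> grad u x)) (at x within UNIV)" for x
    using smooth_GDERIV[OF assms(1), of x] by (simp add: gderiv_def)
  moreover have "onorm (\<lambda>h. h \<bullet> grad u x) \<le> M" for x
  proof (rule onorm_le)
    fix h
    have "norm (h \<bullet> grad u x) \<le> norm h * norm (grad u x)"
      by (simp add: Cauchy_Schwarz_ineq2)
    also have "\<dots> \<le> norm h * M" by (intro mult_left_mono assms) simp
    finally show "norm (h \<bullet> grad u x) \<le> M * norm h" by (simp add: mult.commute)
  qed
  ultimately have "norm (u x - u y) \<le> M * norm (x - y)"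
    by (intro differentiable_bound[where S = UNIV]) auto
  then show ?thesis by (simp add: dist_norm)
qed

text \<open>The segment from \<open>x\<close> to \<open>\<theta> *\<^sub>R x\<close> lies on a ray,
  and its points are dilations of \<open>x\<close>, so Jensen in the parameter and a substitution in
  \<open>x\<close> suffice. The factor (1 - \<theta>)^p is what will make the blending error vanish
  as \<theta> tends to 1.\<close>

lemma nn_integral_dilation_difference:
  fixes \<psi> :: "'a::euclidean_space \<Rightarrow> real"
  assumes \<psi>: "smooth \<psi>" and p: "1 \<le> p" and \<theta>: "0 < \<theta>" "\<theta> < 1" and \<rho>: "0 \<le> \<rho>"
  shows "(\<integral>\<^sup>+x\<in>cball 0 \<rho>. ennreal (\<bar>\<psi> (\<theta> *\<^sub>R x) - \<psi> x\<bar> powr p) \<partial>lborel)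
    \<le> ennreal (((1 - \<theta>) * \<rho>) powr p * \<theta> powr (- real DIM('a))) * dirichlet_energy p UNIV \<psi>"
proof -
  have [measurable]: "grad \<psi> \<in> borel_measurable borel" using \<psi> by (rule borel_measurable_grad)
  define a where "a x = ennreal (norm (grad \<psi> x))" for x
  have [measurable]: "a \<in> borel_measurable borel" unfolding a_def by measurable
  define E where "E = (\<integral>\<^sup>+x. ennpowr (a x) p \<partial>lborel)"
  have E: "dirichlet_energy p UNIV \<psi> = E"
    by (simp add: E_def a_def dirichlet_energy_def)
  define I :: "real \<Rightarrow> ennreal" where "I = indicator {0<..1}"
  have [measurable]: "I \<in> borel_measurable borel" unfolding I_def by measurable
  have int_I: "(\<integral>\<^sup>+t. I t \<partial>lborel) = ennreal 1" by (simp add: I_def)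
  have "(\<integral>\<^sup>+x\<in>cball 0 \<rho>. ennreal (\<bar>\<psi> (\<theta> *\<^sub>R x) - \<psi> x\<bar> powr p) \<partial>lborel) \<le>
     (\<integral>\<^sup>+x. ennreal (((1 - \<theta>) * \<rho>) powr p) * (\<integral>\<^sup>+t. I t * ennpowr (a (0 + (1 - t * (1 - \<theta>)) *\<^sub>R x)) p \<partial>lborel) \<partial>lborel)"
  proof (intro nn_integral_mono)
    fix x :: 'a
    show "ennreal (\<bar>\<psi> (\<theta> *\<^sub>R x) - \<psi> x\<bar> powr p) * indicator (cball 0 \<rho>) x
      \<le> ennreal (((1 - \<theta>) * \<rho>) powr p) * (\<integral>\<^sup>+t. I t * ennpowr (a (0 + (1 - t * (1 - \<theta>)) *\<^sub>R x)) p \<partial>lborel)"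
    proof (cases "x \<in> cball 0 \<rho>")
      case True
      have "x - \<theta> *\<^sub>R x = (1 - \<theta>) *\<^sub>R x" by (simp add: algebra_simps)
      then have "dist x (\<theta> *\<^sub>R x) = (1 - \<theta>) * norm x" using \<theta> by (simp add: dist_norm)
      also have "\<dots> \<le> (1 - \<theta>) * \<rho>" using True \<theta> by (intro mult_left_mono) auto
      finally have "ennreal \<bar>\<psi> x - \<psi> (\<theta> *\<^sub>R x)\<bar> \<le> ennreal ((1 - \<theta>) * \<rho>) *
          (\<integral>\<^sup>+t. indicator {0<..1} t * ennreal (norm (grad \<psi> (x + t *\<^sub>R (\<theta> *\<^sub>R x - x)))) \<partial>lborel)"
        by (rule abs_diff_le_nn_integral_grad[OF \<psi>])
      also have "(\<integral>\<^sup>+t. indicator {0<..1} t * ennreal (norm (grad \<psi> (x + t *\<^sub>R (\<theta> *\<^sub>R x - x)))) \<partial>lborel)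
          = (\<integral>\<^sup>+t. I t * a (0 + (1 - t * (1 - \<theta>)) *\<^sub>R x) \<partial>lborel)"
        by (simp add: I_def a_def algebra_simps)
      finally have "ennpowr (ennreal \<bar>\<psi> x - \<psi> (\<theta> *\<^sub>R x)\<bar>) p \<le>
          ennpowr (ennreal ((1 - \<theta>) * \<rho>) * (\<integral>\<^sup>+t. I t * a (0 + (1 - t * (1 - \<theta>)) *\<^sub>R x) \<partial>lborel)) p"
        using p by (intro ennpowr_mono) auto
      also have "\<dots> = ennreal (((1 - \<theta>) * \<rho>) powr p) * ennpowr (\<integral>\<^sup>+t. I t * a (0 + (1 - t * (1 - \<theta>)) *\<^sub>R x) \<partial>lborel) p"
        using p \<theta> \<rho> by (intro ennpowr_mult_ennreal) auto
      also have "\<dots> \<le> ennreal (((1 - \<theta>) * \<rho>) powr p) *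
          (ennreal (1 powr (p - 1)) * (\<integral>\<^sup>+t. I t * ennpowr (a (0 + (1 - t * (1 - \<theta>)) *\<^sub>R x)) p \<partial>lborel))"
        using p int_I by (intro mult_left_mono nn_integral_Jensen) auto
      finally show ?thesis using True by (simp add: abs_minus_commute)
    qed simp
  qed
  also have "\<dots> = ennreal (((1 - \<theta>) * \<rho>) powr p) *
      (\<integral>\<^sup>+x. (\<integral>\<^sup>+t. I t * ennpowr (a (0 + (1 - t * (1 - \<theta>)) *\<^sub>R x)) p \<partial>lborel) \<partial>lborel)"
    by (rule nn_integral_cmult) measurable
  also have "(\<integral>\<^sup>+x. (\<integral>\<^sup>+t. I t * ennpowr (a (0 + (1 - t * (1 - \<theta>)) *\<^sub>R x)) p \<partial>lborel) \<partial>lborel)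
      = (\<integral>\<^sup>+t. (\<integral>\<^sup>+x. I t * ennpowr (a (0 + (1 - t * (1 - \<theta>)) *\<^sub>R x)) p \<partial>lborel) \<partial>lborel)"
    by (rule nn_integral_lborel_swap) measurable
  also have "\<dots> \<le> (\<integral>\<^sup>+t. I t * (ennreal (\<theta> powr (- real DIM('a))) * E) \<partial>lborel)"
  proof (intro nn_integral_mono)
    fix t :: real
    show "(\<integral>\<^sup>+x. I t * ennpowr (a (0 + (1 - t * (1 - \<theta>)) *\<^sub>R x)) p \<partial>lborel) \<le> I t * (ennreal (\<theta> powr (- real DIM('a))) * E)"
    proof (cases "t \<in> {0<..1}")
      case True
      have "t * (1 - \<theta>) \<le> 1 * (1 - \<theta>)" using True \<theta> by (intro mult_right_mono) auto
      \<comment> \<open>All dilation factors on the segment are at least \<theta>, so each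
        substitution costs at most \<theta>^(-N).\<close>
      then have c: "\<theta> \<le> 1 - t * (1 - \<theta>)" by simp
      have "(\<integral>\<^sup>+x. I t * ennpowr (a (0 + (1 - t * (1 - \<theta>)) *\<^sub>R x)) p \<partial>lborel)
          = I t * (\<integral>\<^sup>+x. ennpowr (a (0 + (1 - t * (1 - \<theta>)) *\<^sub>R x)) p \<partial>lborel)"
        by (rule nn_integral_cmult) measurable
      also have "(\<integral>\<^sup>+x. ennpowr (a (0 + (1 - t * (1 - \<theta>)) *\<^sub>R x)) p \<partial>lborel)
          = ennreal (\<bar>1 - t * (1 - \<theta>)\<bar> powr (- real DIM('a))) * E"
        unfolding E_def using c \<theta> by (intro nn_integral_affine) auto
      also have "\<dots> \<le> ennreal (\<theta> powr (- real DIM('a))) * E"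
        using c \<theta> by (intro mult_right_mono ennreal_leI powr_mono2') auto
      finally show ?thesis by (simp add: mult_left_mono)
    qed (simp add: I_def)
  qed
  also have "\<dots> = ennreal (\<theta> powr (- real DIM('a))) * E"
    by (simp add: nn_integral_multc int_I)
  finally show ?thesis
    unfolding E by (simp add: mult_left_mono ennreal_mult mult.assoc)
qed

text \<open>
  The competitor is a dilation of \<open>\<psi>\<close> near the unit ball and \<open>\<psi>\<close> itself near the boundary of
  \<open>ball 0 2\<close>, so the boundary condition is kept. Up to a small error its gradient is a convex combination of
  the two gradients, which is why no factor away from \<open>1\<close> is lost as \<open>\<theta>\<close> tends to \<open>1\<close>.
\<close>

lemma dirichlet_energy_blend_dilation:
  fixes \<psi> \<zeta> :: "'a::euclidean_space \<Rightarrow> real"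
  assumes p: "1 \<le> p" and \<theta>: "0 < \<theta>" "\<theta> < 1" and \<psi>: "\<psi> \<in> C0_infinity (ball 0 2)"
    and \<zeta>: "\<zeta> \<in> C0_infinity (ball 0 2)" "\<And>x. 0 \<le> \<zeta> x" "\<And>x. \<zeta> x \<le> 1"
    and M: "0 < M" "\<And>x. norm (grad \<zeta> x) \<le> M"
  shows "dirichlet_energy p UNIV (\<lambda>x. \<psi> x + (\<psi> (0 + \<theta> *\<^sub>R x) - \<psi> x) * \<zeta> x) \<le>
    ennreal (\<theta> powr (1 - p) * \<theta> powr (- real DIM('a)) * (1 + 2 * M * (1 - \<theta>) / \<theta>)
      + (1 - \<theta>) * (2 * M) powr p * \<theta> powr (- real DIM('a))) * dirichlet_energy p UNIV \<psi>"
proof -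
  \<comment> \<open>Serves also as the weight in \<open>powr_add_le_weighted\<close>. The error gets
    the coefficient \<tau>^(1-p), and the p-th power of the dilation difference supplies \<tau>^p,
    so one factor \<tau> survives and tends to 0.\<close>
  define \<tau> where "\<tau> = 1 - \<theta>"
  have \<tau>: "0 < \<tau>" "\<tau> < 1" "1 - \<tau> = \<theta>" using \<theta> by (auto simp: \<tau>_def)
  have sm: "smooth \<psi>" "smooth \<zeta>" using \<psi> \<zeta> by (auto intro: C0_infinity_smooth)
  have [measurable]: "\<psi> \<in> borel_measurable borel" "\<zeta> \<in> borel_measurable borel"
    using sm by (auto intro: borel_measurable_smooth)
  have [measurable]: "grad \<psi> \<in> borel_measurable borel" using sm(1) by (rule borel_measurable_grad)
  define a where "a x = norm (grad \<psi> x) powr p" for x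
  have [measurable]: "a \<in> borel_measurable borel" unfolding a_def by measurable
  have a0: "0 \<le> a x" for x by (simp add: a_def)
  define E where "E = (\<integral>\<^sup>+x. ennreal (a x) \<partial>lborel)"
  have E: "dirichlet_energy p UNIV \<psi> = E" by (simp add: E_def a_def dirichlet_energy_def)
  define d where "d x = \<bar>\<psi> (\<theta> *\<^sub>R x) - \<psi> x\<bar>" for x
  have [measurable]: "d \<in> borel_measurable borel" unfolding d_def by measurable
  define f where "f x = \<psi> x + (\<psi> (0 + \<theta> *\<^sub>R x) - \<psi> x) * \<zeta> x" for x
  have sd: "smooth (\<lambda>x. \<psi> (0 + \<theta> *\<^sub>R x) - \<psi> x)" by (intro smooth_diff[OF smooth_affine[OF sm(1)] sm(1)])
  have grad_f: "grad f x = (1 - \<zeta> x) *\<^sub>R grad \<psi> x + (\<zeta> x * \<theta>) *\<^sub>R grad \<psi> (\<theta> *\<^sub>R x)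
      + (\<psi> (\<theta> *\<^sub>R x) - \<psi> x) *\<^sub>R grad \<zeta> x" for x
    unfolding f_def
    by (simp only: grad_add[OF sm(1) smooth_mult[OF sd sm(2)]] grad_mult[OF sd sm(2)]
        grad_diff[OF smooth_affine[OF sm(1)] sm(1)] grad_affine[OF sm(1)])
      (simp add: algebra_simps)
  have pointwise: "norm (grad f x) powr p \<le> \<theta> powr (1 - p) * ((1 - \<zeta> x) * a x + \<zeta> x * a (\<theta> *\<^sub>R x))
      + \<tau> powr (1 - p) * (M powr p * (d x powr p * indicator (cball 0 2) x))" for x
  proof -
    define b where "b = (1 - \<zeta> x) * norm (grad \<psi> x) + \<zeta> x * norm (grad \<psi> (\<theta> *\<^sub>R x))"
    define r where "r = M * (d x * indicator (cball 0 2) x)"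
    have "norm (grad f x) \<le> norm ((1 - \<zeta> x) *\<^sub>R grad \<psi> x) + norm ((\<zeta> x * \<theta>) *\<^sub>R grad \<psi> (\<theta> *\<^sub>R x))
        + norm ((\<psi> (\<theta> *\<^sub>R x) - \<psi> x) *\<^sub>R grad \<zeta> x)"
      unfolding grad_f by (intro norm_triangle_le add_mono order_refl norm_triangle_ineq)
    also have "\<dots> \<le> b + r"
      unfolding b_def
    proof (intro add_mono)
      have "\<zeta> x * \<theta> * norm (grad \<psi> (\<theta> *\<^sub>R x)) \<le> \<zeta> x * 1 * norm (grad \<psi> (\<theta> *\<^sub>R x))"
        using \<zeta> \<theta> by (intro mult_right_mono mult_left_mono) auto
      then show "norm ((\<zeta> x * \<theta>) *\<^sub>R grad \<psi> (\<theta> *\<^sub>R x)) \<le> \<zeta> x * norm (grad \<psi> (\<theta> *\<^sub>R x))"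
        using \<zeta> \<theta> by simp
      show "norm ((\<psi> (\<theta> *\<^sub>R x) - \<psi> x) *\<^sub>R grad \<zeta> x) \<le> r"
      proof (cases "x \<in> ball 0 2")
        case True
        have "d x * norm (grad \<zeta> x) \<le> d x * M" by (intro mult_left_mono M) (simp add: d_def)
        then show ?thesis using True by (simp add: r_def d_def mult.commute)
      next
        case False
        then have "grad \<zeta> x = 0" by (rule C0_infinity_zero[OF \<zeta>(1)])
        then show ?thesis using M by (simp add: r_def d_def)
      qed
    qed (use \<zeta> in simp)
    finally have "norm (grad f x) powr p \<le> (b + r) powr p"
      using p by (intro powr_mono2) auto
    also have "\<dots> \<le> \<theta> powr (1 - p) * b powr p + \<tau> powr (1 - p) * r powr p"
      using powr_add_le_weighted[of p b r \<tau>] p \<zeta> M \<tau> by (simp add: b_def r_def d_def)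
    also have "b powr p \<le> (1 - \<zeta> x) * a x + \<zeta> x * a (\<theta> *\<^sub>R x)"
      unfolding b_def a_def using p \<zeta> by (intro powr_convex_combination) auto
    also have "r powr p = M powr p * (d x powr p * indicator (cball 0 2) x)"
      using M by (auto simp: r_def d_def powr_mult indicator_def)
    finally show ?thesis by (simp add: mult_left_mono)
  qed
  have blend: "(\<integral>\<^sup>+x. ennreal ((1 - \<zeta> x) * a x + \<zeta> x * a (\<theta> *\<^sub>R x)) \<partial>lborel)
      \<le> ennreal (\<theta> powr (- real DIM('a)) * (1 + 2 * M * (1 - \<theta>) / \<theta>)) * E"
  proof -
    \<comment> \<open>Substituting y = \<theta> x moves the argument of the cutoff to y / \<theta>.
      On the support of grad \<psi> the Lipschitz bound brings it back to y, so that the weights 1 -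
      \<zeta> and \<zeta> again add up to 1, up to an error of order 1 - \<theta>.\<close>
    have \<zeta>_shift: "\<zeta> ((1 / \<theta>) *\<^sub>R y) * a y \<le> (\<zeta> y + 2 * M * (1 - \<theta>) / \<theta>) * a y" for y
    proof (cases "y \<in> ball 0 2")
      case True
      have "dist ((1 / \<theta>) *\<^sub>R y) y = norm ((1 / \<theta> - 1) *\<^sub>R y)"
        by (simp add: dist_norm algebra_simps)
      also have "\<dots> = (1 - \<theta>) / \<theta> * norm y" using \<theta> by (simp add: field_simps)
      also have "\<dots> \<le> (1 - \<theta>) / \<theta> * 2" using True \<theta> by (intro mult_left_mono) auto
      finally have "M * dist ((1 / \<theta>) *\<^sub>R y) y \<le> M * ((1 - \<theta>) / \<theta> * 2)" using M by (intro mult_left_mono) auto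
      moreover have "\<bar>\<zeta> ((1 / \<theta>) *\<^sub>R y) - \<zeta> y\<bar> \<le> M * dist ((1 / \<theta>) *\<^sub>R y) y"
        by (rule grad_bound_imp_lipschitz[OF sm(2) M(2)])
      ultimately have "\<zeta> ((1 / \<theta>) *\<^sub>R y) \<le> \<zeta> y + 2 * M * (1 - \<theta>) / \<theta>" by (simp add: mult_ac)
      then show ?thesis using a0 by (intro mult_right_mono)
    next
      case False
      then have "a y = 0" using C0_infinity_zero(2)[OF \<psi>, of y] by (simp add: a_def)
      then show ?thesis by simp
    qed
    have "(\<integral>\<^sup>+x. ennreal ((1 - \<zeta> x) * a x + \<zeta> x * a (\<theta> *\<^sub>R x)) \<partial>lborel)
        = (\<integral>\<^sup>+x. ennreal ((1 - \<zeta> x) * a x) \<partial>lborel) + (\<integral>\<^sup>+x. ennreal (\<zeta> x * a (\<theta> *\<^sub>R x)) \<partial>lborel)"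
      using \<zeta> a0 by (subst nn_integral_add[symmetric]) auto
    also have "(\<integral>\<^sup>+x. ennreal (\<zeta> x * a (\<theta> *\<^sub>R x)) \<partial>lborel)
        = ennreal (\<theta> powr (- real DIM('a))) * (\<integral>\<^sup>+y. ennreal (\<zeta> ((1 / \<theta>) *\<^sub>R y) * a y) \<partial>lborel)"
      using nn_integral_affine[of "\<lambda>y. ennreal (\<zeta> ((1 / \<theta>) *\<^sub>R y) * a y)" \<theta> 0] \<theta> by simp
    \<comment> \<open>The factor \<theta>^(-N) is at least 1; inserting it here as well allows the
      two integrals to be joined before the weights are added.\<close>
    also have "(\<integral>\<^sup>+x. ennreal ((1 - \<zeta> x) * a x) \<partial>lborel) \<le>
        ennreal (\<theta> powr (- real DIM('a))) * (\<integral>\<^sup>+x. ennreal ((1 - \<zeta> x) * a x) \<partial>lborel)"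
      using mult_right_mono[OF ennreal_leI[OF powr_mono2'[of "- DIM('a)" \<theta> 1]]] \<theta> by simp
    also have "ennreal (\<theta> powr (- real DIM('a))) * (\<integral>\<^sup>+x. ennreal ((1 - \<zeta> x) * a x) \<partial>lborel) +
        ennreal (\<theta> powr (- real DIM('a))) * (\<integral>\<^sup>+y. ennreal (\<zeta> ((1 / \<theta>) *\<^sub>R y) * a y) \<partial>lborel)
        = ennreal (\<theta> powr (- real DIM('a))) * (\<integral>\<^sup>+x. ennreal ((1 - \<zeta> x) * a x) + ennreal (\<zeta> ((1 / \<theta>) *\<^sub>R x) * a x) \<partial>lborel)"
      by (subst nn_integral_add) (auto simp: distrib_left)
    also have "\<dots> \<le> ennreal (\<theta> powr (- real DIM('a))) * (\<integral>\<^sup>+x. ennreal (1 + 2 * M * (1 - \<theta>) / \<theta>) * ennreal (a x) \<partial>lborel)"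
    proof (intro mult_left_mono nn_integral_mono)
      fix x
      have "(1 - \<zeta> x) * a x + \<zeta> ((1 / \<theta>) *\<^sub>R x) * a x \<le> (1 + 2 * M * (1 - \<theta>) / \<theta>) * a x"
        using \<zeta>_shift[of x] by (simp add: algebra_simps)
      then have "ennreal ((1 - \<zeta> x) * a x + \<zeta> ((1 / \<theta>) *\<^sub>R x) * a x) \<le> ennreal ((1 + 2 * M * (1 - \<theta>) / \<theta>) * a x)"
        by (rule ennreal_leI)
      then show "ennreal ((1 - \<zeta> x) * a x) + ennreal (\<zeta> ((1 / \<theta>) *\<^sub>R x) * a x) \<le>
          ennreal (1 + 2 * M * (1 - \<theta>) / \<theta>) * ennreal (a x)"
        using \<zeta> a0 M \<theta> by (simp add: ennreal_mult)
    qed simp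
    also have "\<dots> = ennreal (\<theta> powr (- real DIM('a)) * (1 + 2 * M * (1 - \<theta>) / \<theta>)) * E"
      unfolding E_def using M \<theta> by (simp add: nn_integral_cmult ennreal_mult mult.assoc)
    finally show ?thesis by (simp add: add_right_mono)
  qed
  have shift: "(\<integral>\<^sup>+x. ennreal (d x powr p * indicator (cball 0 2) x) \<partial>lborel)
      \<le> ennreal ((2 * \<tau>) powr p * \<theta> powr (- real DIM('a))) * E"
    using nn_integral_dilation_difference[OF sm(1) p \<theta>, of 2]
    by (simp add: E d_def \<tau>_def ennreal_mult ennreal_indicator mult.commute)
  have "dirichlet_energy p UNIV f \<le> (\<integral>\<^sup>+x. ennreal (\<theta> powr (1 - p)) * ennreal ((1 - \<zeta> x) * a x + \<zeta> x * a (\<theta> *\<^sub>R x))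
      + ennreal (\<tau> powr (1 - p) * M powr p) * ennreal (d x powr p * indicator (cball 0 2) x) \<partial>lborel)"
    unfolding dirichlet_energy_def
  proof (intro nn_integral_mono)
    fix x
    show "ennreal (norm (grad f x) powr p) * indicator UNIV x \<le>
      ennreal (\<theta> powr (1 - p)) * ennreal ((1 - \<zeta> x) * a x + \<zeta> x * a (\<theta> *\<^sub>R x))
      + ennreal (\<tau> powr (1 - p) * M powr p) * ennreal (d x powr p * indicator (cball 0 2) x)"
      using ennreal_leI[OF pointwise[of x]] \<zeta> a0
      by (simp add: ennreal_mult[symmetric] ennreal_plus[symmetric] mult.assoc del: ennreal_plus)
  qed
  also have "\<dots> = ennreal (\<theta> powr (1 - p)) * (\<integral>\<^sup>+x. ennreal ((1 - \<zeta> x) * a x + \<zeta> x * a (\<theta> *\<^sub>R x)) \<partial>lborel)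
      + ennreal (\<tau> powr (1 - p) * M powr p) * (\<integral>\<^sup>+x. ennreal (d x powr p * indicator (cball 0 2) x) \<partial>lborel)"
  proof -
    define f1 where "f1 x = ennreal ((1 - \<zeta> x) * a x + \<zeta> x * a (\<theta> *\<^sub>R x))" for x
    define f2 :: "'a \<Rightarrow> ennreal" where "f2 x = ennreal (d x powr p * indicator (cball 0 2) x)" for x
    have [measurable]: "cball (0::'a) 2 \<in> sets borel" by simp
    have [measurable]: "f1 \<in> borel_measurable borel" "f2 \<in> borel_measurable borel"
      unfolding f1_def f2_def by measurable
    show ?thesis
      unfolding f1_def[symmetric] f2_def[symmetric] by (simp add: nn_integral_add nn_integral_cmult)
  qed
  also have "\<dots> \<le> ennreal (\<theta> powr (1 - p)) * (ennreal (\<theta> powr (- real DIM('a)) * (1 + 2 * M * (1 - \<theta>) / \<theta>)) * E)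
      + ennreal (\<tau> powr (1 - p) * M powr p) * (ennreal ((2 * \<tau>) powr p * \<theta> powr (- real DIM('a))) * E)"
    by (intro add_mono mult_left_mono blend shift) auto
  also have "\<dots> = ennreal (\<theta> powr (1 - p) * \<theta> powr (- real DIM('a)) * (1 + 2 * M * (1 - \<theta>) / \<theta>)
      + \<tau> powr (1 - p) * M powr p * ((2 * \<tau>) powr p * \<theta> powr (- real DIM('a)))) * E"
    using M \<theta> by (simp add: ennreal_mult distrib_right mult.assoc)
  also have "\<tau> powr (1 - p) * M powr p * ((2 * \<tau>) powr p * \<theta> powr (- real DIM('a)))
      = (1 - \<theta>) * (2 * M) powr p * \<theta> powr (- real DIM('a))"
    using \<tau> M by (simp add: powr_mult powr_diff \<tau>_def[symmetric])
  finally show ?thesis unfolding f_def E .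
qed

text \<open>Being at least 1 on a slightly smaller ball already costs almost the full capacity of
  the unit ball. The essential point is that one \<theta> serves for all \<psi>.\<close>

lemma capacity_ball_dilation:
  fixes p A :: real
  assumes p: "1 \<le> p" and A: "1 < A"
  obtains \<theta> where "0 < \<theta>" "\<theta> < 1" "\<And>\<psi> :: 'a::euclidean_space \<Rightarrow> real. \<psi> \<in> C0_infinity (ball 0 2) \<Longrightarrow>
    (\<And>x. x \<in> cball 0 \<theta> \<Longrightarrow> 1 \<le> \<psi> x) \<Longrightarrow>
    capacity p (cball (0::'a) 1) (ball 0 2) \<le> ennreal A * dirichlet_energy p UNIV \<psi>"
proof -
  obtain \<zeta> :: "'a \<Rightarrow> real" where \<zeta>: "smooth \<zeta>" "\<And>x. 0 \<le> \<zeta> x" "\<And>x. \<zeta> x \<le> 1"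
    "\<And>x. x \<in> cball 0 1 \<Longrightarrow> \<zeta> x = 1" "\<zeta> \<in> C0_infinity (ball 0 2)"
    using ball_cutoff_exists[of 1 2 "0::'a"] by (metis one_less_numeral_iff semiring_norm(76) zero_less_one)
  obtain M where M: "0 < M" "\<And>x. norm (grad \<zeta> x) \<le> M" using C0_infinity_bounded[OF \<zeta>(5)] by metis
  \<comment> \<open>The factor of \<open>dirichlet_energy_blend_dilation\<close> as a function of
    \<theta>. It is continuous with value 1 at \<theta> = 1, hence below \<open>A\<close> for some
    \<theta> < 1.\<close>
  define g where "g \<theta> = \<theta> powr (1 - p) * \<theta> powr (- real DIM('a)) * (1 + 2 * M * (1 - \<theta>) / \<theta>)
      + (1 - \<theta>) * (2 * M) powr p * \<theta> powr (- real DIM('a))" for \<theta> :: real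
  have "isCont g 1" unfolding g_def by (intro continuous_intros) auto
  moreover have "g 1 = 1" by (simp add: g_def)
  ultimately have "(g \<longlongrightarrow> 1) (at_left 1)"
    by (metis filterlim_at_split isCont_def)
  then have "eventually (\<lambda>\<theta>. g \<theta> < A) (at_left 1)" using A by (rule order_tendstoD)
  moreover have "eventually (\<lambda>\<theta>::real. \<theta> \<in> {0<..<1}) (at_left 1)"
    by (rule eventually_at_left_real) simp
  ultimately obtain \<theta> where \<theta>: "g \<theta> < A" "0 < \<theta>" "\<theta> < 1"
    by (metis (mono_tags, lifting) eventually_conj eventually_happens' greaterThanLessThan_iff trivial_limit_at_left_real)
  show thesis
  proof (rule that[OF \<theta>(2,3)])
    fix \<psi> :: "'a \<Rightarrow> real"
    assume \<psi>: "\<psi> \<in> C0_infinity (ball 0 2)" "\<And>x. x \<in> cball 0 \<theta> \<Longrightarrow> 1 \<le> \<psi> x"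
    define f where "f x = \<psi> x + (\<psi> (0 + \<theta> *\<^sub>R x) - \<psi> x) * \<zeta> x" for x
    have sm: "smooth \<psi>" using \<psi>(1) by (rule C0_infinity_smooth)
    have "f \<in> C0_infinity (ball 0 2)"
      unfolding f_def
      by (rule C0_infinity_add[OF \<psi>(1) C0_infinity_mult[OF smooth_diff[OF smooth_affine[OF sm] sm] \<zeta>(5)]])
    then have "capacity p (cball (0::'a) 1) (ball 0 2) \<le> dirichlet_energy p UNIV f"
    proof (rule capacity_le)
      fix x :: 'a assume x: "x \<in> cball 0 1"
      then have "\<theta> * norm x \<le> \<theta> * 1" using \<theta> by (intro mult_left_mono) auto
      then have "1 \<le> \<psi> (\<theta> *\<^sub>R x)" using \<theta> by (intro \<psi>(2)) simp
      then show "1 \<le> f x" using \<zeta>(4)[OF x] by (simp add: f_def)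
    qed
    also have "\<dots> \<le> ennreal (g \<theta>) * dirichlet_energy p UNIV \<psi>"
      using dirichlet_energy_blend_dilation[OF p \<theta>(2,3) \<psi>(1) \<zeta>(5,2,3) M] unfolding f_def g_def by simp
    also have "\<dots> \<le> ennreal A * dirichlet_energy p UNIV \<psi>"
      using \<theta>(1) by (intro mult_right_mono ennreal_leI) auto
    finally show "capacity p (cball (0::'a) 1) (ball 0 2) \<le> ennreal A * dirichlet_energy p UNIV \<psi>" .
  qed
qed


subsection \<open>The upper bound\<close>

text \<open>The truncated function equals 1 on a whole neighbourhood of the set where \<phi> is at
  least 1, and not just on that set. This makes 1 - \<Phi> vanish near the complement of \<Omega> in
  the unit ball.\<close>

lemma truncated_competitor:
  assumes \<phi>: "\<phi> \<in> C0_infinity E" and p: "1 \<le> p" and \<epsilon>: "0 < \<epsilon>"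
  obtains \<Phi> \<delta> where "\<Phi> \<in> C0_infinity E" "\<And>x. 0 \<le> \<Phi> x" "\<And>x. \<Phi> x \<le> 1" "0 < \<delta>"
    "\<And>x. 1 - \<delta> \<le> \<phi> x \<Longrightarrow> \<Phi> x = 1"
    "dirichlet_energy p UNIV \<Phi> \<le> ennreal ((1 + \<epsilon>) powr p) * dirichlet_energy p UNIV \<phi>"
proof -
  obtain F :: "real \<Rightarrow> real" and \<delta> F' where F: "smooth F" "0 < \<delta>" "\<delta> < 1"
    "\<And>x. x \<le> 0 \<Longrightarrow> F x = 0" "\<And>x. 1 - \<delta> \<le> x \<Longrightarrow> F x = 1" "\<And>x. 0 \<le> F x" "\<And>x. F x \<le> 1"
    "\<And>x. (F has_real_derivative F' x) (at x)" "\<And>x. \<bar>F' x\<bar> \<le> 1 + \<epsilon>"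
    using smooth_truncation_exists[OF \<epsilon>] by metis
  have sm: "smooth \<phi>" using \<phi> by (rule C0_infinity_smooth)
  have [measurable]: "grad \<phi> \<in> borel_measurable borel" using sm by (rule borel_measurable_grad)
  obtain K where K: "compact K" "K \<subseteq> E" "\<And>x. x \<notin> K \<Longrightarrow> \<phi> x = 0" using C0_infinityE[OF \<phi>] by metis
  show thesis
  proof (rule that[of "\<lambda>x. F (\<phi> x)" \<delta>])
    show "(\<lambda>x. F (\<phi> x)) \<in> C0_infinity E"
      by (rule C0_infinityI[OF smooth_compose[OF F(1) sm] K(1,2)]) (simp add: K F)
    have "dirichlet_energy p UNIV (\<lambda>x. F (\<phi> x)) \<le>
        (\<integral>\<^sup>+x. ennreal ((1 + \<epsilon>) powr p) * (ennreal (norm (grad \<phi> x) powr p) * indicator UNIV x) \<partial>lborel)"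
      unfolding dirichlet_energy_def
    proof (intro nn_integral_mono)
      fix x
      have "norm (grad (\<lambda>x. F (\<phi> x)) x) = \<bar>F' (\<phi> x)\<bar> * norm (grad \<phi> x)"
        by (simp add: grad_compose[OF F(8) sm])
      also have "\<dots> \<le> (1 + \<epsilon>) * norm (grad \<phi> x)" by (intro mult_right_mono F) simp
      finally have "norm (grad (\<lambda>x. F (\<phi> x)) x) powr p \<le> ((1 + \<epsilon>) * norm (grad \<phi> x)) powr p"
        using p by (intro powr_mono2) auto
      also have "\<dots> = (1 + \<epsilon>) powr p * norm (grad \<phi> x) powr p" using \<epsilon> by (intro powr_mult)
      finally have "ennreal (norm (grad (\<lambda>x. F (\<phi> x)) x) powr p) \<le> ennreal ((1 + \<epsilon>) powr p * norm (grad \<phi> x) powr p)"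
        by (rule ennreal_leI)
      then show "ennreal (norm (grad (\<lambda>x. F (\<phi> x)) x) powr p) * indicator UNIV x \<le>
          ennreal ((1 + \<epsilon>) powr p) * (ennreal (norm (grad \<phi> x) powr p) * indicator UNIV x)"
        by (simp add: ennreal_mult)
    qed
    also have "\<dots> = ennreal ((1 + \<epsilon>) powr p) * dirichlet_energy p UNIV \<phi>"
      unfolding dirichlet_energy_def by (rule nn_integral_cmult) measurable
    finally show "dirichlet_energy p UNIV (\<lambda>x. F (\<phi> x)) \<le> ennreal ((1 + \<epsilon>) powr p) * dirichlet_energy p UNIV \<phi>" .
  qed (use F in auto)
qed

text \<open>If \<Phi> were close to 1 in L^p on \<open>cball 0 s\<close>, then \<psi> = \<Phi> + (1
  - \<Phi>) \<eta>, which is 1 on the smaller ball of radius \<theta>, would have energy close to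
  that of \<Phi>, hence below what \<open>capacity_ball_dilation\<close> permits. Carrying the
  constants along turns the contradiction into an explicit bound \<open>j\<close>. A radius s < 1
  leaves room for a cutoff inside the unit ball.\<close>

lemma deficiency_lower_bound:
  fixes p g k :: real
  assumes p: "1 \<le> p" and g: "0 < g" "g < 1"
    and k: "capacity p (cball (0::'a::euclidean_space) 1) (ball 0 2) = ennreal k" "0 < k"
  obtains j s where "0 < j" "0 < s" "s < 1"
    "\<And>\<Phi> :: 'a \<Rightarrow> real. \<Phi> \<in> C0_infinity (ball 0 2) \<Longrightarrow> (\<And>x. 0 \<le> \<Phi> x) \<Longrightarrow> (\<And>x. \<Phi> x \<le> 1) \<Longrightarrow>
      dirichlet_energy p UNIV \<Phi> \<le> ennreal (g * k) \<Longrightarrow>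
      ennreal j \<le> (\<integral>\<^sup>+x\<in>cball 0 s. ennreal ((1 - \<Phi> x) powr p) \<partial>lborel)"
proof -
  \<comment> \<open>Two losses of a factor \<open>A\<close> occur, one in the gradient estimate for
    \<psi> and one in the dilation. A third of the available exponent for each keeps
    \<open>A * A * g = g powr (1 / 3)\<close> below 1.\<close>
  define A where "A = g powr (- (1 / 3))"
  have A: "1 < A" using g powr_less_mono2_neg[of "- (1 / 3)" g 1] by (simp add: A_def)
  have A2g: "A * A * g = g powr (1 / 3)"
  proof -
    have "A * A * g = g powr (- (1 / 3)) * g powr (- (1 / 3)) * g powr 1" using g by (simp add: A_def)
    also have "\<dots> = g powr (1 / 3)" by (simp only: powr_add[symmetric]) simp
    finally show ?thesis .
  qed
  then have A2g1: "A * A * g < 1" using g powr_less_mono2[of "1 / 3" g 1] by simp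
  \<comment> \<open>Chosen so that (1 - \<tau>)^(1-p) = A^((p-1)/p), which is at most
    \<open>A\<close>.\<close>
  define \<tau> where "\<tau> = 1 - A powr (- (1 / p))"
  have \<tau>: "0 < \<tau>" "\<tau> < 1"
    using A p powr_less_mono2_neg[of "- (1 / p)" 1 A] by (simp_all add: \<tau>_def)
  have \<tau>A: "(1 - \<tau>) powr (1 - p) \<le> A"
  proof -
    have "(1 - \<tau>) powr (1 - p) = A powr ((- (1 / p)) * (1 - p))" by (simp add: \<tau>_def powr_powr)
    also have "\<dots> \<le> A powr 1" using A p by (intro powr_mono) (auto simp: field_simps)
    finally show ?thesis using A by simp
  qed
  obtain \<theta> where \<theta>: "0 < \<theta>" "\<theta> < 1" "\<And>\<psi> :: 'a \<Rightarrow> real. \<psi> \<in> C0_infinity (ball 0 2) \<Longrightarrow>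
    (\<And>x. x \<in> cball 0 \<theta> \<Longrightarrow> 1 \<le> \<psi> x) \<Longrightarrow>
    capacity p (cball (0::'a) 1) (ball 0 2) \<le> ennreal A * dirichlet_energy p UNIV \<psi>"
    using capacity_ball_dilation[OF p A, where 'a = 'a] by metis
  define s where "s = (1 + \<theta>) / 2"
  have s: "\<theta> < s" "0 < s" "s < 1" using \<theta> by (auto simp: s_def)
  obtain \<eta> :: "'a \<Rightarrow> real" where \<eta>: "smooth \<eta>" "\<And>x. 0 \<le> \<eta> x" "\<And>x. \<eta> x \<le> 1"
    "\<And>x. x \<in> cball 0 \<theta> \<Longrightarrow> \<eta> x = 1" "\<eta> \<in> C0_infinity (ball 0 s)"
    using ball_cutoff_exists[OF \<theta>(1) s(1), of "0::'a"] by metis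
  obtain M where M: "0 < M" "\<And>x. norm (grad \<eta> x) \<le> M" using C0_infinity_bounded[OF \<eta>(5)] by metis
  define D where "D = \<tau> powr (1 - p) * M powr p"
  have D: "0 < D" using \<tau> M by (simp add: D_def)
  \<comment> \<open>Obtained by solving k \<le> A (A g k + D J) for J, where D J is the energy spent
    on raising \<Phi> to 1.\<close>
  define j where "j = (1 - A * A * g) * k / (A * D)"
  show thesis
  proof (rule that[OF _ s(2,3)])
    show "0 < j" using A2g1 k A D by (simp add: j_def)
    fix \<Phi> :: "'a \<Rightarrow> real"
    assume \<Phi>: "\<Phi> \<in> C0_infinity (ball 0 2)" "\<And>x. 0 \<le> \<Phi> x" "\<And>x. \<Phi> x \<le> 1"
      and E: "dirichlet_energy p UNIV \<Phi> \<le> ennreal (g * k)"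
    have sm: "smooth \<Phi>" using \<Phi>(1) by (rule C0_infinity_smooth)
    have sm1: "smooth (\<lambda>x. 1 - \<Phi> x)" by (intro smooth_diff smooth_const sm)
    have [measurable]: "grad \<Phi> \<in> borel_measurable borel" "\<Phi> \<in> borel_measurable borel"
      using sm by (auto intro: borel_measurable_grad borel_measurable_smooth)
    have [measurable]: "cball (0::'a) s \<in> sets borel" by simp
    define J where "J = (\<integral>\<^sup>+x\<in>cball 0 s. ennreal ((1 - \<Phi> x) powr p) \<partial>lborel)"
    define \<psi> where "\<psi> x = \<Phi> x + (1 - \<Phi> x) * \<eta> x" for x
    have "\<eta> \<in> C0_infinity (ball 0 2)" using s by (intro C0_infinity_mono[OF \<eta>(5)]) auto
    then have \<psi>: "\<psi> \<in> C0_infinity (ball 0 2)"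
      unfolding \<psi>_def by (intro C0_infinity_add C0_infinity_mult \<Phi> sm1)
    have g\<psi>: "grad \<psi> x = (1 - \<eta> x) *\<^sub>R grad \<Phi> x + (1 - \<Phi> x) *\<^sub>R grad \<eta> x" for x
      unfolding \<psi>_def
      by (simp only: grad_add[OF sm smooth_mult[OF sm1 \<eta>(1)]] grad_mult[OF sm1 \<eta>(1)]
          grad_diff[OF smooth_const sm] grad_const)
        (simp add: algebra_simps)
    have pointwise: "norm (grad \<psi> x) powr p \<le> A * norm (grad \<Phi> x) powr p
        + D * ((1 - \<Phi> x) powr p * indicator (cball 0 s) x)" for x
    proof -
      define r where "r = M * ((1 - \<Phi> x) * indicator (cball 0 s) x)"
      have "norm (grad \<psi> x) \<le> norm ((1 - \<eta> x) *\<^sub>R grad \<Phi> x) + norm ((1 - \<Phi> x) *\<^sub>R grad \<eta> x)"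
        unfolding g\<psi> by (rule norm_triangle_ineq)
      also have "\<dots> \<le> norm (grad \<Phi> x) + r"
      proof (rule add_mono)
        have "(1 - \<eta> x) * norm (grad \<Phi> x) \<le> 1 * norm (grad \<Phi> x)" using \<eta>(2)[of x] by (intro mult_right_mono) auto
        then show "norm ((1 - \<eta> x) *\<^sub>R grad \<Phi> x) \<le> norm (grad \<Phi> x)" using \<eta>(3)[of x] by simp
        show "norm ((1 - \<Phi> x) *\<^sub>R grad \<eta> x) \<le> r"
        proof (cases "x \<in> ball 0 s")
          case True
          have "(1 - \<Phi> x) * norm (grad \<eta> x) \<le> (1 - \<Phi> x) * M" using \<Phi>(3)[of x] by (intro mult_left_mono M) auto
          then show ?thesis using True \<Phi>(3)[of x] by (simp add: r_def mult.commute)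
        next
          case False
          then have "grad \<eta> x = 0" by (rule C0_infinity_zero[OF \<eta>(5)])
          then show ?thesis using M \<Phi>(3)[of x] by (simp add: r_def)
        qed
      qed
      finally have "norm (grad \<psi> x) powr p \<le> (norm (grad \<Phi> x) + r) powr p"
        using p by (intro powr_mono2) auto
      also have "\<dots> \<le> (1 - \<tau>) powr (1 - p) * norm (grad \<Phi> x) powr p + \<tau> powr (1 - p) * r powr p"
        using p \<tau> M \<Phi>(3)[of x] by (intro powr_add_le_weighted) (auto simp: r_def)
      also have "(1 - \<tau>) powr (1 - p) * norm (grad \<Phi> x) powr p \<le> A * norm (grad \<Phi> x) powr p"
        by (intro mult_right_mono \<tau>A) simp
      also have "\<tau> powr (1 - p) * r powr p = D * ((1 - \<Phi> x) powr p * indicator (cball 0 s) x)"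
        using M \<Phi>(3)[of x] by (auto simp: r_def D_def powr_mult indicator_def)
      finally show ?thesis by simp
    qed
    have "dirichlet_energy p UNIV \<psi> \<le> (\<integral>\<^sup>+x. ennreal A * (ennreal (norm (grad \<Phi> x) powr p) * indicator UNIV x)
        + ennreal D * (ennreal ((1 - \<Phi> x) powr p) * indicator (cball 0 s) x) \<partial>lborel)"
      unfolding dirichlet_energy_def
    proof (intro nn_integral_mono)
      fix x
      show "ennreal (norm (grad \<psi> x) powr p) * indicator UNIV x \<le>
        ennreal A * (ennreal (norm (grad \<Phi> x) powr p) * indicator UNIV x)
        + ennreal D * (ennreal ((1 - \<Phi> x) powr p) * indicator (cball 0 s) x)"
        using ennreal_leI[OF pointwise[of x]] A D by (auto simp: ennreal_mult indicator_def)
    qed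
    also have "\<dots> = ennreal A * dirichlet_energy p UNIV \<Phi> + ennreal D * J"
      unfolding dirichlet_energy_def J_def by (simp add: nn_integral_add nn_integral_cmult)
    also have "\<dots> \<le> ennreal A * ennreal (g * k) + ennreal D * J"
      by (intro add_right_mono mult_left_mono E) simp
    finally have E\<psi>: "dirichlet_energy p UNIV \<psi> \<le> ennreal A * ennreal (g * k) + ennreal D * J" .
    have "ennreal k \<le> ennreal A * dirichlet_energy p UNIV \<psi>"
      unfolding k(1)[symmetric] by (rule \<theta>(3)[OF \<psi>]) (simp add: \<psi>_def \<eta>(4))
    also have "\<dots> \<le> ennreal A * (ennreal A * ennreal (g * k) + ennreal D * J)"
      by (rule mult_left_mono[OF E\<psi>]) simp
    finally have main: "ennreal k \<le> ennreal A * (ennreal A * ennreal (g * k) + ennreal D * J)" .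
    have "ennreal j \<le> J"
    proof (cases J rule: ennreal_cases)
      case (real J')
      have "ennreal k \<le> ennreal (A * (A * (g * k) + D * J'))"
        using main real A D g k by (simp add: ennreal_mult)
      then have "k \<le> A * (A * (g * k) + D * J')"
        using real A D g k by (subst (asm) ennreal_le_iff) auto
      then have "(1 - A * A * g) * k \<le> J' * (A * D)" by (simp add: algebra_simps)
      then have "j \<le> J'" using A D by (simp add: j_def pos_divide_le_eq)
      then show ?thesis using real by (simp add: ennreal_leI)
    qed simp
    then show "ennreal j \<le> (\<integral>\<^sup>+x\<in>cball 0 s. ennreal ((1 - \<Phi> x) powr p) \<partial>lborel)" by (simp add: J_def)
  qed
qed

text \<open>If w^p exceeds \<epsilon>, then w lies between \<epsilon>^(1/p) and 1, so w^(p-q) is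
  bounded whatever the sign of p - q. This transfers a lower bound from L^p to L^q for functions
  with values in [0, 1] on a set of finite measure.\<close>

lemma powr_le_add_powr:
  fixes w \<epsilon> p q :: real
  assumes "0 \<le> w" "w \<le> 1" "0 < \<epsilon>" "0 < p" "0 < q"
  shows "w powr p \<le> \<epsilon> + max 1 (\<epsilon> powr ((p - q) / p)) * w powr q"
proof (cases "w powr p \<le> \<epsilon>")
  case False
  then have w: "0 < w" using assms by (cases "w = 0") auto
  have "w powr (p - q) \<le> max 1 (\<epsilon> powr ((p - q) / p))"
  proof (cases "q \<le> p")
    case True
    then have "w powr (p - q) \<le> 1" using assms by (intro powr_le1) auto
    then show ?thesis by simp
  next
    case q: False
    have "(w powr p) powr ((p - q) / p) \<le> \<epsilon> powr ((p - q) / p)"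
      using False q assms by (intro powr_mono2') (auto simp: divide_nonpos_pos)
    then show ?thesis using assms by (simp add: powr_powr)
  qed
  then have "w powr (p - q) * w powr q \<le> max 1 (\<epsilon> powr ((p - q) / p)) * w powr q"
    by (rule mult_right_mono) simp
  then show ?thesis using assms by (simp add: powr_add[symmetric])
next
  case True
  have "0 \<le> max 1 (\<epsilon> powr ((p - q) / p)) * w powr q" by (intro mult_nonneg_nonneg) auto
  with True show ?thesis by linarith
qed

lemma poincare_sobolev_const_upper_unit:
  fixes p q \<gamma> :: real
  assumes p: "1 \<le> p" and q: "1 \<le> q" and \<gamma>: "0 < \<gamma>" "\<gamma> < 1"
  obtains C where "0 < C" "\<And>\<Omega> :: 'a::euclidean_space set. open \<Omega> \<Longrightarrow>
    capacity_negligible p \<gamma> 0 1 (cball 0 1 - \<Omega>) \<Longrightarrow> poincare_sobolev_const p q \<Omega> \<le> ennreal C"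
proof -
  obtain k where k: "capacity p (cball (0::'a) 1) (ball 0 2) = ennreal k" "0 < k"
  proof -
    obtain c where c: "0 < c" "ennreal c \<le> capacity p (cball (0::'a) 1) (ball 0 2)"
      using capacity_unit_ball_pos[OF p] by metis
    obtain k where "capacity p (cball (0::'a) 1) (ball 0 2) = ennreal k" "0 \<le> k"
      using capacity_unit_ball_finite[OF p, where 'a = 'a] by (metis ennreal_cases infinity_ennreal_def less_irrefl)
    with c that show thesis by auto
  qed
  \<comment> \<open>The gap between \<gamma> and 1 is divided as \<gamma> < h < g < 1: the first
    part pays for a competitor that is only nearly optimal, the second for its truncation, and g < 1
    is what \<open>deficiency_lower_bound\<close> needs.\<close>
  define g where "g = (1 + \<gamma>) / 2"
  define h where "h = (\<gamma> + g) / 2"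
  have "0 < g" "g < 1" "\<gamma> < g" using \<gamma> by (auto simp: g_def)
  then have g: "0 < g" "g < 1" "\<gamma> < h" "h < g" "0 < h" using \<gamma> by (auto simp: h_def)
  \<comment> \<open>Truncation multiplies the energy by at most (1 + \<epsilon>)^p, and this value
    raises the bound from \<open>h * k\<close> exactly to \<open>g * k\<close>.\<close>
  define \<epsilon> where "\<epsilon> = (g / h) powr (1 / p) - 1"
  have \<epsilon>: "0 < \<epsilon>" using g p powr_less_mono2[of "1 / p" 1 "g / h"] by (simp add: \<epsilon>_def)
  have \<epsilon>g: "(1 + \<epsilon>) powr p * h = g" using g p by (simp add: \<epsilon>_def powr_powr)
  obtain j s where j: "0 < j" "0 < s" "s < 1"
    "\<And>\<Phi> :: 'a \<Rightarrow> real. \<Phi> \<in> C0_infinity (ball 0 2) \<Longrightarrow> (\<And>x. 0 \<le> \<Phi> x) \<Longrightarrow> (\<And>x. \<Phi> x \<le> 1) \<Longrightarrow>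
      dirichlet_energy p UNIV \<Phi> \<le> ennreal (g * k) \<Longrightarrow>
      ennreal j \<le> (\<integral>\<^sup>+x\<in>cball 0 s. ennreal ((1 - \<Phi> x) powr p) \<partial>lborel)"
    by (rule deficiency_lower_bound[OF p g(1,2) k]) (rule that; blast)
  obtain \<eta> :: "'a \<Rightarrow> real" where \<eta>: "smooth \<eta>" "\<And>x. 0 \<le> \<eta> x" "\<And>x. \<eta> x \<le> 1"
    "\<And>x. x \<in> cball 0 s \<Longrightarrow> \<eta> x = 1" "\<eta> \<in> C0_infinity (ball 0 1)"
    using ball_cutoff_exists[OF j(2,3), of "0::'a"] by metis
  obtain M where M: "0 < M" "\<And>x. norm (grad \<eta> x) \<le> M" using C0_infinity_bounded[OF \<eta>(5)] by metis
  obtain V where V: "0 < V" "\<And>z::'a. emeasure lborel (cball z 1) = ennreal V"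
    using emeasure_cball_pos[of 1, where 'a = 'a] by (metis zero_less_one)
  \<comment> \<open>The constant \<open>e\<close> integrated over the unit ball uses up half of
    \<open>j\<close>. With \<open>c\<close> the constant of \<open>powr_le_add_powr\<close>
    belonging to \<open>e\<close>, the other half bounds \<open>c\<close> times the q-th moment of
    \<open>v\<close> from below, which gives \<open>i\<^sub>0\<close>.\<close>
  define e where "e = j / (2 * V)"
  define c where "c = max 1 (e powr ((p - q) / p))"
  define i\<^sub>0 where "i\<^sub>0 = j / (2 * c)"
  have c1: "1 \<le> c" by (simp add: c_def)
  have i\<^sub>0: "0 < i\<^sub>0" using j c1 by (simp add: i\<^sub>0_def)
  have e: "0 < e" using j V by (simp add: e_def)
  define D where "D = 2 powr p * (g * k + M powr p * V)"
  have D: "0 < D" using g k V by (simp add: D_def add_pos_nonneg)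
  show thesis
  proof (rule that)
    show "0 < i\<^sub>0 powr (- (p / q)) * D" using D i\<^sub>0 by simp
    fix \<Omega> :: "'a set"
    assume \<Omega>: "open \<Omega>" and neg: "capacity_negligible p \<gamma> 0 1 (cball 0 1 - \<Omega>)"
    have "capacity p (cball 0 1 - \<Omega>) (ball 0 2) \<le> ennreal \<gamma> * ennreal k"
      using neg unfolding capacity_negligible_def by (simp add: k(1))
    also have "\<dots> < ennreal (h * k)"
      using \<gamma> g k by (simp add: ennreal_mult[symmetric] ennreal_lessI)
    finally have "capacity p (cball 0 1 - \<Omega>) (ball 0 2) < ennreal (h * k)" .
    then obtain \<phi> where \<phi>: "\<phi> \<in> C0_infinity (ball 0 2)" "\<And>x. x \<in> cball 0 1 - \<Omega> \<Longrightarrow> 1 \<le> \<phi> x"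
      and "dirichlet_energy p (ball 0 2) \<phi> < ennreal (h * k)"
      unfolding capacity_def INF_less_iff by blast
    then have E\<phi>: "dirichlet_energy p UNIV \<phi> \<le> ennreal (h * k)"
      using dirichlet_energy_eq_UNIV[OF \<phi>(1), of p] by simp
    obtain \<Phi> \<delta> where \<Phi>: "\<Phi> \<in> C0_infinity (ball 0 2)" "\<And>x. 0 \<le> \<Phi> x" "\<And>x. \<Phi> x \<le> 1" and \<delta>: "0 < \<delta>"
      "\<And>x. 1 - \<delta> \<le> \<phi> x \<Longrightarrow> \<Phi> x = 1"
      and "dirichlet_energy p UNIV \<Phi> \<le> ennreal ((1 + \<epsilon>) powr p) * dirichlet_energy p UNIV \<phi>"
      using truncated_competitor[OF \<phi>(1) p \<epsilon>] by metis
    note this(6)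
    also have "ennreal ((1 + \<epsilon>) powr p) * dirichlet_energy p UNIV \<phi> \<le> ennreal ((1 + \<epsilon>) powr p) * ennreal (h * k)"
      by (rule mult_left_mono[OF E\<phi>]) simp
    also have "\<dots> = ennreal (g * k)" using g k by (simp add: ennreal_mult[symmetric] \<epsilon>g[symmetric] mult.assoc)
    finally have E\<Phi>: "dirichlet_energy p UNIV \<Phi> \<le> ennreal (g * k)" .
    have sm\<phi>: "smooth \<phi>" using \<phi>(1) by (rule C0_infinity_smooth)
    have sm: "smooth \<Phi>" using \<Phi>(1) by (rule C0_infinity_smooth)
    have sm1: "smooth (\<lambda>x. 1 - \<Phi> x)" by (intro smooth_diff smooth_const sm)
    have [measurable]: "grad \<Phi> \<in> borel_measurable borel" "\<Phi> \<in> borel_measurable borel"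
      using sm by (auto intro: borel_measurable_grad borel_measurable_smooth)
    have [measurable]: "cball (0::'a) 1 \<in> sets borel" by simp
    have [measurable]: "\<eta> \<in> borel_measurable borel" using \<eta>(1) by (rule borel_measurable_smooth)
    define v where "v x = (1 - \<Phi> x) * \<eta> x" for x
    have smv: "smooth v" unfolding v_def by (intro smooth_mult sm1 \<eta>(1))
    obtain L where L: "compact L" "L \<subseteq> ball 0 1" "\<And>x. x \<notin> L \<Longrightarrow> \<eta> x = 0" using C0_infinityE[OF \<eta>(5)] by metis
    have v: "v \<in> C0_infinity \<Omega>"
    proof (rule C0_infinityI[OF smv])
      have "closed {x. \<phi> x \<le> 1 - \<delta>}"
        by (intro closed_Collect_le smooth_continuous_on[OF sm\<phi>] continuous_on_const)
      \<comment> \<open>The margin \<delta> pays off here: the set where \<phi> < 1 need not be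
        closed, but this one is, and \<open>v\<close> still vanishes outside it. Within the unit
        ball \<phi> is at least 1 off \<Omega>, so the set lies in \<Omega>.\<close>
      then show "compact (L \<inter> {x. \<phi> x \<le> 1 - \<delta>})" by (rule compact_Int_closed[OF L(1)])
      show "L \<inter> {x. \<phi> x \<le> 1 - \<delta>} \<subseteq> \<Omega>"
      proof
        fix x assume x: "x \<in> L \<inter> {x. \<phi> x \<le> 1 - \<delta>}"
        then have "x \<in> cball 0 1" using L(2) by auto
        then show "x \<in> \<Omega>" using \<phi>(2)[of x] \<delta>(1) x by fastforce
      qed
      show "v x = 0" if "x \<notin> L \<inter> {x. \<phi> x \<le> 1 - \<delta>}" for x
        using that L(3)[of x] \<delta>(2)[of x] by (auto simp: v_def)
    qed
    have v01: "0 \<le> v x" "v x \<le> 1" for x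
      using \<Phi>(2,3)[of x] \<eta>(2,3)[of x] by (auto simp: v_def intro: mult_le_one)
    define I where "I = (\<integral>\<^sup>+x. ennreal (\<bar>v x\<bar> powr q) \<partial>lborel)"
    have [measurable]: "v \<in> borel_measurable borel" using smv by (rule borel_measurable_smooth)
    \<comment> \<open>Only finiteness is needed: it allows the extended integral to be replaced by
      the real number \<open>i\<close> used for the normalisation.\<close>
    have I_le: "I \<le> ennreal V"
    proof -
      have "I \<le> (\<integral>\<^sup>+x. indicator (cball (0::'a) 1) x \<partial>lborel)"
        unfolding I_def
      proof (rule nn_integral_mono)
        fix x :: 'a
        have "\<bar>v x\<bar> powr q \<le> 1" using v01[of x] q by (intro powr_le1) auto
        moreover have "v x = 0" if "x \<notin> cball 0 1"
          using that C0_infinity_zero(1)[OF \<eta>(5), of x] by (simp add: v_def)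
        ultimately show "ennreal (\<bar>v x\<bar> powr q) \<le> indicator (cball 0 1) x"
          by (cases "x \<in> cball 0 1") (auto simp: indicator_def ennreal_le_1)
      qed
      then show ?thesis using V by simp
    qed
    then obtain i where i: "I = ennreal i" "0 \<le> i" by (cases I rule: ennreal_cases) (auto simp: top_unique)
    have "ennreal j \<le> (\<integral>\<^sup>+x\<in>cball 0 s. ennreal ((1 - \<Phi> x) powr p) \<partial>lborel)"
      by (rule j(4)[OF \<Phi> E\<Phi>])
    also have "\<dots> \<le> (\<integral>\<^sup>+x. ennreal e * indicator (cball 0 1) x + ennreal c * ennreal (\<bar>v x\<bar> powr q) \<partial>lborel)"
    proof (intro nn_integral_mono)
      fix x :: 'a
      show "ennreal ((1 - \<Phi> x) powr p) * indicator (cball 0 s) x \<le>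
          ennreal e * indicator (cball 0 1) x + ennreal c * ennreal (\<bar>v x\<bar> powr q)"
      proof (cases "x \<in> cball 0 s")
        case True
        then have "x \<in> cball 0 1" using j by auto
        moreover have "v x = 1 - \<Phi> x" using \<eta>(4)[OF True] by (simp add: v_def)
        moreover have "ennreal (v x powr p) \<le> ennreal (e + c * v x powr q)"
          unfolding c_def using v01[of x] e p q by (intro ennreal_leI powr_le_add_powr) auto
        ultimately show ?thesis using True v01[of x] e c1 by (simp add: ennreal_mult)
      qed simp
    qed
    also have "\<dots> = ennreal e * ennreal V + ennreal c * I"
      by (simp add: nn_integral_add nn_integral_cmult nn_integral_cmult_indicator V(2) I_def)
    also have "\<dots> = ennreal (j / 2 + c * i)"
      using i e V c1 j by (simp add: ennreal_mult[symmetric] e_def)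
    finally have "j \<le> j / 2 + c * i"
      using i c1 j by (subst (asm) ennreal_le_iff) auto
    then have ii: "i\<^sub>0 \<le> i" using c1 by (simp add: i\<^sub>0_def field_simps)
    have gv: "grad v x = (1 - \<Phi> x) *\<^sub>R grad \<eta> x - \<eta> x *\<^sub>R grad \<Phi> x" for x
      unfolding v_def
      by (simp only: grad_mult[OF sm1 \<eta>(1)] grad_diff[OF smooth_const sm] grad_const) simp
    have pointwise: "norm (grad v x) powr p \<le>
        2 powr p * (norm (grad \<Phi> x) powr p + M powr p * indicator (cball 0 1) x)" for x
    proof -
      have "norm (grad v x) \<le> norm ((1 - \<Phi> x) *\<^sub>R grad \<eta> x) + norm (\<eta> x *\<^sub>R grad \<Phi> x)"
        unfolding gv by (rule norm_triangle_ineq4)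
      also have "\<dots> \<le> M * indicator (cball 0 1) x + norm (grad \<Phi> x)"
      proof (rule add_mono)
        show "norm ((1 - \<Phi> x) *\<^sub>R grad \<eta> x) \<le> M * indicator (cball 0 1) x"
        proof (cases "x \<in> ball 0 1")
          case True
          have "\<bar>1 - \<Phi> x\<bar> * norm (grad \<eta> x) \<le> 1 * M" using \<Phi>(2,3)[of x] M by (intro mult_mono) auto
          then show ?thesis using True by simp
        next
          case False
          then have "grad \<eta> x = 0" by (rule C0_infinity_zero[OF \<eta>(5)])
          then show ?thesis using M by simp
        qed
        have "\<eta> x * norm (grad \<Phi> x) \<le> 1 * norm (grad \<Phi> x)" using \<eta>(3)[of x] by (intro mult_right_mono) auto
        then show "norm (\<eta> x *\<^sub>R grad \<Phi> x) \<le> norm (grad \<Phi> x)" using \<eta>(2)[of x] by simp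
      qed
      finally have "norm (grad v x) powr p \<le> (norm (grad \<Phi> x) + M * indicator (cball 0 1) x) powr p"
        using p by (intro powr_mono2) (auto simp: add.commute)
      also have "\<dots> \<le> 2 powr p * (norm (grad \<Phi> x) powr p + (M * indicator (cball 0 1) x) powr p)"
        using p M by (intro powr_add_le) auto
      also have "(M * indicator (cball 0 1) x) powr p = M powr p * indicator (cball 0 1) x"
        by (simp add: indicator_def)
      finally show ?thesis .
    qed
    have "dirichlet_energy p UNIV v \<le> (\<integral>\<^sup>+x. ennreal (2 powr p) * (ennreal (norm (grad \<Phi> x) powr p) * indicator UNIV x
        + ennreal (M powr p) * indicator (cball 0 1) x) \<partial>lborel)"
      unfolding dirichlet_energy_def
    proof (intro nn_integral_mono)
      fix x
      show "ennreal (norm (grad v x) powr p) * indicator UNIV x \<le>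
        ennreal (2 powr p) * (ennreal (norm (grad \<Phi> x) powr p) * indicator UNIV x + ennreal (M powr p) * indicator (cball 0 1) x)"
        using ennreal_leI[OF pointwise[of x]] by (auto simp: ennreal_mult indicator_def)
    qed
    also have "\<dots> = ennreal (2 powr p) * (dirichlet_energy p UNIV \<Phi> + ennreal (M powr p) * ennreal V)"
      unfolding dirichlet_energy_def
      by (simp add: nn_integral_add nn_integral_cmult nn_integral_cmult_indicator V(2))
    also have "\<dots> \<le> ennreal (2 powr p) * (ennreal (g * k) + ennreal (M powr p) * ennreal V)"
      by (intro mult_left_mono add_right_mono E\<Phi>) simp
    also have "\<dots> = ennreal D" using g k V by (simp add: D_def ennreal_mult)
    finally have Ev: "dirichlet_energy p UNIV v \<le> ennreal D" .
    have "poincare_sobolev_const p q \<Omega> \<le> ennreal (i powr (- (p / q))) * dirichlet_energy p UNIV v"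
      using i i\<^sub>0 ii by (intro poincare_sobolev_const_le[OF v q]) (auto simp: I_def)
    also have "\<dots> \<le> ennreal (i\<^sub>0 powr (- (p / q))) * ennreal D"
      using i\<^sub>0 ii p q by (intro mult_mono Ev ennreal_leI powr_mono2') auto
    finally show "poincare_sobolev_const p q \<Omega> \<le> ennreal (i\<^sub>0 powr (- (p / q)) * D)"
      using D by (simp add: ennreal_mult)
  qed
qed

subsection \<open>The main theorem\<close>

theorem theorem6p1:
  fixes p q N :: real
  defines "N \<equiv> real CARD('n::finite)"
  assumes "CARD('n) \<ge> 2"
    and "1 \<le> p" and "p \<le> N"
    and "1 \<le> q" and "p < N \<Longrightarrow> q < N * p / (N - p)"
  shows "(\<forall>\<gamma>. 0 < \<gamma> \<and> \<gamma> < 1 \<longrightarrow>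
            (\<exists>C>0. \<forall>\<Omega> :: (real ^ 'n) set. open \<Omega> \<longrightarrow>
               poincare_sobolev_const p q \<Omega>
                 \<le> ennreal C * ennpowr (1 / capacitary_inradius p \<gamma> \<Omega>) (p - N + N * (p / q))))
       \<and> (p \<le> q \<longrightarrow>
            (\<exists>\<sigma>>0. \<forall>\<gamma>. 0 < \<gamma> \<and> \<gamma> < 1 \<longrightarrow> (\<forall>\<Omega> :: (real ^ 'n) set. open \<Omega> \<longrightarrow>
               ennreal (\<gamma> * \<sigma>) * ennpowr (1 / capacitary_inradius p \<gamma> \<Omega>) (p - N + N * (p / q))
                 \<le> poincare_sobolev_const p q \<Omega>)))"
proof -
  have N: "N = real DIM(real ^ 'n)" by (simp add: N_def)
  have p: "1 \<le> p" and q: "1 \<le> q" by fact+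
  \<comment> \<open>Both cases of the hypothesis on \<open>q\<close> collapse to one inequality. It
    is equivalent to \<kappa> > 0, and equally to the integrability condition \<alpha> < 1 for the
    weight in the Poincare-Sobolev inequality.\<close>
  have gap: "N * (q - p) < p * q"
  proof (cases "p < N")
    case True
    then have "q * (N - p) < N * p" using assms(6) by (simp add: pos_less_divide_eq)
    then show ?thesis by (simp add: algebra_simps)
  next
    case False
    then have "N = p" using assms(4) by simp
    then show ?thesis using p by (simp add: algebra_simps)
  qed
  have sub: "N * (1 / p - 1 / q) < 1"
    using gap p q by (simp add: field_simps)
  define \<kappa> where "\<kappa> = p - N + N * (p / q)"
  have "\<kappa> = (p * q - N * (q - p)) / q" using q by (simp add: \<kappa>_def field_simps)
  then have \<kappa>: "0 < \<kappa>" using gap q by simp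
  show ?thesis unfolding \<kappa>_def[symmetric]
  proof (intro conjI allI impI)
    fix \<gamma> :: real assume \<gamma>: "0 < \<gamma> \<and> \<gamma> < 1"
    obtain C where C: "0 < C" "\<And>\<Omega> :: (real ^ 'n) set. open \<Omega> \<Longrightarrow>
        capacity_negligible p \<gamma> 0 1 (cball 0 1 - \<Omega>) \<Longrightarrow> poincare_sobolev_const p q \<Omega> \<le> ennreal C"
      using poincare_sobolev_const_upper_unit[OF p q, of \<gamma>, where 'a = "real ^ 'n"] \<gamma> by metis
    show "\<exists>C>0. \<forall>\<Omega> :: (real ^ 'n) set. open \<Omega> \<longrightarrow>
        poincare_sobolev_const p q \<Omega> \<le> ennreal C * ennpowr (1 / capacitary_inradius p \<gamma> \<Omega>) \<kappa>"
      using C \<kappa> by (intro exI[of _ C] conjI allI impI capacitary_inradius_upper[OF p q C(1)])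
        (auto simp: \<kappa>_def N)
  next
    assume pq: "p \<le> q"
    obtain \<sigma> where \<sigma>: "0 < \<sigma>" "\<And>\<gamma> (\<Omega> :: (real ^ 'n) set). 0 < \<gamma> \<Longrightarrow> \<gamma> < 1 \<Longrightarrow> open \<Omega> \<Longrightarrow>
        (\<And>x\<^sub>0. \<not> capacity_negligible p \<gamma> x\<^sub>0 1 (cball x\<^sub>0 1 - \<Omega>)) \<Longrightarrow>
        ennreal (\<gamma> * \<sigma>) \<le> poincare_sobolev_const p q \<Omega>"
      using poincare_sobolev_const_lower_unit[OF p pq sub[unfolded N]] by metis
    show "\<exists>\<sigma>>0. \<forall>\<gamma>. 0 < \<gamma> \<and> \<gamma> < 1 \<longrightarrow> (\<forall>\<Omega> :: (real ^ 'n) set. open \<Omega> \<longrightarrow>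
        ennreal (\<gamma> * \<sigma>) * ennpowr (1 / capacitary_inradius p \<gamma> \<Omega>) \<kappa> \<le> poincare_sobolev_const p q \<Omega>)"
      using \<sigma> \<kappa> by (intro exI[of _ \<sigma>] conjI allI impI capacitary_inradius_lower[OF p q])
        (auto simp: \<kappa>_def N)
  qed
qed

end
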